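(* There is a polynomial-time algorithm that approximates the Simultaneous Boxes Class Cover problem (SBCC) within a constant factor; that is, there exist a constant $C\ge 1$ and a polynomial-time algorithm which, given any finite set $S$ of red and blue points in the plane, outputs an SBCC of $S$ of size at most $C$ times the minimum size of an SBCC of $S$.
   Context: All boxes are closed, bounded, axis-aligned rectangles in the plane with non-empty interior. A box covers a point $p$ if $p$ lies in the interior of the box. An SBCC (simultaneous boxes class cover) of a finite set $S$ of points in the plane, each colored red or blue, is a finite set of axis-aligned boxes such that every point of $S$ is covered by some box of the set, every box of the set covers only points of one color, and no box covering a red point intersects the interior of a box covering a blue point. Its size is its number of boxes. The problem SBCC asks, given $S$, for an SBCC of $S$ of minimum size. *)

theory Defs
  imports "HOL-Analysis.Analysis" "HOL-Computational_Algebra.Polynomial"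
begin

type_synonym point = "real \<times> real"

datatype color = Red | Blue

definition is_box :: "point set \<Rightarrow> bool" where
  "is_box B \<longleftrightarrow> (\<exists>a b. B = cbox a b) \<and> interior B \<noteq> {}"

definition covers :: "point set \<Rightarrow> point \<Rightarrow> bool" where
  "covers B p \<longleftrightarrow> p \<in> interior B"

(* The colored point set is a set S together with a coloring, which is only consulted on S. *)
definition is_sbcc :: "point set \<Rightarrow> (point \<Rightarrow> color) \<Rightarrow> point set set \<Rightarrow> bool" where
  "is_sbcc S col \<B> \<longleftrightarrow>
     finite \<B> \<and> (\<forall>B\<in>\<B>. is_box B) \<and>
     (\<forall>p\<in>S. \<exists>B\<in>\<B>. covers B p) \<and>
     (\<forall>B\<in>\<B>. \<forall>p\<in>S. \<forall>q\<in>S. covers B p \<and> covers B q \<longrightarrow> col p = col q) \<and>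
     (\<forall>B\<in>\<B>. \<forall>B'\<in>\<B>.
        (\<exists>p\<in>S. col p = Red \<and> covers B p) \<and> (\<exists>q\<in>S. col q = Blue \<and> covers B' q)
        \<longrightarrow> B \<inter> interior B' = {})"

definition min_sbcc_size :: "point set \<Rightarrow> (point \<Rightarrow> color) \<Rightarrow> nat" where
  "min_sbcc_size S col = (LEAST k. \<exists>\<B>. is_sbcc S col \<B> \<and> card \<B> = k)"

(* Algorithms are programs of a random access machine with two memories, one for natural numbers
   (also used as addresses) and one for real numbers. Each memory consists of arrays, addressed by
   a name fixed in the program and a computed index; a scalar variable is the cell 0 of an array.

   Every executed assignment and every evaluated test takes one unit of time. Expressions are
   part of the program text, so charging for each of their operations instead would change the
   running time only by a constant factor depending on the program.

   The arithmetic is chosen such that polynomial time in this model is polynomial time both on the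
   real RAM and, for rational inputs, on Turing machines. There is no unit-cost multiplication:
   naturals can only be added and subtracted, reals can only be added, subtracted and scaled by
   rational literals, so that all numbers occurring within t steps on rational inputs of total
   bit length L have bit length O(L + t)
   (the constant depends on the program). Real literals are rational, so a program cannot contain
   an infinite amount of information, and there is no rounding from reals to naturals. *)

type_synonym vname = string

datatype iexp = INum nat | ICell vname iexp | IAdd iexp iexp | ISub iexp iexp

datatype rexp = RNum rat | RCell vname iexp | RAdd rexp rexp | RSub rexp rexp | RScale rat rexp

datatype bexp = ILess iexp iexp | RLess rexp rexp | BNot bexp | BAnd bexp bexp

datatype com =
    Skip
  | IAssign vname iexp iexp  (* array, index, value *)
  | RAssign vname iexp rexp
  | Seq com com
  | If bexp com com
  | While bexp com

record state =
  imem :: "vname \<Rightarrow> nat \<Rightarrow> nat"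
  rmem :: "vname \<Rightarrow> nat \<Rightarrow> real"

fun ival :: "iexp \<Rightarrow> state \<Rightarrow> nat" where
  "ival (INum k) s = k"
| "ival (ICell a e) s = imem s a (ival e s)"
| "ival (IAdd e f) s = ival e s + ival f s"
| "ival (ISub e f) s = ival e s - ival f s"

fun rval :: "rexp \<Rightarrow> state \<Rightarrow> real" where
  "rval (RNum q) s = of_rat q"
| "rval (RCell a e) s = rmem s a (ival e s)"
| "rval (RAdd e f) s = rval e s + rval f s"
| "rval (RSub e f) s = rval e s - rval f s"
| "rval (RScale q e) s = of_rat q * rval e s"

fun bval :: "bexp \<Rightarrow> state \<Rightarrow> bool" where
  "bval (ILess e f) s \<longleftrightarrow> ival e s < ival f s"
| "bval (RLess e f) s \<longleftrightarrow> rval e s < rval f s"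
| "bval (BNot b) s \<longleftrightarrow> \<not> bval b s"
| "bval (BAnd b c) s \<longleftrightarrow> bval b s \<and> bval c s"

definition iupdate :: "vname \<Rightarrow> nat \<Rightarrow> nat \<Rightarrow> state \<Rightarrow> state" where
  "iupdate a i v s = s\<lparr>imem := (imem s)(a := (imem s a)(i := v))\<rparr>"

definition rupdate :: "vname \<Rightarrow> nat \<Rightarrow> real \<Rightarrow> state \<Rightarrow> state" where
  "rupdate a i v s = s\<lparr>rmem := (rmem s)(a := (rmem s a)(i := v))\<rparr>"

(* exec c s t s': started in state s, the program c halts after t time units in state s'.
   A diverging run has no derivation. *)
inductive exec :: "com \<Rightarrow> state \<Rightarrow> nat \<Rightarrow> state \<Rightarrow> bool" where
  Skip: "exec Skip s 0 s"
| IAssign: "exec (IAssign a i e) s 1 (iupdate a (ival i s) (ival e s) s)"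
| RAssign: "exec (RAssign a i e) s 1 (rupdate a (ival i s) (rval e s) s)"
| Seq: "exec c s t s' \<Longrightarrow> exec d s' u s'' \<Longrightarrow> exec (Seq c d) s (t + u) s''"
| IfTrue: "bval b s \<Longrightarrow> exec c s t s' \<Longrightarrow> exec (If b c d) s (Suc t) s'"
| IfFalse: "\<not> bval b s \<Longrightarrow> exec d s t s' \<Longrightarrow> exec (If b c d) s (Suc t) s'"
| WhileFalse: "\<not> bval b s \<Longrightarrow> exec (While b c) s 1 s"
| WhileTrue: "bval b s \<Longrightarrow> exec c s t s' \<Longrightarrow> exec (While b c) s' u s'' \<Longrightarrow>
    exec (While b c) s (Suc (t + u)) s''"

inductive_cases exec_SkipE: "exec Skip s t s'"
inductive_cases exec_IAssignE: "exec (IAssign a i e) s t s'"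
inductive_cases exec_RAssignE: "exec (RAssign a i e) s t s'"
inductive_cases exec_SeqE: "exec (Seq c d) s t s'"
inductive_cases exec_IfE: "exec (If b c d) s t s'"
inductive_cases exec_WhileE: "exec (While b c) s t s'"

lemma exec_deterministic:
  "exec c s t s' \<Longrightarrow> exec c s u s'' \<Longrightarrow> t = u \<and> s' = s''"
proof (induction arbitrary: u s'' rule: exec.induct)
  case Skip
  then show ?case by (auto elim: exec_SkipE)
next
  case IAssign
  then show ?case by (auto elim: exec_IAssignE)
next
  case RAssign
  then show ?case by (auto elim: exec_RAssignE)
next
  case Seq
  from Seq.prems show ?case by (rule exec_SeqE) (use Seq.IH in metis)
next
  case IfTrue
  from IfTrue.prems show ?case
    by (rule exec_IfE) (use IfTrue.hyps IfTrue.IH in metis)+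
next
  case IfFalse
  from IfFalse.prems show ?case
    by (rule exec_IfE) (use IfFalse.hyps IfFalse.IH in metis)+
next
  case WhileFalse
  from WhileFalse.prems show ?case
    by (rule exec_WhileE) (use WhileFalse.hyps in auto)
next
  case WhileTrue
  from WhileTrue.prems show ?case
    by (rule exec_WhileE) (use WhileTrue.hyps WhileTrue.IH in metis)+
qed

(* Input: the number of points in n, the i-th point in x[i], y[i], and its color in color[i]
   (0 for red, 1 for blue); every other cell is 0. *)
definition input_state :: "point list \<Rightarrow> (point \<Rightarrow> color) \<Rightarrow> state" where
  "input_state ps col =
     \<lparr>imem = (\<lambda>a i.
         if a = ''n'' \<and> i = 0 then length ps
         else if a = ''color'' \<and> i < length ps then (case col (ps ! i) of Red \<Rightarrow> 0 | Blue \<Rightarrow> 1)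
         else 0),
      rmem = (\<lambda>a i.
         if a = ''x'' \<and> i < length ps then fst (ps ! i)
         else if a = ''y'' \<and> i < length ps then snd (ps ! i)
         else 0)\<rparr>"

(* Output: the boxes [x1[i], x2[i]] \<times> [y1[i], y2[i]] for all i < m, where m is the cell 0 of
   the array m. *)
definition output_boxes :: "state \<Rightarrow> point set set" where
  "output_boxes s =
     (\<lambda>i. cbox (rmem s ''x1'' i, rmem s ''y1'' i) (rmem s ''x2'' i, rmem s ''y2'' i))
       ` {..<imem s ''m'' 0}"

end

theory Submission
  imports Defs
begin

text \<open>
The program computes a cheapest recursive tiling of a rectangle containing all points into
monochromatic rectangles, where each step cuts a rectangle into the five pieces of a pinwheel
(guillotine cuts are degenerate pinwheels) along lines through the gaps between the coordinates of
the points. This is a dynamic program over the polynomially many rectangles spanned by these lines.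

Conversely, \<open>k\<close> boxes of an SBCC yield such a tiling of size \<open>O(k)\<close>. Call a box through in a
rectangle if it crosses the rectangle from side to side. If all through boxes have the same colour,
there is a cut such that corners or sides of boxes are lost on its walls and such that, apart from
boxes paid for by these losses, the through boxes of each piece change colour at most once. Since every
box has boundedly many corners and sides, the cuts are paid for. The cut is a straight line unless boxes
of both colours reach in deeply from all four sides; if these four bundles turn around a centre, the walls
of a pinwheel are obtained by extending each bundle until boxes of both colours block it.
\<close>

subsection \<open>Tilings and coloured boxes\<close>

text \<open>Through boxes cannot pay for cuts: a line between two of them may lose no feature. Hence
  the invariant that all through boxes of a rectangle have one colour. A piece whose through boxes
  change colour once, apart from k exceptions, is brought back to the invariant by O(k + 1) straight
  cuts, and the exceptions are boxes that lost a feature on the walls just drawn. Five pieces at 6 +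
  20 k each and the split itself cost 31 + 100 k, while at least k features, and at least one, are
  gone: 130 per feature balances this. Nine features per box, and 20 per box for a root whose
  through boxes are arbitrary, make 1190 per box; the first box absorbs the remaining 6, which gives
  1196.

  Sides count as features because a box may run across the centre of a pinwheel with all its corners
  in the sails. The number of rounds of the program is the largest cost that matters, and this is
  linear in the number of points, because tiny boxes around the points yield a tiling of such a
  cost.\<close>

type_synonym 'a quad = "'a \<times> 'a \<times> 'a \<times> 'a"

(* A quadruple is a rectangle, x-range first. The pieces are the bottom, right, top and left sails of the
   pinwheel and its centre (e, f, g, h); the other orientation is obtained by transposition. *)
fun wheel :: "'a quad \<Rightarrow> 'a quad \<Rightarrow> 'a quad list" where
  "wheel (a, b, c, d) (e, f, g, h) =
     [(a, f, c, g), (f, b, c, h), (e, b, h, d), (a, e, g, d), (e, f, g, h)]"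

fun flip :: "'a quad \<Rightarrow> 'a quad" where
  "flip (a, b, c, d) = (c, d, a, b)"

definition pieces :: "bool \<Rightarrow> 'a quad \<Rightarrow> 'a quad \<Rightarrow> 'a quad list" where
  "pieces w Q W = (if w then wheel Q W else map flip (wheel (flip Q) (flip W)))"

fun fits :: "real quad \<Rightarrow> real quad \<Rightarrow> bool" where
  "fits (a, b, c, d) (e, f, g, h) \<longleftrightarrow> a \<le> e \<and> e \<le> f \<and> f \<le> b \<and> c \<le> g \<and> g \<le> h \<and> h \<le> d"

text \<open>The cost counts splits as well as leaves, so each piece is strictly cheaper than the
  whole; the rounds of the dynamic program rest on this. The weak inequalities of
  \<open>fits\<close> admit pieces of zero width, which turns straight cuts into splits.\<close>

inductive tiling :: "(real quad \<Rightarrow> bool) \<Rightarrow> real set \<Rightarrow> real set \<Rightarrow> real quad \<Rightarrow> nat \<Rightarrow> bool"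
  for ok GX GY where
  leaf: "ok Q \<Longrightarrow> 1 \<le> n \<Longrightarrow> tiling ok GX GY Q n"
| split: "fits Q W \<Longrightarrow> W \<in> GX \<times> GX \<times> GY \<times> GY \<Longrightarrow> (\<forall>K\<in>set (pieces w Q W). tiling ok GX GY K (f K)) \<Longrightarrow>
    1 + sum_list (map f (pieces w Q W)) \<le> n \<Longrightarrow> tiling ok GX GY Q n"

lemma flip_flip [simp]: "flip (flip Q) = Q"
  by (cases Q) auto

lemma tiling_mono: "tiling ok GX GY Q n \<Longrightarrow> n \<le> m \<Longrightarrow> tiling ok GX GY Q m"
  by (erule tiling.cases) (auto intro: tiling.leaf tiling.split)

lemma pieces_flip: "pieces w (flip Q) (flip W) = map flip (pieces (\<not> w) Q W)"
proof -
  have "flip \<circ> flip = (id :: 'a quad \<Rightarrow> 'a quad)" by auto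
  then show ?thesis by (simp add: pieces_def)
qed

lemma fits_flip [simp]: "fits (flip Q) (flip W) = fits Q W"
  by (cases Q; cases W) auto

text \<open>Transposition exchanges the two orientations of the pinwheel and otherwise preserves
  tilings. Arguments about one direction or one orientation thus cover the other.\<close>

lemma tiling_flip:
  assumes "tiling ok GX GY Q n"
  shows "tiling (ok \<circ> flip) GY GX (flip Q) n"
  using assms
proof induction
  case (leaf Q n)
  then show ?case by (auto intro: tiling.leaf)
next
  case (split Q W w f n)
  show ?case
  proof (rule tiling.split[where W = "flip W" and w = "\<not> w" and f = "f \<circ> flip"])
    show "fits (flip Q) (flip W)" using split by simp
    show "flip W \<in> GY \<times> GY \<times> GX \<times> GX" using split by (cases W) auto
    show "\<forall>K\<in>set (pieces (\<not> w) (flip Q) (flip W)). tiling (ok \<circ> flip) GY GX K ((f \<circ> flip) K)"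
      using split by (simp add: pieces_flip o_def)
    show "1 + sum_list (map (f \<circ> flip) (pieces (\<not> w) (flip Q) (flip W))) \<le> n"
      using split by (simp add: pieces_flip o_def)
  qed
qed

lemma tiling_flip_iff: "tiling (ok \<circ> flip) GY GX (flip Q) n \<longleftrightarrow> tiling ok GX GY Q n"
proof
  assume "tiling (ok \<circ> flip) GY GX (flip Q) n"
  then have "tiling (ok \<circ> flip \<circ> flip) GX GY (flip (flip Q)) n" by (rule tiling_flip)
  moreover have "ok \<circ> flip \<circ> flip = ok" by auto
  ultimately show "tiling ok GX GY Q n" by simp
qed (rule tiling_flip)

lemma ex_argmin:
  fixes f :: "'a \<Rightarrow> real"
  assumes "finite A" "A \<noteq> {}"
  shows "\<exists>i\<in>A. \<forall>j\<in>A. f i \<le> f j"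
proof -
  have "Min (f ` A) \<in> f ` A" using assms by (intro Min_in) auto
  then obtain i where "i \<in> A" "Min (f ` A) = f i" by auto
  moreover have "Min (f ` A) \<le> f j" if "j \<in> A" for j using assms that by (intro Min_le) auto
  ultimately show ?thesis by metis
qed

lemma two_colors: "a \<noteq> c \<Longrightarrow> b \<noteq> c \<Longrightarrow> a = (b::color)"
  by (cases a; cases b; cases c) auto

text \<open>Of the two colours, each with its element of largest \<open>k\<close>, \<open>p\<close>
  belongs to the one that falls short. Up to \<open>k p\<close> both colours are present, beyond it
  only one. In this form the lemma places the walls: a wall at \<open>k p\<close> is crossed by one
  colour only.\<close>

lemma two_max:
  fixes k :: "'a \<Rightarrow> real" and hue :: "'a \<Rightarrow> color"
  assumes A: "finite A" and n: "\<not> (\<exists>c. \<forall>i\<in>A. hue i = c)"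
  obtains p j where "p \<in> A" "\<And>i. i \<in> A \<Longrightarrow> hue i = hue p \<Longrightarrow> k i \<le> k p" "j \<in> A" "hue j \<noteq> hue p" "k p \<le> k j"
proof -
  have "\<exists>p. p \<in> A \<and> hue p = c \<and> (\<forall>i\<in>A. hue i = c \<longrightarrow> k i \<le> k p)" for c
  proof -
    obtain d where "d \<noteq> c" using color.distinct by metis
    then have "hue i = d" if "hue i \<noteq> c" for i using two_colors[OF that, of d] by simp
    then have "{i \<in> A. hue i = c} \<noteq> {}" using n by blast
    then show ?thesis using ex_argmin[of "{i \<in> A. hue i = c}" "\<lambda>i. - k i"] A by auto
  qed
  then obtain p where p: "p c \<in> A" "hue (p c) = c" "\<And>i. i \<in> A \<Longrightarrow> hue i = c \<Longrightarrow> k i \<le> k (p c)" for c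
    by metis
  show ?thesis
  proof (cases "k (p Red) \<le> k (p Blue)")
    case True
    then show ?thesis using that[of "p Red" "p Blue"] p by auto
  next
    case False
    then show ?thesis using that[of "p Blue" "p Red"] p by auto
  qed
qed

text \<open>The assumption \<open>sep\<close> is disjointness of interiors for different colours;
  boxes of one colour may overlap. Keeping \<open>ok\<close> abstract lets transposition replace it
  by \<open>ok o flip\<close>.\<close>

locale family =
  fixes I :: "'i set" and l r b t :: "'i \<Rightarrow> real" and hue :: "'i \<Rightarrow> color"
    and ok :: "real quad \<Rightarrow> bool" and GX GY :: "real set"
  assumes fin: "finite I"
    and lr: "i \<in> I \<Longrightarrow> l i < r i" and bt: "i \<in> I \<Longrightarrow> b i < t i"
    and sep: "i \<in> I \<Longrightarrow> j \<in> I \<Longrightarrow> hue i \<noteq> hue j \<Longrightarrow>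
      r i \<le> l j \<or> r j \<le> l i \<or> t i \<le> b j \<or> t j \<le> b i"
    and grid: "i \<in> I \<Longrightarrow> l i \<in> GX \<and> r i \<in> GX \<and> b i \<in> GY \<and> t i \<in> GY"
    and ok_mono: "(\<And>i j. i \<in> I \<Longrightarrow> j \<in> I \<Longrightarrow> x0 < x1 \<and> y0 < y1 \<and> l i < x1 \<and> x0 < r i \<and> b i < y1 \<and> y0 < t i \<Longrightarrow>
        l j < x1 \<and> x0 < r j \<and> b j < y1 \<and> y0 < t j \<Longrightarrow> hue i = hue j) \<Longrightarrow> ok (x0, x1, y0, y1)"
begin

text \<open>The conditions on the rectangle make sure that a degenerate one meets no box; it is then
  unicolored and a leaf.\<close>

fun meet :: "'i \<Rightarrow> real quad \<Rightarrow> bool" where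
  "meet i (x0, x1, y0, y1) \<longleftrightarrow> i \<in> I \<and> x0 < x1 \<and> y0 < y1 \<and> l i < x1 \<and> x0 < r i \<and> b i < y1 \<and> y0 < t i"

fun h_through :: "'i \<Rightarrow> real quad \<Rightarrow> bool" where
  "h_through i (x0, x1, y0, y1) \<longleftrightarrow> meet i (x0, x1, y0, y1) \<and> l i \<le> x0 \<and> x1 \<le> r i"

fun v_through :: "'i \<Rightarrow> real quad \<Rightarrow> bool" where
  "v_through i (x0, x1, y0, y1) \<longleftrightarrow> meet i (x0, x1, y0, y1) \<and> b i \<le> y0 \<and> y1 \<le> t i"

(* Corners and sides are degenerate rectangles; the product also contains the box itself, which is harmless. *)
definition features :: "('i \<times> (real \<times> real) \<times> (real \<times> real)) set" where
  "features = (SIGMA i:I. {(l i, l i), (r i, r i), (l i, r i)} \<times> {(b i, b i), (t i, t i), (b i, t i)})"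

fun inside :: "'i \<times> (real \<times> real) \<times> (real \<times> real) \<Rightarrow> real quad \<Rightarrow> bool" where
  "inside (i, (u, u'), (v, v')) (x0, x1, y0, y1) \<longleftrightarrow> x0 < u \<and> u' < x1 \<and> y0 < v \<and> v' < y1"

definition feats_in :: "real quad \<Rightarrow> ('i \<times> (real \<times> real) \<times> (real \<times> real)) set" where
  "feats_in Q = {\<phi> \<in> features. inside \<phi> Q}"

definition unicolored :: "real quad \<Rightarrow> bool" where
  "unicolored Q \<longleftrightarrow> (\<forall>i j. meet i Q \<and> meet j Q \<longrightarrow> hue i = hue j)"

definition thr_unicolored :: "real quad \<Rightarrow> bool" where
  "thr_unicolored Q \<longleftrightarrow> (\<forall>i j. (h_through i Q \<or> v_through i Q) \<and> (h_through j Q \<or> v_through j Q) \<longrightarrow> hue i = hue j)"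

definition on_grid :: "real quad \<Rightarrow> bool" where
  "on_grid Q \<longleftrightarrow> Q \<in> GX \<times> GX \<times> GY \<times> GY"

(* The induction hypothesis on the number of features. *)
definition solved :: "nat \<Rightarrow> bool" where
  "solved n \<longleftrightarrow> (\<forall>Q. card (feats_in Q) < n \<and> on_grid Q \<and> thr_unicolored Q \<longrightarrow> tiling ok GX GY Q (1 + 130 * card (feats_in Q)))"

text \<open>At most one colour change from bottom to top, located at a grid line because this line
  becomes the wall of a straight cut.\<close>

definition sepH :: "'i set \<Rightarrow> bool" where
  "sepH A \<longleftrightarrow> (\<exists>c. \<forall>i\<in>A. hue i = c) \<or>
    (\<exists>z\<in>GY. \<exists>c d. \<forall>i\<in>A. t i \<le> z \<and> hue i = c \<or> z \<le> b i \<and> hue i = d)"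

definition sepV :: "'i set \<Rightarrow> bool" where
  "sepV A \<longleftrightarrow> (\<exists>c. \<forall>i\<in>A. hue i = c) \<or>
    (\<exists>z\<in>GX. \<exists>c d. \<forall>i\<in>A. r i \<le> z \<and> hue i = c \<or> z \<le> l i \<and> hue i = d)"

text \<open>This is what the pieces of a well-chosen cut satisfy, with \<open>E\<close> the boxes
  that lost a feature on its walls. It is weaker than \<open>thr_unicolored\<close>, and
  \<open>good_part\<close> pays for the difference.\<close>

definition good :: "real quad \<Rightarrow> 'i set \<Rightarrow> bool" where
  "good Q E \<longleftrightarrow> unicolored Q \<or> sepH {i. h_through i Q \<and> i \<notin> E} \<and> sepV {i. v_through i Q \<and> i \<notin> E}"

lemma meetD:
  assumes "meet i (x0, x1, y0, y1)"
  shows "i \<in> I" "l i < x1" "x0 < r i" "b i < y1" "y0 < t i" "l i < r i" "b i < t i"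
  using assms lr[of i] bt[of i] by auto

lemma finite_meet: "finite {i. meet i Q \<and> P i}"
  by (rule finite_subset[OF _ fin]) (cases Q, auto)

lemma uni_ok: "unicolored Q \<Longrightarrow> ok Q"
  by (cases Q) (auto simp: unicolored_def intro!: ok_mono)

lemma uni_part: "unicolored Q \<Longrightarrow> 1 \<le> n \<Longrightarrow> tiling ok GX GY Q n"
  by (intro tiling.leaf uni_ok)

lemma degenerate_uni: "x1 \<le> x0 \<or> y1 \<le> y0 \<Longrightarrow> unicolored (x0, x1, y0, y1)"
  by (auto simp: unicolored_def)

lemma flip_family: "family I b t l r hue (ok \<circ> flip) GY GX"
proof
  show "(ok \<circ> flip) (x0, x1, y0, y1)"
    if "\<And>i j. i \<in> I \<Longrightarrow> j \<in> I \<Longrightarrow> x0 < x1 \<and> y0 < y1 \<and> b i < x1 \<and> x0 < t i \<and> l i < y1 \<and> y0 < r i \<Longrightarrow>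
      b j < x1 \<and> x0 < t j \<and> l j < y1 \<and> y0 < r j \<Longrightarrow> hue i = hue j" for x0 x1 y0 y1
    using that by (auto intro!: ok_mono)
  show "t i \<le> b j \<or> t j \<le> b i \<or> r i \<le> l j \<or> r j \<le> l i"
    if "i \<in> I" "j \<in> I" "hue i \<noteq> hue j" for i j
    using sep[OF that] by blast
qed (simp_all add: fin lr bt grid)

lemma finite_feats [simp]: "finite features"
  unfolding features_def using fin by auto

lemma finite_ft [simp]: "finite (feats_in Q)"
  unfolding feats_in_def by auto

lemma card_feats: "card features \<le> 9 * card I"
proof -
  have "card features = (\<Sum>i\<in>I. card ({(l i, l i), (r i, r i), (l i, r i)} \<times> {(b i, b i), (t i, t i), (b i, t i)}))"
    unfolding features_def using fin by (intro card_SigmaI) auto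
  also have "\<dots> \<le> (\<Sum>i\<in>I. 9)"
  proof (intro sum_mono)
    fix i
    have 3: "card {x, y, z} \<le> 3" for x y z :: "real \<times> real"
      by (simp add: card_insert_if)
    show "card ({(l i, l i), (r i, r i), (l i, r i)} \<times> {(b i, b i), (t i, t i), (b i, t i)}) \<le> 9"
      unfolding card_cartesian_product
      using mult_mono[OF 3 3] by fastforce
  qed
  finally show ?thesis by simp
qed

section \<open>Straight cuts between through boxes\<close>

lemma hth_vth: "h_through i Q \<Longrightarrow> v_through j Q \<Longrightarrow> hue i = hue j"
  by (cases Q) (use sep[of i j] in auto)

text \<open>Such a box contains \<open>Q\<close>, so every other box that meets \<open>Q\<close>
  overlaps it and shares its colour.\<close>

lemma cover_uni: "h_through i Q \<Longrightarrow> v_through i Q \<Longrightarrow> unicolored Q"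
proof (cases Q)
  fix x0 x1 y0 y1 assume Q: "Q = (x0, x1, y0, y1)" and i: "h_through i Q" "v_through i Q"
  have "hue i = hue j" if "meet j Q" for j
    using that i sep[of i j] by (auto simp: Q)
  then show ?thesis unfolding unicolored_def by metis
qed

text \<open>The straight cut is the pinwheel whose centre is the upper part and whose bottom sail is
  the lower one. The other three sails have zero width; they cost 1 each, and with the split itself
  this makes 4.\<close>

lemma tiling_hcut:
  assumes "tiling ok GX GY (x0, x1, y0, z) n" "tiling ok GX GY (x0, x1, z, y1) m" "on_grid (x0, x1, y0, y1)"
    "z \<in> GY" "x0 \<le> x1" "y0 \<le> z" "z \<le> y1" "n + m + 4 \<le> k"
  shows "tiling ok GX GY (x0, x1, y0, y1) k"
proof -
  \<comment> \<open>A split needs one cost function on rectangles, and pieces may coincide when they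
    are degenerate. The least cost is a function of the rectangle and lies below every given
    bound.\<close>
  obtain f where f: "\<And>K. tiling ok GX GY K (f K) \<or> \<not> (\<exists>n. tiling ok GX GY K n)" "\<And>K n. tiling ok GX GY K n \<Longrightarrow> f K \<le> n"
  proof -
    let ?f = "\<lambda>K. LEAST n. tiling ok GX GY K n"
    show ?thesis
      by (rule that[of ?f]) (auto intro: LeastI Least_le)
  qed
  have d: "tiling ok GX GY (x1, x1, y0, y1) 1" "tiling ok GX GY (x0, x1, y1, y1) 1" "tiling ok GX GY (x0, x0, z, y1) 1"
    by (auto intro!: uni_part degenerate_uni)
  show ?thesis
  proof (rule tiling.split[where W = "(x0, x1, z, y1)" and w = True and f = f])
    show "\<forall>K\<in>set (pieces True (x0, x1, y0, y1) (x0, x1, z, y1)). tiling ok GX GY K (f K)"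
      using assms(1,2) d f(1) by (simp add: pieces_def) metis
    show "1 + sum_list (map f (pieces True (x0, x1, y0, y1) (x0, x1, z, y1))) \<le> k"
      using f(2)[OF assms(1)] f(2)[OF assms(2)] d[THEN f(2)] assms(8) by (simp add: pieces_def)
  qed (use assms in \<open>auto simp: on_grid_def\<close>)
qed

text \<open>A feature strictly inside one part is not strictly inside the other, and features that
  touch or cross the line are counted in neither.\<close>

lemma card_ft_hcut:
  assumes "y0 \<le> z" "z \<le> y1"
  shows "card (feats_in (x0, x1, y0, z)) + card (feats_in (x0, x1, z, y1)) \<le> card (feats_in (x0, x1, y0, y1))"
proof -
  have v: "v \<le> v'" if "(i, u, (v, v')) \<in> features" for i u v v'
    using that bt[of i] by (auto simp: features_def)
  have "feats_in (x0, x1, y0, z) \<inter> feats_in (x0, x1, z, y1) = {}"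
    by (fastforce simp: feats_in_def dest: v)
  then have "card (feats_in (x0, x1, y0, z)) + card (feats_in (x0, x1, z, y1)) = card (feats_in (x0, x1, y0, z) \<union> feats_in (x0, x1, z, y1))"
    by (simp add: card_Un_disjoint)
  also have "\<dots> \<le> card (feats_in (x0, x1, y0, y1))"
    using assms by (intro card_mono) (auto simp: feats_in_def)
  finally show ?thesis .
qed

text \<open>A horizontal through box crosses every vertical one, so the vertical ones have its
  colour as well and the induction hypothesis applies.\<close>

lemma monochrome_h:
  assumes "solved n" "card (feats_in Q) < n" "on_grid Q" "h_through i Q" "\<And>j. h_through j Q \<Longrightarrow> hue j = hue i"
  shows "tiling ok GX GY Q (1 + 130 * card (feats_in Q))"
proof -
  have "hue j = hue i" if "h_through j Q \<or> v_through j Q" for j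
    using that assms(4,5) hth_vth by metis
  then have "thr_unicolored Q" unfolding thr_unicolored_def by metis
  then show ?thesis using assms(1-3) unfolding solved_def by blast
qed

lemma finite_hth: "finite {i. h_through i Q \<and> P i}"
  by (rule finite_subset[OF _ fin]) (cases Q, auto)

text \<open>Each box of colour \<open>c\<close> is separated by at most two cuts, one below and one
  above. A cut costs 5: the 4 of \<open>tiling_hcut\<close> and the constant 1 of an additional
  part. Hence 10 per box. Both parts of each cut keep a horizontal through box, which also fixes the
  colour of their vertical ones.\<close>

lemma alternating_h:
  assumes S: "solved n"
  shows "card (feats_in Q) < n \<Longrightarrow> on_grid Q \<Longrightarrow> \<exists>i. h_through i Q \<Longrightarrow> card {i. h_through i Q \<and> hue i = c} \<le> e \<Longrightarrow>
    tiling ok GX GY Q (1 + 130 * card (feats_in Q) + 10 * e)"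
proof (induction e arbitrary: Q)
  case 0
  then have nc: "\<not> (h_through i Q \<and> hue i = c)" for i using finite_hth[of Q] by fastforce
  obtain i where i: "h_through i Q" using 0 by blast
  have "tiling ok GX GY Q (1 + 130 * card (feats_in Q))"
    by (rule monochrome_h[OF S 0(1,2) i]) (use two_colors i nc in metis)
  then show ?case by simp
next
  case (Suc e)
  \<comment> \<open>With no through box of the other colour below \<open>i\<close>, the cut below
    \<open>i\<close> is saved: one cut under the lowest box of the other colour is enough, which is
    5 less.\<close>
  have A0: "tiling ok GX GY Q (1 + 130 * card (feats_in Q) + 10 * e + 5)"
    if Q: "card (feats_in Q) < n" "on_grid Q" "card {i. h_through i Q \<and> hue i = c} \<le> Suc e"
      and i: "h_through i Q" "hue i = c" and nob: "\<And>k. h_through k Q \<Longrightarrow> hue k \<noteq> c \<Longrightarrow> \<not> t k \<le> b i" for Q i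
  proof (cases "\<exists>k. h_through k Q \<and> hue k \<noteq> c")
    case False
    then have "hue j = hue i" if "h_through j Q" for j using that i(2) by simp
    then have "tiling ok GX GY Q (1 + 130 * card (feats_in Q))" by (rule monochrome_h[OF S Q(1,2) i(1)])
    then show ?thesis by (rule tiling_mono) simp
  next
    case True
    obtain x0 x1 y0 y1 where q: "Q = (x0, x1, y0, y1)" by (cases Q)
    let ?A = "{k. h_through k Q \<and> hue k \<noteq> c}"
    obtain k where k: "h_through k Q" "hue k \<noteq> c" and kmin: "\<And>k'. h_through k' Q \<Longrightarrow> hue k' \<noteq> c \<Longrightarrow> b k \<le> b k'"
      using ex_argmin[of ?A b] finite_hth[of Q] True by auto
    have ik: "t i \<le> b k" using sep[of i k] nob[OF k] k i by (auto simp: q)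
    have z: "b k \<in> GY" "y0 \<le> b k" "b k \<le> y1" "x0 \<le> x1" "y0 < b k" "b k < y1"
      using k i ik grid[of k] bt[of i] by (auto simp: q)
    let ?L = "(x0, x1, y0, b k)" and ?U = "(x0, x1, b k, y1)"
    have c: "card (feats_in ?L) + card (feats_in ?U) \<le> card (feats_in Q)" using card_ft_hcut[OF z(2,3)] by (simp add: q)
    have G: "on_grid ?L" "on_grid ?U" using Q z by (auto simp: q on_grid_def)
    have iL: "h_through i ?L" using i ik z bt[of i] by (auto simp: q)
    have L: "tiling ok GX GY ?L (1 + 130 * card (feats_in ?L))"
    proof (rule monochrome_h[OF S _ G(1) iL])
      show "hue j = hue i" if "h_through j ?L" for j
        using kmin[of j] that z i by (fastforce simp: q)
    qed (use c Q in simp)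
    have sub: "{j. h_through j ?U \<and> hue j = c} \<subseteq> {j. h_through j Q \<and> hue j = c} - {i}"
      using ik z by (auto simp: q)
    have "card {j. h_through j ?U \<and> hue j = c} \<le> card ({j. h_through j Q \<and> hue j = c} - {i})"
      by (rule card_mono[OF _ sub]) (use finite_hth in auto)
    also have "\<dots> \<le> e" using Q(3) i by (subst card_Diff_singleton) auto
    finally have "card {j. h_through j ?U \<and> hue j = c} \<le> e" .
    moreover have "h_through k ?U" using k z bt[of k] by (auto simp: q)
    ultimately have U: "tiling ok GX GY ?U (1 + 130 * card (feats_in ?U) + 10 * e)"
      using Suc.IH[of ?U] G c Q by fastforce
    show ?thesis unfolding q
      by (rule tiling_hcut[OF L U]) (use Q z c in \<open>auto simp: q\<close>)
  qed
  show ?case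
  proof (cases "\<exists>i. h_through i Q \<and> hue i = c")
    case False
    obtain i where i: "h_through i Q" using Suc.prems by blast
    have "hue j = hue i" if "h_through j Q" for j using that i False by (intro two_colors[of _ c]) auto
    then have "tiling ok GX GY Q (1 + 130 * card (feats_in Q))"
      by (rule monochrome_h[OF S Suc.prems(1,2) i])
    then show ?thesis by (rule tiling_mono) simp
  next
    case True
    obtain x0 x1 y0 y1 where q: "Q = (x0, x1, y0, y1)" by (cases Q)
    let ?A = "{k. h_through k Q \<and> hue k = c}"
    obtain i where i: "h_through i Q" "hue i = c" and imin: "\<And>k'. h_through k' Q \<Longrightarrow> hue k' = c \<Longrightarrow> b i \<le> b k'"
      using ex_argmin[of ?A b] finite_hth[of Q] True by auto
    show ?thesis
    proof (cases "\<exists>k. h_through k Q \<and> hue k \<noteq> c \<and> t k \<le> b i")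
      case False
      then have "tiling ok GX GY Q (1 + 130 * card (feats_in Q) + 10 * e + 5)" using A0[of Q i] Suc.prems i by blast
      then show ?thesis by (rule tiling_mono) simp
    next
      case True
      then obtain k where k: "h_through k Q" "hue k \<noteq> c" "t k \<le> b i" by blast
      have z: "b i \<in> GY" "y0 \<le> b i" "b i \<le> y1" "x0 \<le> x1" "y0 < b i" "b i < y1"
        using k i grid[of i] by (auto simp: q)
      let ?L = "(x0, x1, y0, b i)" and ?U = "(x0, x1, b i, y1)"
      have c: "card (feats_in ?L) + card (feats_in ?U) \<le> card (feats_in Q)" using card_ft_hcut[OF z(2,3)] by (simp add: q)
      have G: "on_grid ?L" "on_grid ?U" using Suc.prems z by (auto simp: q on_grid_def)
      have kL: "h_through k ?L" using k z bt[of k] by (auto simp: q)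
      have L: "tiling ok GX GY ?L (1 + 130 * card (feats_in ?L))"
      proof (rule monochrome_h[OF S _ G(1) kL])
        show "hue j = hue k" if "h_through j ?L" for j
          using imin[of j] that z k by (intro two_colors[of _ c]) (auto simp: q)
      qed (use c Suc.prems in simp)
      have sub: "{j. h_through j ?U \<and> hue j = c} \<subseteq> {j. h_through j Q \<and> hue j = c}"
        using z by (auto simp: q)
      have "card {j. h_through j ?U \<and> hue j = c} \<le> Suc e"
        using card_mono[OF _ sub] finite_hth[of Q] Suc.prems(4) by fastforce
      moreover have "h_through i ?U" using i z bt[of i] by (auto simp: q)
      ultimately have U: "tiling ok GX GY ?U (1 + 130 * card (feats_in ?U) + 10 * e + 5)"
        using A0[of ?U i] i G c Suc.prems by fastforce
      show ?thesis unfolding q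
        by (rule tiling_hcut[OF L U]) (use Suc.prems z c in \<open>auto simp: q\<close>)
    qed
  qed
qed

text \<open>After a cut along the line of the colour change, only boxes of \<open>E\<close> can have
  the wrong colour in either part. A box of \<open>E\<close> may be through in both parts, so the
  cost is 2 (1 + 10 |E|) + 4 apart from the features.\<close>

lemma good_h:
  assumes S: "solved n" and Q: "card (feats_in Q) < n" "on_grid Q" and E: "finite E"
    and s: "sepH {i. h_through i Q \<and> i \<notin> E}" and h: "\<exists>i. h_through i Q"
  shows "tiling ok GX GY Q (6 + 130 * card (feats_in Q) + 20 * card E)"
proof -
  have one: "tiling ok GX GY Q (1 + 130 * card (feats_in Q) + 10 * card E)"
    if "card (feats_in Q) < n" "on_grid Q" "\<exists>i. h_through i Q" and c: "\<And>i. h_through i Q \<Longrightarrow> i \<notin> E \<Longrightarrow> hue i = c" for Q c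
  proof -
    obtain c' where "c' \<noteq> c" using color.distinct by metis
    then have "{i. h_through i Q \<and> hue i = c'} \<subseteq> E" using c by auto
    then have "card {i. h_through i Q \<and> hue i = c'} \<le> card E" using E by (intro card_mono) auto
    then show ?thesis using alternating_h[OF S that(1-3), of c' "card E"] by simp
  qed
  show ?thesis
  proof (cases "\<exists>c. \<forall>i. h_through i Q \<and> i \<notin> E \<longrightarrow> hue i = c")
    case True
    then obtain c where "\<And>i. h_through i Q \<Longrightarrow> i \<notin> E \<Longrightarrow> hue i = c" by blast
    then have "tiling ok GX GY Q (1 + 130 * card (feats_in Q) + 10 * card E)" using one[OF Q h] by blast
    then show ?thesis by (rule tiling_mono) simp
  next
    case False
    then have "\<not> (\<exists>c. \<forall>i\<in>{i. h_through i Q \<and> i \<notin> E}. hue i = c)" by simp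
    then have "\<exists>z\<in>GY. \<exists>c d. \<forall>i\<in>{i. h_through i Q \<and> i \<notin> E}. t i \<le> z \<and> hue i = c \<or> z \<le> b i \<and> hue i = d"
      using s unfolding sepH_def by (simp only: simp_thms)
    then obtain z c d where z0: "z \<in> GY" "\<forall>i\<in>{i. h_through i Q \<and> i \<notin> E}. t i \<le> z \<and> hue i = c \<or> z \<le> b i \<and> hue i = d"
      by (elim bexE exE)
    then have z: "z \<in> GY" "\<And>i. h_through i Q \<Longrightarrow> i \<notin> E \<Longrightarrow> t i \<le> z \<and> hue i = c \<or> z \<le> b i \<and> hue i = d"
      by simp_all
    obtain i where i: "h_through i Q" "i \<notin> E" "hue i \<noteq> d" using False by blast
    obtain j where j: "h_through j Q" "j \<notin> E" "hue j \<noteq> c" using False by blast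
    have ij: "t i \<le> z" "z \<le> b j" using z(2) i j by blast+
    obtain x0 x1 y0 y1 where q: "Q = (x0, x1, y0, y1)" by (cases Q)
    have zz: "y0 \<le> z" "z \<le> y1" "x0 \<le> x1" "y0 < z" "z < y1" using i j ij by (auto simp: q)
    let ?L = "(x0, x1, y0, z)" and ?U = "(x0, x1, z, y1)"
    have c: "card (feats_in ?L) + card (feats_in ?U) \<le> card (feats_in Q)" using card_ft_hcut[OF zz(1,2)] by (simp add: q)
    have G: "on_grid ?L" "on_grid ?U" using Q z by (auto simp: q on_grid_def)
    have "h_through i ?L" using i ij zz bt[of i] by (auto simp: q)
    moreover have "hue k = c" if "h_through k ?L" "k \<notin> E" for k
      using z(2)[of k] that zz by (auto simp: q)
    ultimately have L: "tiling ok GX GY ?L (1 + 130 * card (feats_in ?L) + 10 * card E)"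
      using one[of ?L c] G c Q by fastforce
    have "h_through j ?U" using j ij zz bt[of j] by (auto simp: q)
    moreover have "hue k = d" if "h_through k ?U" "k \<notin> E" for k
      using z(2)[of k] that zz by (auto simp: q)
    ultimately have U: "tiling ok GX GY ?U (1 + 130 * card (feats_in ?U) + 10 * card E)"
      using one[of ?U d] G c Q by fastforce
    show ?thesis unfolding q
      by (rule tiling_hcut[OF L U]) (use Q z zz c in \<open>auto simp: q\<close>)
  qed
qed


lemma ft_disjoint:
  assumes "x1 \<le> x0' \<or> x1' \<le> x0 \<or> y1 \<le> y0' \<or> y1' \<le> y0"
  shows "feats_in (x0, x1, y0, y1) \<inter> feats_in (x0', x1', y0', y1') = {}"
proof -
  have "u \<le> u' \<and> v \<le> v'" if "(i, (u, u'), (v, v')) \<in> features" for i u u' v v'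
    using that bt[of i] lr[of i] by (auto simp: features_def)
  then show ?thesis using assms unfolding feats_in_def by fastforce
qed

lemma monoI: "(\<And>i. i \<in> A \<Longrightarrow> hue i \<noteq> d) \<Longrightarrow> \<exists>c. \<forall>i\<in>A. hue i = c"
  using two_colors by metis

lemma sepH_mono: "sepH A \<Longrightarrow> B \<subseteq> A \<Longrightarrow> sepH B"
  unfolding sepH_def by (elim disjE) (metis subsetD)+

lemma sepH_uni: "\<exists>c. \<forall>i\<in>A. hue i = c \<Longrightarrow> sepH A"
  unfolding sepH_def by blast

lemma sepV_uni: "\<exists>c. \<forall>i\<in>A. hue i = c \<Longrightarrow> sepV A"
  unfolding sepV_def by blast

section \<open>Transposition of a family of boxes\<close>

context
begin

interpretation T: family I b t l r hue "ok \<circ> flip" GY GX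
  by (rule flip_family)

lemma T_meet: "T.meet i (flip Q) = meet i Q"
  by (cases Q) auto

lemma T_hth: "T.h_through i (flip Q) = v_through i Q"
  by (cases Q) auto

lemma T_vth: "T.v_through i (flip Q) = h_through i Q"
  by (cases Q) auto

lemma T_uni: "T.unicolored (flip Q) = unicolored Q"
  by (simp add: T.unicolored_def unicolored_def T_meet)

lemma T_thuni: "T.thr_unicolored (flip Q) = thr_unicolored Q"
  by (auto simp: T.thr_unicolored_def thr_unicolored_def T_hth T_vth)

lemma T_inG: "T.on_grid (flip Q) = on_grid Q"
  by (cases Q) (auto simp: T.on_grid_def on_grid_def)

lemma T_ft: "card (T.feats_in (flip Q)) = card (feats_in Q)"
proof -
  have "T.feats_in (flip Q) = (\<lambda>(i, u, v). (i, v, u)) ` feats_in Q"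
    by (cases Q) (force simp: T.feats_in_def feats_in_def T.features_def features_def image_iff)
  moreover have "inj_on (\<lambda>(i, u, v). (i, v, u)) (feats_in Q)" by (auto simp: inj_on_def)
  ultimately show ?thesis by (simp add: card_image)
qed

lemma T_solved: "T.solved n = solved n"
proof -
  have "T.solved n \<longleftrightarrow> (\<forall>Q. card (T.feats_in (flip Q)) < n \<and> T.on_grid (flip Q) \<and> T.thr_unicolored (flip Q) \<longrightarrow>
     tiling (ok \<circ> flip) GY GX (flip Q) (1 + 130 * card (T.feats_in (flip Q))))"
    unfolding T.solved_def by (metis flip_flip)
  then show ?thesis by (simp only: T_ft T_inG T_thuni tiling_flip_iff solved_def)
qed

text \<open>As soon as one horizontal through box exists, horizontal cuts alone restore the
  invariant, since the vertical through boxes of each part take the colour of its horizontal ones.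
  Otherwise the transposed family is used.\<close>

lemma good_part:
  assumes S: "solved n" and Q: "card (feats_in Q) < n" "on_grid Q" and E: "finite E" and g: "good Q E"
  shows "tiling ok GX GY Q (6 + 130 * card (feats_in Q) + 20 * card E)"
proof (cases "unicolored Q \<or> thr_unicolored Q")
  case True
  have "tiling ok GX GY Q (1 + 130 * card (feats_in Q))"
    using True uni_part[of Q] S Q unfolding solved_def by (metis le_add1)
  then show ?thesis by (rule tiling_mono) simp
next
  case False
  then have s: "sepH {i. h_through i Q \<and> i \<notin> E}" "sepV {i. v_through i Q \<and> i \<notin> E}" using g by (auto simp: good_def)
  show ?thesis
  proof (cases "\<exists>i. h_through i Q")
    case True
    then show ?thesis using good_h[OF S Q E s(1)] by blast
  next
    case no: False
    then have "\<exists>i. v_through i Q" using False unfolding thr_unicolored_def by blast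
    then have "tiling (ok \<circ> flip) GY GX (flip Q) (6 + 130 * card (T.feats_in (flip Q)) + 20 * card E)"
      using S Q E s(2)
      by (intro T.good_h[of n]) (simp_all add: T_solved T_ft T_inG T_hth T.sepH_def sepV_def)
    then show ?thesis by (simp only: tiling_flip_iff T_ft)
  qed
qed

end

text \<open>With k = \<open>card lost\<close>, the five pieces and the split cost at most 5 (6 + 20
  k) + 1 besides 130 for each of the features that are not lost, and 31 + 100 k <= 1 + 130 k because
  k >= 1. This is the origin of 130. The loss also gives each piece fewer features than
  \<open>Q\<close>, as the induction hypothesis demands.\<close>

lemma wheel_step:
  assumes S: "solved (card (feats_in Q))" and Q: "on_grid Q" "fits Q W" "on_grid W"
    and lost: "lost = {\<phi> \<in> feats_in Q. \<forall>K\<in>set (wheel Q W). \<not> inside \<phi> K}" "lost \<noteq> {}"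
    and good: "\<And>K. K \<in> set (wheel Q W) \<Longrightarrow> good K (fst ` lost)"
  shows "tiling ok GX GY Q (1 + 130 * card (feats_in Q))"
proof -
  define f where "f K = 6 + 130 * card (feats_in K) + 20 * card (fst ` lost)" for K
  have finl [simp]: "finite lost" using lost by simp
  obtain x0 x1 y0 y1 where q: "Q = (x0, x1, y0, y1)" by (cases Q)
  obtain u1 u2 v1 v2 where w: "W = (u1, u2, v1, v2)" by (cases W)
  have sub: "feats_in K \<subseteq> feats_in Q - lost" if "K \<in> set (wheel Q W)" for K
  proof
    fix \<phi> assume \<phi>: "\<phi> \<in> feats_in K"
    then have "inside \<phi> Q" using that Q(2) by (cases \<phi>) (auto simp: q w feats_in_def)
    moreover have "\<phi> \<notin> lost" using \<phi> that lost(1) by (auto simp: feats_in_def)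
    ultimately show "\<phi> \<in> feats_in Q - lost" using \<phi> by (simp add: feats_in_def)
  qed
  have cl: "card (feats_in Q - lost) + card lost = card (feats_in Q)" "card lost > 0" "card (fst ` lost) \<le> card lost"
    using lost by (auto simp: card_Diff_subset card_mono card_gt_0_iff card_image_le)
  have parts: "tiling ok GX GY K (f K)" if K: "K \<in> set (wheel Q W)" for K
    unfolding f_def
  proof (rule good_part[OF S _ _ _ good[OF K]])
    show "card (feats_in K) < card (feats_in Q)" using card_mono[OF _ sub[OF K]] cl by simp
    show "on_grid K" using K Q by (auto simp: q w on_grid_def)
  qed simp
  let ?A = "feats_in (x0, u2, y0, v1)" and ?B = "feats_in (u2, x1, y0, v2)" and ?C = "feats_in (u1, x1, v2, y1)"
    and ?D = "feats_in (x0, u1, v1, y1)" and ?F = "feats_in (u1, u2, v1, v2)"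
  have ord: "x0 \<le> u1" "u1 \<le> u2" "u2 \<le> x1" "y0 \<le> v1" "v1 \<le> v2" "v2 \<le> y1" using Q by (auto simp: q w)
  have "card ?A + card ?B + card ?C + card ?D + card ?F = card (?A \<union> ?B \<union> ?C \<union> ?D \<union> ?F)"
    using ord by (simp add: card_Un_disjoint Int_Un_distrib2 ft_disjoint)
  also have "\<dots> \<le> card (feats_in Q - lost)"
    using sub by (intro card_mono) (auto simp: q w)
  finally have s: "card ?A + card ?B + card ?C + card ?D + card ?F \<le> card (feats_in Q - lost)" .
  show ?thesis
  proof (rule tiling.split[where W = W and w = True and f = f])
    show "1 + sum_list (map f (pieces True Q W)) \<le> 1 + 130 * card (feats_in Q)"
      using s cl by (simp add: pieces_def q w f_def)
  qed (use parts Q in \<open>auto simp: pieces_def on_grid_def\<close>)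
qed

text \<open>A horizontal through box of one half either runs across the cut, where \<open>L\<close>
  or \<open>R\<close> controls the colours, or ends on it; in the latter case it fills the half or
  loses a corner. Vertical through boxes of a half are through in \<open>Q\<close>. The box
  \<open>i\<close> guarantees that some corner is lost.\<close>

lemma cut_vertical:
  assumes S: "solved (card (feats_in Q))" and q: "Q = (x0, x1, y0, y1)" and Q: "on_grid Q" "thr_unicolored Q"
    and x: "x \<in> GX" "x0 < x" "x < x1"
    and i: "i \<in> I" "x \<in> {l i, r i}" "v \<in> {b i, t i}" "y0 < v" "v < y1"
    and L: "sepH {i. meet i Q \<and> l i \<le> x0 \<and> x < r i}"
    and R: "sepH {i. meet i Q \<and> x1 \<le> r i \<and> l i < x}"
  shows "tiling ok GX GY Q (1 + 130 * card (feats_in Q))"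
proof -
  \<comment> \<open>Left sail and centre are the two halves; the other sails have zero
    width.\<close>
  define W where "W = (x, x1, y0, y1)"
  define lost where "lost = {\<phi> \<in> feats_in Q. \<forall>K\<in>set (wheel Q W). \<not> inside \<phi> K}"
  have lostI: "(i, (x, x), (v, v)) \<in> lost" if "i \<in> I" "x \<in> {l i, r i}" "v \<in> {b i, t i}" "y0 < v" "v < y1" for i v
    using that x by (auto simp: lost_def feats_in_def features_def q W_def)
  have E: "i \<in> fst ` lost" if "i \<in> I" "x \<in> {l i, r i}" "y0 < b i \<and> b i < y1 \<or> y0 < t i \<and> t i < y1" for i
    using lostI[of i "b i"] lostI[of i "t i"] that by force
  have v: "sepV {i. v_through i K \<and> i \<notin> fst ` lost}" if "\<And>i. v_through i K \<Longrightarrow> v_through i Q" for K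
  proof (rule sepV_uni)
    show "\<exists>c. \<forall>i\<in>{i. v_through i K \<and> i \<notin> fst ` lost}. hue i = c"
      using Q(2) that unfolding thr_unicolored_def by blast
  qed
  show ?thesis
  proof (rule wheel_step[OF S Q(1) _ _ lost_def])
    show "fits Q W" "on_grid W" using x i Q by (auto simp: q W_def on_grid_def)
    show "lost \<noteq> {}" using lostI[OF i] by auto
    fix K assume "K \<in> set (wheel Q W)"
    then consider "unicolored K" | "\<not> unicolored K" "K = (x0, x, y0, y1)" | "\<not> unicolored K" "K = (x, x1, y0, y1)"
      by (auto simp: q W_def degenerate_uni)
    then show "good K (fst ` lost)"
    proof cases
      case 2
      then have nc: "\<not> (h_through i K \<and> v_through i K)" for i using cover_uni by blast
      have "{i. h_through i K \<and> i \<notin> fst ` lost} \<subseteq> {i. meet i Q \<and> l i \<le> x0 \<and> x < r i}"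
      proof safe
        fix i assume h: "h_through i K" "i \<notin> fst ` lost"
        then show "meet i Q" "l i \<le> x0" using x by (auto simp: 2 q)
        show "x < r i" using h nc[of i] E[of i] by (force simp: 2)
      qed
      then show ?thesis unfolding good_def using sepH_mono[OF L] v[of K] x by (auto simp: 2 q)
    next
      case 3
      then have nc: "\<not> (h_through i K \<and> v_through i K)" for i using cover_uni by blast
      have "{i. h_through i K \<and> i \<notin> fst ` lost} \<subseteq> {i. meet i Q \<and> x1 \<le> r i \<and> l i < x}"
      proof safe
        fix i assume h: "h_through i K" "i \<notin> fst ` lost"
        then show "meet i Q" "x1 \<le> r i" using x by (auto simp: 3 q)
        show "l i < x" using h nc[of i] E[of i] by (force simp: 3)
      qed
      then show ?thesis unfolding good_def using sepH_mono[OF R] v[of K] x by (auto simp: 3 q)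
    qed (auto simp: good_def)
  qed
qed

end

subsection \<open>Cutting along walls that see few colour changes\<close>

context family
begin

text \<open>The certificate that vertical cuts fail: from the left both colours reach
  \<open>x\<close> but only one goes further, and from the right both colours reach
  \<open>x'\<close>. Since \<open>x' < x\<close>, a cut at \<open>x\<close> would be crossed by both
  colours from the right. The box \<open>p\<close> ends at \<open>x\<close> with a corner that such
  a cut would lose.\<close>

definition stuck :: "real quad \<Rightarrow> real \<Rightarrow> real \<Rightarrow> bool" where
  "stuck Q x x' \<longleftrightarrow> (case Q of (x0, x1, y0, y1) \<Rightarrow>
     x \<in> GX \<and> x' \<in> GX \<and> x' < x \<and> x0 < x \<and> x < x1 \<and>
     (\<exists>p\<in>I. r p = x \<and> (\<exists>v\<in>{b p, t p}. y0 < v \<and> v < y1)) \<and>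
     (\<exists>c. \<forall>i. meet i Q \<and> l i \<le> x0 \<and> x < r i \<longrightarrow> hue i = c) \<and>
     (\<forall>c. \<exists>i. meet i Q \<and> l i \<le> x0 \<and> x \<le> r i \<and> hue i = c) \<and>
     (\<forall>c. \<exists>i. meet i Q \<and> x1 \<le> r i \<and> l i \<le> x' \<and> hue i = c))"

text \<open>If the boxes from one side have a single colour, some cut succeeds: at a corner of a box
  that is not through, or where the shorter colour from the opposite side ends, because only one
  colour continues there. So failure forces both colours on both sides, with overlapping
  reach.\<close>

lemma vertical:
  assumes S: "solved (card (feats_in Q))" and Q: "on_grid Q" "thr_unicolored Q" "\<not> unicolored Q"
    and np: "\<not> tiling ok GX GY Q (1 + 130 * card (feats_in Q))"
  shows "\<exists>x x'. stuck Q x x'"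
proof -
  obtain x0 x1 y0 y1 where q: "Q = (x0, x1, y0, y1)" by (cases Q)
  have cut: False if "i \<in> I" "x \<in> {l i, r i}" "v \<in> {b i, t i}" "y0 < v" "v < y1" "x0 < x" "x < x1"
    "\<exists>c. \<forall>i\<in>{i. meet i Q \<and> l i \<le> x0 \<and> x < r i}. hue i = c"
    "\<exists>c. \<forall>i\<in>{i. meet i Q \<and> x1 \<le> r i \<and> l i < x}. hue i = c" for i x v
  proof -
    have "x \<in> GX" using that(1,2) grid by auto
    then show False
      using cut_vertical[OF S q Q(1,2) _ that(6,7) that(1-5)] np sepH_uni that(8,9) by blast
  qed
  have both: "hue p = hue j" if "h_through p Q" "h_through j Q" for p j
    using Q(2) that unfolding thr_unicolored_def by blast
  show ?thesis
  proof (cases "\<exists>c. \<forall>i\<in>{i. meet i Q \<and> l i \<le> x0}. hue i = c")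
    case L: True
    show ?thesis
    proof (cases "\<exists>c. \<forall>i\<in>{i. meet i Q \<and> x1 \<le> r i}. hue i = c")
      case R: True
      \<comment> \<open>Otherwise all boxes meeting \<open>Q\<close> were through and
        \<open>Q\<close> would be unicolored.\<close>
      have "\<exists>i. meet i Q \<and> \<not> h_through i Q \<and> \<not> v_through i Q"
        using Q(2,3) unfolding unicolored_def thr_unicolored_def by blast
      then obtain i where i: "meet i Q" "\<not> h_through i Q" "\<not> v_through i Q" by blast
      have iI: "i \<in> I" using i by (auto simp: q)
      obtain x where x: "x \<in> {l i, r i}" "x0 < x" "x < x1"
        using i(1,2) by (cases "x0 < l i") (auto simp: q)
      obtain v where v: "v \<in> {b i, t i}" "y0 < v" "v < y1"
        using i(1,3) by (cases "y0 < b i") (auto simp: q)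
      show ?thesis using cut[OF iI x(1) v x(2,3)] L R by blast
    next
      case R: False
      obtain p j where p: "p \<in> {i. meet i Q \<and> x1 \<le> r i}"
        "\<And>i. i \<in> {i. meet i Q \<and> x1 \<le> r i} \<Longrightarrow> hue i = hue p \<Longrightarrow> - l i \<le> - l p"
        "j \<in> {i. meet i Q \<and> x1 \<le> r i}" "hue j \<noteq> hue p" "- l p \<le> - l j"
        by (rule two_max[OF finite_meet R, of "\<lambda>i. - l i"]) (rule that)
      \<comment> \<open>Otherwise \<open>p\<close> and \<open>j\<close> would be through boxes of
        different colours.\<close>
      have "x0 < l p" by (rule ccontr) (use both[of p j] p in \<open>auto simp: q\<close>)
      \<comment> \<open>The boxes \<open>p\<close> and \<open>j\<close> overlap horizontally, so
        they are separated vertically, and a horizontal side of \<open>p\<close> lies strictly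
        between \<open>y0\<close> and \<open>y1\<close>.\<close>
      moreover have "\<exists>v\<in>{b p, t p}. y0 < v \<and> v < y1"
        using sep[of p j] p lr[of p] by (auto simp: q)
      then obtain v where "v\<in>{b p, t p}" "y0 < v" "v < y1" by blast
      moreover have "\<exists>c. \<forall>i\<in>{i. meet i Q \<and> x1 \<le> r i \<and> l i < l p}. hue i = c"
        by (rule monoI[of _ "hue p"]) (use p(2) in force)
      moreover have "p \<in> I" "l p < x1" using p by (auto simp: q)
      ultimately show ?thesis using cut[of p "l p" v] L by blast
    qed
  next
    case L: False
    obtain p j where p: "p \<in> {i. meet i Q \<and> l i \<le> x0}"
      "\<And>i. i \<in> {i. meet i Q \<and> l i \<le> x0} \<Longrightarrow> hue i = hue p \<Longrightarrow> r i \<le> r p"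
      "j \<in> {i. meet i Q \<and> l i \<le> x0}" "hue j \<noteq> hue p" "r p \<le> r j"
      by (rule two_max[OF finite_meet L, of r]) (rule that)
    have pI: "p \<in> I" "x0 < r p" using p by (auto simp: q)
    have x1: "r p < x1" by (rule ccontr) (use both[of p j] p in \<open>auto simp: q\<close>)
    have v0: "\<exists>v\<in>{b p, t p}. y0 < v \<and> v < y1"
      using sep[of p j] p lr[of p] by (auto simp: q)
    then obtain v where v: "v\<in>{b p, t p}" "y0 < v" "v < y1" by blast
    have Lc: "\<exists>c. \<forall>i\<in>{i. meet i Q \<and> l i \<le> x0 \<and> r p < r i}. hue i = c"
      by (rule monoI[of _ "hue p"]) (use p(2) in force)
    \<comment> \<open>Every other requirement for a cut at \<open>r p\<close> is met, so the boxes
      that cross it from the right must be to blame.\<close>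
    have R: "\<not> (\<exists>c. \<forall>i\<in>{i. meet i Q \<and> x1 \<le> r i \<and> l i < r p}. hue i = c)"
      using cut[OF pI(1) _ v pI(2) x1 Lc] by blast
    obtain p' j' where p': "p' \<in> {i. meet i Q \<and> x1 \<le> r i \<and> l i < r p}"
      "\<And>i. i \<in> {i. meet i Q \<and> x1 \<le> r i \<and> l i < r p} \<Longrightarrow> hue i = hue p' \<Longrightarrow> - l i \<le> - l p'"
      "j' \<in> {i. meet i Q \<and> x1 \<le> r i \<and> l i < r p}" "hue j' \<noteq> hue p'" "- l p' \<le> - l j'"
      by (rule two_max[OF finite_meet R, of "\<lambda>i. - l i"]) (rule that)
    have "\<exists>i. meet i Q \<and> l i \<le> x0 \<and> r p \<le> r i \<and> hue i = c" for c
      using p two_colors[of "hue j" "hue p" c] by (cases "c = hue p") auto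
    moreover have "\<exists>i. meet i Q \<and> x1 \<le> r i \<and> l i \<le> l p' \<and> hue i = c" for c
      using p' two_colors[of "hue j'" "hue p'" c] by (cases "c = hue p'") auto
    moreover have "p' \<in> I" "l p' < r p" using p' by (auto simp: q)
    ultimately have "stuck Q (r p) (l p')"
      unfolding stuck_def using q grid[of p] grid[of p'] pI x1 v0 Lc by auto
    then show ?thesis by blast
  qed
qed

text \<open>By \<open>pos\<close> the left bundle passes low, the bottom one right, the right one
  high and the top one left. In each sail, the through boxes of one direction pass beyond a wall at
  the reach of one colour, which leaves the other colour. Those of the other direction overlap the
  box that defines the wall they pass through; only in the bottom sail is their colour given by
  \<open>mono\<close>.\<close>

lemma pinwheel:
  fixes L R B T :: "color \<Rightarrow> 'i"
  assumes S: "solved (card (feats_in Q))" and q: "Q = (x0, x1, y0, y1)" and Q: "on_grid Q"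
    and x: "x0 < x" "x < x1" "x' < x" "x' \<in> GX" and y: "y' < y" "y' \<in> GY"
    and mono: "\<And>i. meet i Q \<Longrightarrow> l i \<le> x0 \<Longrightarrow> x < r i \<Longrightarrow> hue i = cl"
    and L: "\<And>c. meet (L c) Q" "\<And>c. l (L c) \<le> x0" "\<And>c. x \<le> r (L c)" "\<And>c. hue (L c) = c"
    and R: "\<And>c. meet (R c) Q" "\<And>c. x1 \<le> r (R c)" "\<And>c. l (R c) \<le> x'" "\<And>c. hue (R c) = c"
    and B: "\<And>c. meet (B c) Q" "\<And>c. b (B c) \<le> y0" "\<And>c. y \<le> t (B c)" "\<And>c. hue (B c) = c"
    and T: "\<And>c. meet (T c) Q" "\<And>c. y1 \<le> t (T c)" "\<And>c. b (T c) \<le> y'" "\<And>c. hue (T c) = c"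
    and pos: "\<And>c. t (L c) \<le> y'" "\<And>c. y \<le> b (R c)" "\<And>c. r (T c) \<le> x'" "\<And>c. x \<le> l (B c)"
  shows "tiling ok GX GY Q (1 + 130 * card (feats_in Q))"
proof -
  have nu: "\<not> (\<exists>c. \<forall>i\<in>A. hue i = c)" if "\<And>c. f c \<in> A" "\<And>c. hue (f c) = c" for f A
    using that color.distinct(1) by metis
  note meetD = meetD[of _ x0 x1 y0 y1, folded q]
  have other: "hue p = c \<or> hue j = c" if "hue j \<noteq> hue p" for p j c
    using that two_colors[of "hue j" c "hue p"] by auto
  note LD = meetD[OF L(1)] note RD = meetD[OF R(1)] note BD = meetD[OF B(1)] note TD = meetD[OF T(1)]

  (* Going once around the centre, each wall is placed where the previous one, prolonged, has met boxes of
     both colours. *)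
  define h0 where "h0 = min (t (L Red)) (t (L Blue))"
  have h0: "h0 \<le> y'" "\<And>c. h0 \<le> t (L c)" "\<exists>a. t (L a) = h0"
  proof -
    show "h0 \<le> y'" using pos(1)[of Red] by (simp add: h0_def)
    show "h0 \<le> t (L c)" for c by (cases c) (auto simp: h0_def)
    show "\<exists>a. t (L a) = h0" by (auto simp: h0_def min_def)
  qed
  then obtain a where a: "t (L a) = h0" by blast

  let ?A = "{i. meet i Q \<and> (b i \<le> y0 \<and> h0 < t i)}"
  have BA0: "B c \<in> ?A" for c using B(1,2,3)[of c] h0(1) y by auto
  note nuA = nu[OF this B(4)]
  obtain p p' where p: "p \<in> ?A" "\<And>i. i \<in> ?A \<Longrightarrow> hue i = hue p \<Longrightarrow> - l i \<le> - l p"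
    "p' \<in> ?A" "hue p' \<noteq> hue p" "- l p \<le> - l p'"
    by (rule two_max[OF finite_meet nuA, of "\<lambda>i. - l i"]) (rule that)
  define x2 where "x2 = l p"
  \<comment> \<open>The box \<open>L a\<close> occupies the way from \<open>x0\<close> to
    \<open>x\<close> and has its top at \<open>h0\<close>. A box of the other colour that rises from
    the bottom beyond \<open>h0\<close> therefore stands to the right of \<open>x\<close>.\<close>
  have A1: "x \<le> l i" if "i \<in> ?A" "hue i \<noteq> a" for i
    using sep[of i "L a"] that a LD[of a] L(2,3,4)[of a] meetD[of i] by auto
  have x2: "x \<le> x2" using other[OF p(4), of a] A1[OF p(1)] A1[OF p(3)] p(5) two_colors[of "hue p'" "hue p" a] p(4)
    by (auto simp: x2_def)
  have x2': "x2 < x1" using p meetD[of p] by (auto simp: x2_def)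
  have Bx2: "i \<in> ?A \<Longrightarrow> l i < x2 \<Longrightarrow> hue i \<noteq> hue p" for i using p(2)[of i] by (auto simp: x2_def)

  let ?A = "{i. meet i Q \<and> (x1 \<le> r i \<and> l i < x2)}"
  have "R c \<in> ?A" for c using R(1,2,3)[of c] x x2 by auto
  note nuA = nu[OF this R(4)]
  obtain s s' where s: "s \<in> ?A" "\<And>i. i \<in> ?A \<Longrightarrow> hue i = hue s \<Longrightarrow> - b i \<le> - b s"
    "s' \<in> ?A" "hue s' \<noteq> hue s" "- b s \<le> - b s'"
    by (rule two_max[OF finite_meet nuA, of "\<lambda>i. - b i"]) (rule that)
  define y2 where "y2 = b s"
  have BA: "x2 \<le> l (B (hue p))"
    using p(2)[of "B (hue p)"] B[of "hue p"] h0(1) y by (auto simp: x2_def)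
  have A2: "y \<le> b i \<and> t p \<le> b i" if "i \<in> ?A" "hue i \<noteq> hue p" for i
  proof
    show "y \<le> b i"
      using sep[of i "B (hue p)"] that BD[of "hue p"] B(2,3,4)[of "hue p"] meetD[of i] BA by auto
    \<comment> \<open>This puts the upper left corner of \<open>p\<close> on the wall at
      \<open>x2\<close>, not above its end \<open>y2\<close>; it is the corner that is certain to be
      lost.\<close>
    show "t p \<le> b i"
      using sep[of i p] that p(1) meetD[of i] meetD[of p] by (auto simp: x2_def)
  qed
  have y2: "y \<le> y2" "t p \<le> y2" using other[OF s(4), of "hue p"] A2[OF s(1)] A2[OF s(3)] s(4,5) two_colors[of "hue s'" "hue s" "hue p"]
    by (auto simp: y2_def)
  have y2': "y2 < y1" using s meetD[of s] by (auto simp: y2_def)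
  have Ry2: "i \<in> ?A \<Longrightarrow> b i < y2 \<Longrightarrow> hue i \<noteq> hue s" for i using s(2)[of i] by (auto simp: y2_def)
  have RS: "y2 \<le> b (R (hue s))"
    using s(2)[of "R (hue s)"] R[of "hue s"] x x2 by (auto simp: y2_def)

  let ?A = "{i. meet i Q \<and> (y1 \<le> t i \<and> b i < y2)}"
  have "T c \<in> ?A" for c using T(1,2,3)[of c] y y2 by auto
  note nuA = nu[OF this T(4)]
  obtain m m' where m: "m \<in> ?A" "\<And>i. i \<in> ?A \<Longrightarrow> hue i = hue m \<Longrightarrow> r i \<le> r m"
    "m' \<in> ?A" "hue m' \<noteq> hue m" "r m \<le> r m'"
    by (rule two_max[OF finite_meet nuA, of r]) (rule that)
  define w where "w = r m"
  have A3: "r i \<le> x'" if "i \<in> ?A" "hue i \<noteq> hue s" for i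
    using sep[of i "R (hue s)"] that RD[of "hue s"] R(2,3,4)[of "hue s"] meetD[of i] RS by auto
  have w: "w \<le> x'" using other[OF m(4), of "hue s"] A3[OF m(1)] A3[OF m(3)] m(4,5) two_colors[of "hue m'" "hue m" "hue s"]
    by (auto simp: w_def)
  have w': "x0 < w" using m meetD[of m] by (auto simp: w_def)
  have Tw: "i \<in> ?A \<Longrightarrow> w < r i \<Longrightarrow> hue i \<noteq> hue m" for i using m(2)[of i] by (auto simp: w_def)
  have TM: "r (T (hue m)) \<le> w"
    using m(2)[of "T (hue m)"] T[of "hue m"] y y2 by (auto simp: w_def)

  let ?A = "{i. meet i Q \<and> (l i \<le> x0 \<and> w < r i)}"
  have LA: "L c \<in> ?A" for c using L(1,2,3)[of c] x w by auto
  note nuA = nu[OF this L(4)]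
  obtain n n' where n: "n \<in> ?A" "\<And>i. i \<in> ?A \<Longrightarrow> hue i = hue n \<Longrightarrow> t i \<le> t n"
    "n' \<in> ?A" "hue n' \<noteq> hue n" "t n \<le> t n'"
    by (rule two_max[OF finite_meet nuA, of t]) (rule that)
  define v where "v = t n"
  have A4: "t i \<le> y'" if "i \<in> ?A" "hue i \<noteq> hue m" for i
    using sep[of i "T (hue m)"] that TD[of "hue m"] T(2,3,4)[of "hue m"] meetD[of i] TM by auto
  have v: "v \<le> y'" using other[OF n(4), of "hue m"] A4[OF n(1)] A4[OF n(3)] n(4,5) two_colors[of "hue n'" "hue n" "hue m"]
    by (auto simp: v_def)
  have v': "y0 < v" using n meetD[of n] by (auto simp: v_def)
  have Lv: "i \<in> ?A \<Longrightarrow> v < t i \<Longrightarrow> hue i \<noteq> hue n" for i using n(2)[of i] by (auto simp: v_def)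
  \<comment> \<open>This closes the cycle. The wall \<open>x2\<close> was chosen for boxes that rise
    beyond \<open>h0\<close>, before \<open>v\<close> was known; boxes that rise beyond
    \<open>v\<close> are among them.\<close>
  have h0v: "h0 \<le> v" using n(2)[OF LA, of "hue n"] L(4) h0(2)[of "hue n"] by (auto simp: v_def)

  have GG: "x2 \<in> GX" "w \<in> GX" "y2 \<in> GY" "v \<in> GY"
    using grid[of p] grid[of s] grid[of m] grid[of n] p s m n meetD(1) by (auto simp: x2_def w_def y2_def v_def)
  have ord: "x0 < w" "w < x2" "x2 < x1" "y0 < v" "v < y2" "y2 < y1"
    using x y x2 x2' y2 y2' w w' v v' by auto

  define W where "W = (w, x2, v, y2)"
  define lost where "lost = {\<phi> \<in> feats_in Q. \<forall>K\<in>set (wheel Q W). \<not> inside \<phi> K}"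
  define E where "E = fst ` lost"
  \<comment> \<open>The last five conditions exclude the bottom, right, top and left sails and the
    centre, in this order.\<close>
  have lostI: "(i, (u, u'), (z, z')) \<in> lost" if "i \<in> I" "(u, u') \<in> {(l i, l i), (r i, r i), (l i, r i)}"
    "(z, z') \<in> {(b i, b i), (t i, t i), (b i, t i)}" "x0 < u" "u' < x1" "y0 < z" "z' < y1"
    "x2 \<le> u' \<or> v \<le> z'" "u \<le> x2 \<or> y2 \<le> z'" "u \<le> w \<or> z \<le> y2" "w \<le> u' \<or> z \<le> v"
    "u \<le> w \<or> x2 \<le> u' \<or> z \<le> v \<or> y2 \<le> z'" for i u u' z z'
  proof -
    have "(i, (u, u'), (z, z')) \<in> features" unfolding features_def using that(1-3) by blast
    moreover have "\<forall>K\<in>set (wheel Q W). \<not> inside (i, (u, u'), (z, z')) K"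
      using that(8-12) by (auto simp: q W_def)
    ultimately show ?thesis using that(4-7) by (simp add: lost_def feats_in_def q)
  qed
  have inE: "i \<in> E" if "(i, uv) \<in> lost" for i uv
    using that unfolding E_def by force
  \<comment> \<open>Corners on one of the four walls, \<open>x2\<close> here and \<open>v\<close>,
    \<open>y2\<close>, \<open>w\<close> next, belong to no piece.\<close>
  have Eb: "i \<in> E" if "i \<in> I" "u \<in> {l i, r i}" "z \<in> {b i, t i}" "u = x2" "y0 < z" "z \<le> y2" for i u z
    by (rule inE, rule lostI[of i u u z z]) (use that ord in auto)
  have El: "i \<in> E" if "i \<in> I" "u \<in> {l i, r i}" "z \<in> {b i, t i}" "z = v" "x0 < u" "u \<le> x2" for i u z
    by (rule inE, rule lostI[of i u u z z]) (use that ord in auto)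
  have Er: "i \<in> E" if "i \<in> I" "u \<in> {l i, r i}" "z \<in> {b i, t i}" "z = y2" "w \<le> u" "u < x1" for i u z
    by (rule inE, rule lostI[of i u u z z]) (use that ord in auto)
  have Et: "i \<in> E" if "i \<in> I" "u \<in> {l i, r i}" "z \<in> {b i, t i}" "u = w" "v \<le> z" "z < y1" for i u z
    by (rule inE, rule lostI[of i u u z z]) (use that ord in auto)
  \<comment> \<open>The corners of such a box may survive in the sails, but its horizontal side
    within the height of the centre is cut by the walls. Sides are features for the sake of this
    case and the next.\<close>
  have Eh: "i \<in> E" if "i \<in> I" "x0 < l i" "l i \<le> w" "x2 \<le> r i" "r i < x1" "z \<in> {b i, t i}" "v < z" "z < y2" for i z
    by (rule inE, rule lostI[of i "l i" "r i" z z]) (use that ord in auto)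
  have Ev: "i \<in> E" if "i \<in> I" "y0 < b i" "b i \<le> v" "y2 \<le> t i" "t i < y1" "u \<in> {l i, r i}" "w < u" "u < x2" for i u
    by (rule inE, rule lostI[of i u u "b i" "t i"]) (use that ord in auto)

  show ?thesis
  proof (rule wheel_step[OF S Q _ _ lost_def])
    show "fits Q W" "on_grid W" using ord GG by (auto simp: q W_def on_grid_def)
    have "(p, (l p, l p), (t p, t p)) \<in> lost"
      by (rule lostI) (use p meetD[of p] ord y2 in \<open>auto simp: x2_def[symmetric]\<close>)
    then show "lost \<noteq> {}" by auto
    fix K assume K: "K \<in> set (wheel Q W)"
    show "good K (fst ` lost)"
    proof (cases "unicolored K")
      case True
      then show ?thesis by (simp add: good_def)
    next
      case False
      \<comment> \<open>A box through in both directions would make \<open>K\<close> unicolored.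
        Consequently a through box that ends on a wall has a corner there and belongs to
        \<open>E\<close>; all others pass beyond the wall.\<close>
      then have nc: "\<not> (h_through i K \<and> v_through i K)" for i using cover_uni by blast
      consider "K = (x0, x2, y0, v)" | "K = (x2, x1, y0, y2)" | "K = (w, x1, y2, y1)" | "K = (x0, w, v, y1)" | "K = (w, x2, v, y2)"
        using K by (auto simp: q W_def)
      then have "sepH {i. h_through i K \<and> i \<notin> E} \<and> sepV {i. v_through i K \<and> i \<notin> E}"
      proof cases
        case k: 1
        \<comment> \<open>The wall \<open>x2\<close> was placed before the height \<open>v\<close>,
          so the boxes passing it need not overlap \<open>p\<close>. They come from the left and
          pass \<open>x\<close>, which leaves one colour.\<close>
        have "hue i = cl" if i: "h_through i K" "i \<notin> E" for i
        proof (rule mono)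
          show "meet i Q" "l i \<le> x0" using i ord by (auto simp: k q)
          have "r i \<noteq> x2" using Eb[of i "r i" "b i"] Eb[of i "r i" "t i"] i nc[of i] ord by (auto simp: k)
          then show "x < r i" using i x2 by (auto simp: k)
        qed
        moreover have "hue i \<noteq> hue p" if i: "v_through i K" "i \<notin> E" for i
        proof (rule Bx2)
          have "t i \<noteq> v" using El[of i "l i" "t i"] El[of i "r i" "t i"] i nc[of i] ord by (auto simp: k)
          then show "i \<in> {i. meet i Q \<and> (b i \<le> y0 \<and> h0 < t i)}" "l i < x2" using i ord h0v by (auto simp: k q)
        qed
        ultimately show ?thesis by (intro conjI sepH_uni sepV_uni) (blast | (rule monoI[of _ "hue p"], blast))+
      next
        case k: 2
        have "hue i \<noteq> hue s" if i: "h_through i K" "i \<notin> E" for i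
        proof (rule Ry2)
          have "l i \<noteq> x2" using Eb[of i "l i" "b i"] Eb[of i "l i" "t i"] i nc[of i] ord by (auto simp: k)
          then show "i \<in> {i. meet i Q \<and> (x1 \<le> r i \<and> l i < x2)}" "b i < y2" using i ord by (auto simp: k q)
        qed
        \<comment> \<open>The box \<open>s\<close> rests on the wall at \<open>y2\<close> and
          stretches from there over the whole width of the sail, so a box rising through this wall
          overlaps it.\<close>
        moreover have "hue i = hue s" if i: "v_through i K" "i \<notin> E" for i
        proof -
          have "t i \<noteq> y2" using Er[of i "l i" "t i"] Er[of i "r i" "t i"] i nc[of i] ord by (auto simp: k)
          then have "y2 < t i" "meet i Q" "b i \<le> y0" "x2 < r i" "l i < x1" using i ord by (auto simp: k q)
          then show ?thesis using sep[of i s] s(1) meetD[of i] meetD[of s] ord by (auto simp: y2_def)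
        qed
        ultimately show ?thesis by (intro conjI sepH_uni sepV_uni) (blast | (rule monoI[of _ "hue s"], blast))+
      next
        case k: 3
        have "hue i = hue m" if i: "h_through i K" "i \<notin> E" for i
        proof -
          have "l i \<noteq> w" using Et[of i "l i" "b i"] Et[of i "l i" "t i"] i nc[of i] ord by (auto simp: k)
          then have "l i < w" "meet i Q" "x1 \<le> r i" "y2 < t i" "b i < y1" using i ord by (auto simp: k q)
          then show ?thesis using sep[of i m] m(1) meetD[of i] meetD[of m] ord by (auto simp: w_def)
        qed
        moreover have "hue i \<noteq> hue m" if i: "v_through i K" "i \<notin> E" for i
        proof (rule Tw)
          have "b i \<noteq> y2" using Er[of i "l i" "b i"] Er[of i "r i" "b i"] i nc[of i] ord by (auto simp: k)
          then show "i \<in> {i. meet i Q \<and> (y1 \<le> t i \<and> b i < y2)}" "w < r i" using i ord by (auto simp: k q)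
        qed
        ultimately show ?thesis by (intro conjI sepH_uni sepV_uni) (blast | (rule monoI[of _ "hue m"], blast))+
      next
        case k: 4
        have "hue i = hue n" if i: "v_through i K" "i \<notin> E" for i
        proof -
          have "b i \<noteq> v" using El[of i "l i" "b i"] El[of i "r i" "b i"] i nc[of i] ord by (auto simp: k)
          then have "b i < v" "meet i Q" "y1 \<le> t i" "x0 < r i" "l i < w" using i ord by (auto simp: k q)
          then show ?thesis using sep[of i n] n(1) meetD[of i] meetD[of n] ord by (auto simp: v_def)
        qed
        moreover have "hue i \<noteq> hue n" if i: "h_through i K" "i \<notin> E" for i
        proof (rule Lv)
          have "r i \<noteq> w" using Et[of i "r i" "b i"] Et[of i "r i" "t i"] i nc[of i] ord by (auto simp: k)
          then show "i \<in> {i. meet i Q \<and> (l i \<le> x0 \<and> w < r i)}" "v < t i" using i ord by (auto simp: k q)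
        qed
        ultimately show ?thesis by (intro conjI sepH_uni sepV_uni) (blast | (rule monoI[of _ "hue n"], blast))+
      next
        case k: 5
        obtain nn ss pp mm where cc: "nn \<noteq> hue n" "ss \<noteq> hue s" "pp \<noteq> hue p" "mm \<noteq> hue m"
          using color.distinct by metis
        \<comment> \<open>A box from the left passes under the top boxes of the other colour and
          stays below \<open>y'\<close>; a box from the right passes over the bottom boxes and stays
          above. The choices of \<open>n\<close> and \<open>s\<close> leave one colour on each side.
          A box that touches neither side of \<open>Q\<close> loses a side.\<close>
        have hs: "t i \<le> y' \<and> hue i = nn \<or> y' \<le> b i \<and> hue i = ss" if i: "h_through i K" "i \<notin> E" for i
        proof -
          have m': "meet i Q" "l i \<le> w" "x2 \<le> r i" "v < t i" "b i < y2" using i ord by (auto simp: k q)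
          consider "l i \<le> x0" | "x1 \<le> r i" | "x0 < l i" "r i < x1" by linarith
          then show ?thesis
          proof cases
            case 1
            have "hue i = nn" using two_colors[OF Lv[of i] cc(1)] 1 m' ord by auto
            moreover obtain c where c: "c \<noteq> hue i" using color.distinct by metis
            have "t i \<le> y'"
              using sep[of i "T c"] c T(2,3,4)[of c] TD[of c] pos(3)[of c] 1 m' meetD[of i] x x2 by auto
            ultimately show ?thesis by simp
          next
            case 2
            have "hue i = ss" using two_colors[OF Ry2[of i] cc(2)] 2 m' ord by auto
            moreover obtain c where c: "c \<noteq> hue i" using color.distinct by metis
            have "y' \<le> b i"
              using sep[of i "B c"] c B(2,3,4)[of c] BD[of c] pos(4)[of c] 2 m' meetD[of i] x w y by auto
            ultimately show ?thesis by simp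
          next
            case 3
            then show ?thesis using Eh[of i "b i"] Eh[of i "t i"] i nc[of i] m' meetD[of i] by (auto simp: k)
          qed
        qed
        have vs: "r i \<le> x' \<and> hue i = mm \<or> x' \<le> l i \<and> hue i = pp" if i: "v_through i K" "i \<notin> E" for i
        proof -
          have m': "meet i Q" "b i \<le> v" "y2 \<le> t i" "w < r i" "l i < x2" using i ord by (auto simp: k q)
          consider "y1 \<le> t i" | "b i \<le> y0" | "y0 < b i" "t i < y1" by linarith
          then show ?thesis
          proof cases
            case 1
            have "hue i = mm" using two_colors[OF Tw[of i] cc(4)] 1 m' ord by auto
            moreover obtain c where c: "c \<noteq> hue i" using color.distinct by metis
            have "r i \<le> x'"
              using sep[of i "R c"] c R(2,3,4)[of c] RD[of c] pos(2)[of c] 1 m' meetD[of i] y v by auto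
            ultimately show ?thesis by simp
          next
            case 2
            have "hue i = pp" using two_colors[OF Bx2[of i] cc(3)] 2 m' ord h0(1) y y2 by auto
            moreover obtain c where c: "c \<noteq> hue i" using color.distinct by metis
            have "x' \<le> l i"
              using sep[of i "L c"] c L(2,3,4)[of c] LD[of c] pos(1)[of c] 2 m' meetD[of i] y y2 x by auto
            ultimately show ?thesis by simp
          next
            case 3
            then show ?thesis using Ev[of i "l i"] Ev[of i "r i"] i nc[of i] m' meetD[of i] by (auto simp: k)
          qed
        qed
        have "sepH {i. h_through i K \<and> i \<notin> E}"
          unfolding sepH_def
          by (rule disjI2, rule bexI[OF _ y(2)], rule exI[of _ nn], rule exI[of _ ss]) (use hs in blast)
        moreover have "sepV {i. v_through i K \<and> i \<notin> E}"
          unfolding sepV_def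
          by (rule disjI2, rule bexI[OF _ x(4)], rule exI[of _ mm], rule exI[of _ pp]) (use vs in blast)
        ultimately show ?thesis by blast
      qed
      then show ?thesis by (simp add: good_def E_def)
    qed
  qed
qed

text \<open>A box from the left that passes \<open>x\<close> must go under \<open>T d\<close> if its
  colour is \<open>c\<close> and over \<open>B c\<close> if its colour is \<open>d\<close>: there is
  one colour change, at \<open>y'\<close>. From the right the two colours change roles. So a
  straight cut at \<open>x\<close> suffices although both colours cross it.\<close>

lemma crossing:
  fixes L R B T :: "color \<Rightarrow> 'i"
  assumes S: "solved (card (feats_in Q))" and q: "Q = (x0, x1, y0, y1)" and Q: "on_grid Q" "thr_unicolored Q"
    and x: "x0 < x" "x < x1" "x' < x" "x \<in> GX" and y: "y' < y" "y' \<in> GY"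
    and corner: "p \<in> I" "r p = x" "v \<in> {b p, t p}" "y0 < v" "v < y1"
    and L: "\<And>c. meet (L c) Q" "\<And>c. l (L c) \<le> x0" "\<And>c. x \<le> r (L c)" "\<And>c. hue (L c) = c"
    and R: "\<And>c. meet (R c) Q" "\<And>c. x1 \<le> r (R c)" "\<And>c. l (R c) \<le> x'" "\<And>c. hue (R c) = c"
    and B: "\<And>c. meet (B c) Q" "\<And>c. b (B c) \<le> y0" "\<And>c. y \<le> t (B c)" "\<And>c. hue (B c) = c"
    and T: "\<And>c. meet (T c) Q" "\<And>c. y1 \<le> t (T c)" "\<And>c. b (T c) \<le> y'" "\<And>c. hue (T c) = c"
    and cd: "c \<noteq> d"
    and pos: "r (T d) \<le> x'" "x \<le> l (B d)" "x \<le> l (T c)" "r (B c) \<le> x'"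
  shows "tiling ok GX GY Q (1 + 130 * card (feats_in Q))"
proof (rule cut_vertical[OF S q Q x(4) x(1,2) corner(1) _ corner(3-5)])
  note meetD = meetD[of _ x0 x1 y0 y1, folded q]
  have cases: "hue i = c \<or> hue i = d" for i
    using two_colors[of "hue i" c d] cd by auto
  show "x \<in> {l p, r p}" using corner by simp
  have l1: "t i \<le> y' \<and> hue i = c \<or> y' \<le> b i \<and> hue i = d" if "meet i Q" "l i \<le> x0" "x < r i" for i
    using cases[of i] sep[of i "T d"] sep[of i "B c"] cd that meetD[of i] meetD[OF T(1)[of d]] meetD[OF B(1)[of c]]
      T(2-4)[of d] B(2-4)[of c] pos x y by auto
  show "sepH {i. meet i Q \<and> l i \<le> x0 \<and> x < r i}"
    unfolding sepH_def by (rule disjI2, rule bexI[OF _ y(2)], rule exI[of _ c], rule exI[of _ d]) (use l1 in blast)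
  have r1: "t i \<le> y' \<and> hue i = d \<or> y' \<le> b i \<and> hue i = c" if "meet i Q" "x1 \<le> r i" "l i < x" for i
    using cases[of i] sep[of i "T c"] sep[of i "B d"] cd that meetD[of i] meetD[OF T(1)[of c]] meetD[OF B(1)[of d]]
      T(2-4)[of c] B(2-4)[of d] pos x y by auto
  show "sepH {i. meet i Q \<and> x1 \<le> r i \<and> l i < x}"
    unfolding sepH_def by (rule disjI2, rule bexI[OF _ y(2)], rule exI[of _ d], rule exI[of _ c]) (use r1 in blast)
qed

text \<open>When straight cuts fail in both directions, bundles of both colours come from all four
  sides. Bundles of different colours must avoid each other: if the left bundle of one colour is
  low, the right one is high, and conversely. If the colours agree on this, they turn around a
  centre; if not, \<open>crossing\<close> applies.\<close>

lemma solved_step: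
  assumes S: "solved (card (feats_in Q))" and Q: "on_grid Q" "thr_unicolored Q"
  shows "tiling ok GX GY Q (1 + 130 * card (feats_in Q))"
proof (rule ccontr)
  assume np: "\<not> tiling ok GX GY Q (1 + 130 * card (feats_in Q))"
  interpret T: family I b t l r hue "ok \<circ> flip" GY GX
    by (rule flip_family)
  have nu: "\<not> unicolored Q" using np uni_part[of Q] by auto
  obtain x0 x1 y0 y1 where q: "Q = (x0, x1, y0, y1)" by (cases Q)
  have fq: "flip Q = (y0, y1, x0, x1)" by (simp add: q)
  have mf: "T.meet i (y0, y1, x0, x1) = meet i Q" for i using T_meet[of i Q] by (simp only: fq)
  obtain x x' where sx: "stuck Q x x'" using vertical[OF S Q nu np] by blast
  obtain y y' where sy: "T.stuck (flip Q) y y'"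
    using T.vertical[of "flip Q"] S Q nu np by (auto simp: T_solved T_ft T_inG T_thuni T_uni tiling_flip_iff)
  note ex = sx[unfolded stuck_def q prod.case, folded q]
  note ey = sy[unfolded T.stuck_def fq prod.case mf]
  have "\<exists>p\<in>I. r p = x \<and> (\<exists>v\<in>{b p, t p}. y0 < v \<and> v < y1)" using ex by (elim conjE)
  then obtain p v where px: "p \<in> I" "r p = x" "v \<in> {b p, t p}" "y0 < v" "v < y1" by blast
  obtain cl where cl: "\<And>i. meet i Q \<Longrightarrow> l i \<le> x0 \<Longrightarrow> x < r i \<Longrightarrow> hue i = cl" using ex by blast
  obtain cb where cb: "\<And>i. meet i Q \<Longrightarrow> b i \<le> y0 \<Longrightarrow> y < t i \<Longrightarrow> hue i = cb" using ey by blast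
  have X: "x \<in> GX" "x' \<in> GX" "x' < x" "x0 < x" "x < x1" using ex by blast+
  have Y: "y \<in> GY" "y' \<in> GY" "y' < y" "y0 < y" "y < y1" using ey by blast+
  have "\<forall>c. \<exists>i. meet i Q \<and> l i \<le> x0 \<and> x \<le> r i \<and> hue i = c" using ex by blast
  then obtain L where L: "\<And>c. meet (L c) Q" "\<And>c. l (L c) \<le> x0" "\<And>c. x \<le> r (L c)" "\<And>c. hue (L c) = c" by metis
  have "\<forall>c. \<exists>i. meet i Q \<and> x1 \<le> r i \<and> l i \<le> x' \<and> hue i = c" using ex by blast
  then obtain R where R: "\<And>c. meet (R c) Q" "\<And>c. x1 \<le> r (R c)" "\<And>c. l (R c) \<le> x'" "\<And>c. hue (R c) = c" by metis
  have "\<forall>c. \<exists>i. meet i Q \<and> b i \<le> y0 \<and> y \<le> t i \<and> hue i = c" using ey by blast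
  then obtain B where B: "\<And>c. meet (B c) Q" "\<And>c. b (B c) \<le> y0" "\<And>c. y \<le> t (B c)" "\<And>c. hue (B c) = c" by metis
  have "\<forall>c. \<exists>i. meet i Q \<and> y1 \<le> t i \<and> b i \<le> y' \<and> hue i = c" using ey by blast
  then obtain T where T: "\<And>c. meet (T c) Q" "\<And>c. y1 \<le> t (T c)" "\<And>c. b (T c) \<le> y'" "\<And>c. hue (T c) = c" by metis
  note meetD = meetD[of _ x0 x1 y0 y1, folded q]
  note LD = meetD[OF L(1)] note RD = meetD[OF R(1)] note BD = meetD[OF B(1)] note TD = meetD[OF T(1)]
  have LT: "t (L c) \<le> y' \<or> x \<le> l (T d)" and LB: "y \<le> b (L c) \<or> x \<le> l (B d)"
    and RT: "t (R c) \<le> y' \<or> r (T d) \<le> x'" and RB: "y \<le> b (R c) \<or> r (B d) \<le> x'" if "c \<noteq> d" for c d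
    using that sep[of "L c" "T d"] sep[of "L c" "B d"] sep[of "R c" "T d"] sep[of "R c" "B d"]
      L(2-4)[of c] R(2-4)[of c] B(2-4)[of d] T(2-4)[of d] LD[of c] RD[of c] BD[of d] TD[of d] X Y by auto
  have TT: "\<not> (x \<le> l (T d) \<and> r (T d) \<le> x')" and BB: "\<not> (x \<le> l (B d) \<and> r (B d) \<le> x')"
    and LL: "\<not> (t (L d) \<le> y' \<and> y \<le> b (L d))" and RR: "\<not> (t (R d) \<le> y' \<and> y \<le> b (R d))" for d
    using TD[of d] BD[of d] LD[of d] RD[of d] X(3) Y(3) by auto
  define lowhigh where "lowhigh c \<longleftrightarrow> t (L c) \<le> y' \<and> y \<le> b (R c)" for c
  define highlow where "highlow c \<longleftrightarrow> y \<le> b (L c) \<and> t (R c) \<le> y'" for c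
  have lh: "lowhigh c \<or> highlow c" for c
  proof -
    obtain d where "c \<noteq> d" using color.distinct by metis
    from LT[OF this] LB[OF this] RT[OF this] RB[OF this] TT[of d] BB[of d] LL[of c] RR[of c]
    show ?thesis unfolding lowhigh_def highlow_def by blast
  qed
  have mixed: False if "lowhigh c" "highlow d" "c \<noteq> d" for c d
  proof -
    have "r (T d) \<le> x'" "x \<le> l (B d)" "x \<le> l (T c)" "r (B c) \<le> x'"
      using that LT[of c d] LB[of c d] RT[of c d] RB[of c d] LT[of d c] LB[of d c] RT[of d c] RB[of d c]
        LL[of c] RR[of c] LL[of d] RR[of d] unfolding lowhigh_def highlow_def by auto
    then show False
      using crossing[OF S q Q X(4,5,3,1) Y(3,2) px L R B T that(3)] np by blast
  qed
  consider "lowhigh Red" "lowhigh Blue" | "highlow Red" "highlow Blue"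
    using lh[of Red] lh[of Blue] mixed[of Red Blue] mixed[of Blue Red] by auto
  then show False
  proof cases
    case 1
    then have lo: "lowhigh c" for c by (cases c) auto
    have "r (T d) \<le> x' \<and> x \<le> l (B d)" for d
    proof -
      obtain c where "c \<noteq> d" using color.distinct by metis
      from LB[OF this] RT[OF this] LL[of c] RR[of c] lo[of c] show ?thesis unfolding lowhigh_def by blast
    qed
    then show False
      using pinwheel[OF S q Q(1) X(4,5,3,2) Y(3,2) cl L R B T] lo np unfolding lowhigh_def by blast
  next
    case 2
    then have lo: "highlow c" for c by (cases c) auto
    have p: "r (B d) \<le> x' \<and> x \<le> l (T d)" for d
    proof -
      obtain c where "c \<noteq> d" using color.distinct by metis
      from LT[OF this] RB[OF this] LL[of c] RR[of c] lo[of c] show ?thesis unfolding highlow_def by blast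
    qed
    \<comment> \<open>The opposite sense of rotation: transposition exchanges left with bottom and
      right with top, and the bundles then turn as in \<open>pinwheel\<close>.\<close>
    have "tiling (ok \<circ> flip) GY GX (flip Q) (1 + 130 * card (T.feats_in (flip Q)))"
    proof (rule T.pinwheel[OF _ fq _ Y(4,5,3,2) X(3,2), where L = B and R = T and B = L and T = R and cl = cb])
      show "T.solved (card (T.feats_in (flip Q)))" "T.on_grid (flip Q)" using S Q by (simp_all add: T_solved T_ft T_inG)
    qed (use cb L R B T lo p in \<open>auto simp: T_meet highlow_def\<close>)
    then show False using np by (simp only: tiling_flip_iff T_ft)
  qed
qed

theorem tiling_exists:
  assumes "on_grid Q" "thr_unicolored Q"
  shows "tiling ok GX GY Q (1 + 130 * card (feats_in Q))"
  using assms
proof (induction "card (feats_in Q)" arbitrary: Q rule: less_induct)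
  case less
  then have "solved (card (feats_in Q))" by (simp add: solved_def)
  then show ?case using solved_step less by blast
qed

end

subsection \<open>Lines between the points\<close>

text \<open>For finite \<open>X\<close> this means one value in every gap between consecutive
  elements of \<open>X\<close> and one beyond either end.\<close>

definition lines :: "real set \<Rightarrow> real set \<Rightarrow> bool" where
  "lines X G \<longleftrightarrow> G \<inter> X = {} \<and> (\<forall>g\<in>G. \<forall>g'\<in>G. g < g' \<longrightarrow> (\<exists>x\<in>X. g < x \<and> x < g')) \<and>
     (\<exists>g\<in>G. \<forall>x\<in>X. g < x) \<and> (\<forall>x\<in>X. \<exists>g\<in>G. x < g \<and> (\<forall>x'\<in>X. x < x' \<longrightarrow> g < x'))"

lemma lines_above: "lines X G \<Longrightarrow> x \<in> X \<Longrightarrow> \<exists>g\<in>G. x < g \<and> (\<forall>x'\<in>X. x < x' \<longrightarrow> g < x')"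
  by (simp add: lines_def)

lemma lines_below: "lines X G \<Longrightarrow> \<exists>g\<in>G. \<forall>x\<in>X. g < x"
  by (simp add: lines_def)

lemma lines_between: "lines X G \<Longrightarrow> g \<in> G \<Longrightarrow> g' \<in> G \<Longrightarrow> g < g' \<Longrightarrow> \<exists>x\<in>X. g < x \<and> x < g'"
  by (simp add: lines_def)

text \<open>Each end of the interval moves within its gap to the line there, which changes none of
  the points inside. The point \<open>z\<close> keeps the two ends in different gaps, so the new
  interval is not empty.\<close>

lemma lines_snap:
  assumes "lines X G" "finite X" "z \<in> X" "a < z" "z < b"
  shows "\<exists>u\<in>G. \<exists>v\<in>G. u < v \<and> (\<forall>x\<in>X. u < x \<and> x < v \<longleftrightarrow> a < x \<and> x < b)"
proof -
  have *: "\<exists>z\<in>A. \<forall>x\<in>A. x \<le> z" if "A \<subseteq> X" "A \<noteq> {}" for A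
    using ex_argmin[of A "\<lambda>x. - x"] that assms(2) finite_subset by auto
  obtain m where m: "m \<in> X" "a < m" "m < b" "\<And>x. x \<in> X \<Longrightarrow> a < x \<Longrightarrow> x < b \<Longrightarrow> x \<le> m"
  proof -
    have "\<exists>m\<in>{x \<in> X. a < x \<and> x < b}. \<forall>x\<in>{x \<in> X. a < x \<and> x < b}. x \<le> m"
      using assms(3-5) by (intro *) auto
    then obtain m where "m \<in> {x \<in> X. a < x \<and> x < b}" "\<forall>x\<in>{x \<in> X. a < x \<and> x < b}. x \<le> m"
      by (rule bexE)
    then show ?thesis by (intro that[of m]) simp_all
  qed
  then obtain v where v: "v \<in> G" "m < v" "\<And>x. x \<in> X \<Longrightarrow> m < x \<Longrightarrow> v < x"
    using lines_above[OF assms(1)] by blast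
  have "\<exists>u\<in>G. \<forall>x\<in>X. (a < x \<longrightarrow> u < x) \<and> (x \<le> a \<longrightarrow> x < u)"
  proof (cases "\<exists>x\<in>X. x \<le> a")
    case False
    then show ?thesis using lines_below[OF assms(1)] by (meson not_le)
  next
    case True
    obtain k where k: "k \<in> X" "k \<le> a" "\<And>x. x \<in> X \<Longrightarrow> x \<le> a \<Longrightarrow> x \<le> k"
    proof -
      have "\<exists>k\<in>{x \<in> X. x \<le> a}. \<forall>x\<in>{x \<in> X. x \<le> a}. x \<le> k"
        using True by (intro *) auto
      then obtain k where "k \<in> {x \<in> X. x \<le> a}" "\<forall>x\<in>{x \<in> X. x \<le> a}. x \<le> k"
        by (rule bexE)
      then show ?thesis by (intro that[of k]) simp_all
    qed
    then obtain u where u: "u \<in> G" "k < u" "\<And>x. x \<in> X \<Longrightarrow> k < x \<Longrightarrow> u < x"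
      using lines_above[OF assms(1)] by blast
    have "\<forall>x\<in>X. (a < x \<longrightarrow> u < x) \<and> (x \<le> a \<longrightarrow> x < u)"
      using u k by fastforce
    then show ?thesis using u by blast
  qed
  then obtain u where u: "u \<in> G" "\<forall>x\<in>X. (a < x \<longrightarrow> u < x) \<and> (x \<le> a \<longrightarrow> x < u)" by blast
  have "u < v" using u m v by fastforce
  moreover have "\<forall>x\<in>X. u < x \<and> x < v \<longleftrightarrow> a < x \<and> x < b"
  proof
    fix x assume x: "x \<in> X"
    show "u < x \<and> x < v \<longleftrightarrow> a < x \<and> x < b"
    proof (cases "a < x")
      case True
      have "x < v \<longleftrightarrow> x < b"
      proof
        assume "x < v"
        then have "x \<le> m" using v(3)[OF x] by fastforce
        then show "x < b" using m(3) by simp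
      next
        assume "x < b"
        then show "x < v" using m(4)[OF x True] v(2) by simp
      qed
      then show ?thesis using True u x by blast
    next
      case False
      then show ?thesis using u x by fastforce
    qed
  qed
  ultimately show ?thesis using u v by blast
qed

section \<open>Tilings obtained from covers of the points\<close>

fun in_quad :: "point \<Rightarrow> real quad \<Rightarrow> bool" where
  "in_quad p (x0, x1, y0, y1) \<longleftrightarrow> x0 < fst p \<and> fst p < x1 \<and> y0 < snd p \<and> snd p < y1"

definition monochromatic :: "point set \<Rightarrow> (point \<Rightarrow> color) \<Rightarrow> real quad \<Rightarrow> bool" where
  "monochromatic S col Q \<longleftrightarrow> (\<forall>p\<in>S. \<forall>q\<in>S. in_quad p Q \<and> in_quad q Q \<longrightarrow> col p = col q)"

text \<open>Disjointness is demanded only at pairs of coordinates of the points, and this survives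
  snapping to the lines: if two snapped boxes overlap, their intersection is again bounded by lines
  and contains such a pair.\<close>

lemma tiling_of_boxes:
  fixes a b c d :: "'i \<Rightarrow> real"
  assumes S: "finite S" and G: "lines (fst ` S) GX" "lines (snd ` S) GY" and I: "finite I"
    and box: "\<And>i. i \<in> I \<Longrightarrow> \<exists>p\<in>S. a i < fst p \<and> fst p < b i \<and> c i < snd p \<and> snd p < d i"
    and disj: "\<And>i j x y. i \<in> I \<Longrightarrow> j \<in> I \<Longrightarrow> hue i \<noteq> hue j \<Longrightarrow> x \<in> fst ` S \<Longrightarrow> y \<in> snd ` S \<Longrightarrow>
      a i < x \<and> x < b i \<and> c i < y \<and> y < d i \<Longrightarrow> a j < x \<and> x < b j \<and> c j < y \<and> y < d j \<Longrightarrow> False"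
    and cov: "\<And>p. p \<in> S \<Longrightarrow> \<exists>i\<in>I. hue i = col p \<and> a i < fst p \<and> fst p < b i \<and> c i < snd p \<and> snd p < d i"
    and Q: "Q \<in> GX \<times> GX \<times> GY \<times> GY"
  shows "tiling (monochromatic S col) GX GY Q (6 + 1190 * card I)"
proof -
  have fin: "finite (fst ` S)" "finite (snd ` S)" using S by auto
  have "\<exists>u v. u \<in> GX \<and> v \<in> GX \<and> u < v \<and> (\<forall>x\<in>fst ` S. u < x \<and> x < v \<longleftrightarrow> a i < x \<and> x < b i)" if i: "i \<in> I" for i
  proof -
    obtain p where "p \<in> S" "a i < fst p \<and> fst p < b i \<and> c i < snd p \<and> snd p < d i" using box[OF i] by blast
    then show ?thesis using lines_snap[OF G(1) fin(1), of "fst p" "a i" "b i"] by blast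
  qed
  then obtain l r where lr: "\<And>i. i \<in> I \<Longrightarrow> l i \<in> GX \<and> r i \<in> GX \<and> l i < r i"
    "\<And>i x. i \<in> I \<Longrightarrow> x \<in> fst ` S \<Longrightarrow> l i < x \<and> x < r i \<longleftrightarrow> a i < x \<and> x < b i"
    by metis
  have "\<exists>u v. u \<in> GY \<and> v \<in> GY \<and> u < v \<and> (\<forall>x\<in>snd ` S. u < x \<and> x < v \<longleftrightarrow> c i < x \<and> x < d i)" if i: "i \<in> I" for i
  proof -
    obtain p where "p \<in> S" "a i < fst p \<and> fst p < b i \<and> c i < snd p \<and> snd p < d i" using box[OF i] by blast
    then show ?thesis using lines_snap[OF G(2) fin(2), of "snd p" "c i" "d i"] by blast
  qed
  then obtain bo t where bt: "\<And>i. i \<in> I \<Longrightarrow> bo i \<in> GY \<and> t i \<in> GY \<and> bo i < t i"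
    "\<And>i x. i \<in> I \<Longrightarrow> x \<in> snd ` S \<Longrightarrow> bo i < x \<and> x < t i \<longleftrightarrow> c i < x \<and> x < d i"
    by metis
  have between: "\<exists>x\<in>X. max u u' < x \<and> x < min v v'"
    if "lines X G" "{u, u', v, v'} \<subseteq> G" "u < v" "u' < v'" "u < v'" "u' < v" for X G u u' v v'
  proof -
    have "max u u' \<in> G" "min v v' \<in> G" "max u u' < min v v'" using that by (auto simp: max_def min_def)
    then show ?thesis by (rule lines_between[OF that(1)])
  qed
  interpret family I l r bo t hue "monochromatic S col" GX GY
  proof
    show "r i \<le> l j \<or> r j \<le> l i \<or> t i \<le> bo j \<or> t j \<le> bo i" if ij: "i \<in> I" "j \<in> I" "hue i \<noteq> hue j" for i j
    proof (rule ccontr)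
      assume "\<not> ?thesis"
      then have lt: "l j < r i" "l i < r j" "bo j < t i" "bo i < t j" by auto
      obtain x where x: "x \<in> fst ` S" "max (l i) (l j) < x" "x < min (r i) (r j)"
        using between[OF G(1), of "l i" "l j" "r i" "r j"] lr(1) ij lt by auto
      obtain y where y: "y \<in> snd ` S" "max (bo i) (bo j) < y" "y < min (t i) (t j)"
        using between[OF G(2), of "bo i" "bo j" "t i" "t j"] bt(1) ij lt by auto
      show False using disj[OF ij x(1) y(1)] lr(2)[of i x] lr(2)[of j x] bt(2)[of i y] bt(2)[of j y] ij x y by auto
    qed
    show "monochromatic S col (x0, x1, y0, y1)"
      if H: "\<And>i j. i \<in> I \<Longrightarrow> j \<in> I \<Longrightarrow> x0 < x1 \<and> y0 < y1 \<and> l i < x1 \<and> x0 < r i \<and> bo i < y1 \<and> y0 < t i \<Longrightarrow>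
        l j < x1 \<and> x0 < r j \<and> bo j < y1 \<and> y0 < t j \<Longrightarrow> hue i = hue j" for x0 x1 y0 y1
      unfolding monochromatic_def
    proof (intro ballI impI)
      fix p q assume p: "p \<in> S" and q: "q \<in> S" and pq: "in_quad p (x0, x1, y0, y1) \<and> in_quad q (x0, x1, y0, y1)"
      obtain i where i: "i \<in> I" "hue i = col p" "a i < fst p \<and> fst p < b i" "c i < snd p \<and> snd p < d i" using cov[OF p] by blast
      obtain j where j: "j \<in> I" "hue j = col q" "a j < fst q \<and> fst q < b j" "c j < snd q \<and> snd q < d j" using cov[OF q] by blast
      have i': "l i < fst p \<and> fst p < r i" "bo i < snd p \<and> snd p < t i" using lr(2)[of i "fst p"] bt(2)[of i "snd p"] i p by auto
      have j': "l j < fst q \<and> fst q < r j" "bo j < snd q \<and> snd q < t j" using lr(2)[of j "fst q"] bt(2)[of j "snd q"] j q by auto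
      show "col p = col q" using H[OF i(1) j(1)] i' j' pq i(2) j(2) by auto
    qed
  qed (use I lr(1) bt(1) in auto)
  have "solved (Suc (card (feats_in Q)))" using tiling_exists by (simp add: solved_def)
  \<comment> \<open>The through boxes of the given rectangle may have any colours, so all boxes are
    declared exceptional. This costs 20 per box, and 130 for each of 9 features makes 1190.\<close>
  moreover have "good Q I" by (cases Q) (auto simp: good_def sepH_def sepV_def)
  ultimately have "tiling (monochromatic S col) GX GY Q (6 + 130 * card (feats_in Q) + 20 * card I)"
    using good_part[of "Suc (card (feats_in Q))" Q I] I Q by (simp add: on_grid_def)
  moreover have "card (feats_in Q) \<le> 9 * card I"
    using card_mono[OF finite_feats, of "feats_in Q"] card_feats by (auto simp: feats_in_def)
  ultimately show ?thesis by (elim tiling_mono) simp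
qed

text \<open>Boxes around the points, too small to contain another coordinate, satisfy the
  assumptions of \<open>tiling_of_boxes\<close>. The resulting linear bound on the cost limits the
  rounds of the program.\<close>

lemma tiling_points:
  assumes S: "finite S" and G: "lines (fst ` S) GX" "lines (snd ` S) GY" and Q: "Q \<in> GX \<times> GX \<times> GY \<times> GY"
  shows "tiling (monochromatic S col) GX GY Q (6 + 1190 * card S)"
proof -
  have iso: "\<exists>e>0. \<forall>x\<in>X. \<bar>x - z\<bar> < e \<longrightarrow> x = z" if "finite X" for X and z :: real
    using finite_set_avoid[OF that, of z] by (auto simp: dist_real_def abs_minus_commute) (meson linorder_not_less)
  obtain e where e: "\<And>z. e z > 0" "\<And>z x. x \<in> fst ` S \<Longrightarrow> \<bar>x - z\<bar> < e z \<Longrightarrow> x = z"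
    using iso[of "fst ` S"] S by (metis finite_imageI)
  obtain f where f: "\<And>z. f z > 0" "\<And>z x. x \<in> snd ` S \<Longrightarrow> \<bar>x - z\<bar> < f z \<Longrightarrow> x = z"
    using iso[of "snd ` S"] S by (metis finite_imageI)
  have e': "x = z" if "x \<in> fst ` S" "z - e z < x" "x < z + e z" for x z
    using e(2)[of x z] that by (simp add: abs_less_iff)
  have f': "x = z" if "x \<in> snd ` S" "z - f z < x" "x < z + f z" for x z
    using f(2)[of x z] that by (simp add: abs_less_iff)
  show ?thesis
  proof (rule tiling_of_boxes[OF S G S _ _ _ Q, where hue = col
        and a = "\<lambda>p. fst p - e (fst p)" and b = "\<lambda>p. fst p + e (fst p)"
        and c = "\<lambda>p. snd p - f (snd p)" and d = "\<lambda>p. snd p + f (snd p)"])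
    show "\<exists>q\<in>S. fst p - e (fst p) < fst q \<and> fst q < fst p + e (fst p) \<and> snd p - f (snd p) < snd q \<and> snd q < snd p + f (snd p)"
      if "p \<in> S" for p using that e(1) f(1) by (intro bexI[of _ p]) auto
    show "\<exists>q\<in>S. col q = col p \<and> fst q - e (fst q) < fst p \<and> fst p < fst q + e (fst q) \<and> snd q - f (snd q) < snd p \<and> snd p < snd q + f (snd q)"
      if "p \<in> S" for p using that e(1) f(1) by (intro bexI[of _ p]) auto
    show False if "p \<in> S" "q \<in> S" "col p \<noteq> col q" "x \<in> fst ` S" "y \<in> snd ` S"
      "fst p - e (fst p) < x \<and> x < fst p + e (fst p) \<and> snd p - f (snd p) < y \<and> y < snd p + f (snd p)"
      "fst q - e (fst q) < x \<and> x < fst q + e (fst q) \<and> snd q - f (snd q) < y \<and> y < snd q + f (snd q)" for p q x y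
    proof -
      have "p = q" using e'[of x "fst p"] e'[of x "fst q"] f'[of y "snd p"] f'[of y "snd q"] that
        by (intro prod_eqI) auto
      then show False using that by simp
    qed
  qed
qed

text \<open>A box of an SBCC that covers a point covers one colour only, which becomes its hue.
  Boxes that cover nothing are discarded, since snapping needs a point inside.\<close>

lemma tiling_sbcc:
  assumes S: "finite S" and G: "lines (fst ` S) GX" "lines (snd ` S) GY" and Q: "Q \<in> GX \<times> GX \<times> GY \<times> GY"
    and B: "is_sbcc S col B"
  shows "tiling (monochromatic S col) GX GY Q (6 + 1190 * card B)"
proof -
  let ?I = "{K \<in> B. \<exists>p\<in>S. covers K p}"
  have fB: "finite B" using B by (simp add: is_sbcc_def)
  have bx: "\<exists>R. interior K = {p. in_quad p R}" if K: "K \<in> B" for K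
  proof -
    have "is_box K" using B K by (simp add: is_sbcc_def)
    then obtain u v where "K = cbox u v" unfolding is_box_def by (elim conjE exE)
    then have "interior K = box u v" by simp
    moreover have "p \<in> box u v \<longleftrightarrow> in_quad p (fst u, fst v, snd u, snd v)" for p
      by (cases u; cases v; cases p) (auto simp: mem_box Basis_prod_def)
    ultimately have "interior K = {p. in_quad p (fst u, fst v, snd u, snd v)}"
      by auto
    then show ?thesis by (rule exI)
  qed
  define q where "q K = (SOME R. interior K = {p. in_quad p R})" for K
  have q: "interior K = {p. in_quad p (q K)}" if "K \<in> B" for K
    unfolding q_def using bx[OF that] by (rule someI_ex)
  define a b c d where "a K = fst (q K)" and "b K = fst (snd (q K))" and
    "c K = fst (snd (snd (q K)))" and "d K = snd (snd (snd (q K)))" for K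
  have i: "interior K = {p. a K < fst p \<and> fst p < b K \<and> c K < snd p \<and> snd p < d K}" if "K \<in> B" for K
    unfolding q[OF that] by (cases "q K") (simp add: a_def b_def c_def d_def)
  define hue where "hue K = (if \<exists>p\<in>S. col p = Red \<and> covers K p then Red else Blue)" for K
  have hue: "hue K = col p" if "K \<in> B" "p \<in> S" "covers K p" for K p
  proof (cases "col p")
    case Red
    then show ?thesis using that by (auto simp: hue_def)
  next
    case Blue
    moreover have "col q = Blue" if "q \<in> S" "covers K q" for q
      using B \<open>K \<in> B\<close> \<open>p \<in> S\<close> \<open>covers K p\<close> that Blue unfolding is_sbcc_def by metis
    ultimately show ?thesis by (auto simp: hue_def)
  qed
  have "tiling (monochromatic S col) GX GY Q (6 + 1190 * card ?I)"
  proof (rule tiling_of_boxes[OF S G _ _ _ _ Q, where a = a and b = b and c = c and d = d and hue = hue])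
    show "finite ?I" using fB by simp
    show "\<exists>p\<in>S. a K < fst p \<and> fst p < b K \<and> c K < snd p \<and> snd p < d K" if "K \<in> ?I" for K
      using that i[of K] by (auto simp: covers_def)
    show "\<exists>K\<in>?I. hue K = col p \<and> a K < fst p \<and> fst p < b K \<and> c K < snd p \<and> snd p < d K" if p: "p \<in> S" for p
    proof -
      obtain K where K: "K \<in> B" "covers K p" using B p unfolding is_sbcc_def by blast
      then have "p \<in> interior K" by (simp add: covers_def)
      then show ?thesis using K p hue[OF K(1) p K(2)] i[OF K(1)] by auto
    qed
    fix K K' x y assume K: "K \<in> ?I" "K' \<in> ?I" "hue K \<noteq> hue K'"
      "a K < x \<and> x < b K \<and> c K < y \<and> y < d K" "a K' < x \<and> x < b K' \<and> c K' < y \<and> y < d K'"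
    then have xy: "(x, y) \<in> interior K" "(x, y) \<in> interior K'" using i[of K] i[of K'] by auto
    obtain p q where pq: "p \<in> S" "covers K p" "q \<in> S" "covers K' q" using K by blast
    have "col p = hue K" "col q = hue K'" using hue[of K p] hue[of K' q] K(1,2) pq by auto
    then have "col p = Red \<and> col q = Blue \<or> col p = Blue \<and> col q = Red"
      using K(3) by (cases "hue K"; cases "hue K'") auto
    then have "K \<inter> interior K' = {} \<or> K' \<inter> interior K = {}"
      using B K(1,2) pq unfolding is_sbcc_def by blast
    then show False using xy interior_subset[of K] interior_subset[of K'] by blast
  qed
  moreover have "card ?I \<le> card B" using fB by (intro card_mono) auto
  ultimately show ?thesis by (elim tiling_mono) simp
qed

fun apart :: "real quad \<Rightarrow> real quad \<Rightarrow> bool" where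
  "apart (a, b, c, d) (a', b', c', d') \<longleftrightarrow> b \<le> a' \<or> b' \<le> a \<or> d \<le> c' \<or> d' \<le> c"

fun proper :: "real quad \<Rightarrow> bool" where
  "proper (a, b, c, d) \<longleftrightarrow> a < b \<and> c < d"

fun qbox :: "real quad \<Rightarrow> point set" where
  "qbox (a, b, c, d) = cbox (a, c) (b, d)"

lemma interior_qbox: "interior (qbox Q) = {p. in_quad p Q}"
  by (cases Q) (auto simp: mem_box Basis_prod_def)

lemma is_box_qbox: "proper Q \<Longrightarrow> is_box (qbox Q)"
proof (cases Q)
  fix a b c d assume Q: "Q = (a, b, c, d)" and p: "proper Q"
  have "((a + b) / 2, (c + d) / 2) \<in> interior (qbox Q)"
    using p by (simp only: interior_qbox) (simp add: Q)
  then show ?thesis unfolding is_box_def by (auto simp: Q)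
qed

text \<open>Neighbouring pieces share a wall, which is harmless: an SBCC only forbids that a box
  meets the interior of another.\<close>

lemma apart_qbox: "apart Q R \<Longrightarrow> proper R \<Longrightarrow> qbox Q \<inter> interior (qbox R) = {}"
  unfolding interior_qbox by (cases Q; cases R) (auto simp: mem_box Basis_prod_def)

lemma apart_sym: "apart Q R \<Longrightarrow> apart R Q"
  by (cases Q; cases R) auto

text \<open>A rectangle covering a red point and one covering a blue point are different because
  each is monochromatic, hence they are apart.\<close>

lemma sbcc_of_quads:
  assumes "sorted_wrt apart Qs" "\<And>Q. Q \<in> set Qs \<Longrightarrow> proper Q \<and> monochromatic S col Q"
    "\<And>p. p \<in> S \<Longrightarrow> \<exists>Q\<in>set Qs. in_quad p Q"
  shows "is_sbcc S col (qbox ` set Qs)"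
proof -
  have ap: "apart Q R" if "Q \<in> set Qs" "R \<in> set Qs" "Q \<noteq> R" for Q R
    using assms(1) that
  proof (induction Qs)
    case (Cons K Qs)
    then show ?case by (auto intro: apart_sym simp del: apart.simps)
  qed simp
  have cov: "covers (qbox Q) p \<longleftrightarrow> in_quad p Q" for Q p by (simp add: covers_def interior_qbox)
  show ?thesis unfolding is_sbcc_def
  proof (intro conjI ballI impI)
    fix B p q assume "B \<in> qbox ` set Qs" "p \<in> S" "q \<in> S" "covers B p \<and> covers B q"
    moreover then obtain Q where "Q \<in> set Qs" "B = qbox Q" by blast
    ultimately show "col p = col q" using assms(2)[of Q] cov[of Q] unfolding monochromatic_def by metis
  next
    fix B B' assume B: "B \<in> qbox ` set Qs" "B' \<in> qbox ` set Qs"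
      and h: "(\<exists>p\<in>S. col p = Red \<and> covers B p) \<and> (\<exists>q\<in>S. col q = Blue \<and> covers B' q)"
    obtain Q R where Q: "Q \<in> set Qs" "B = qbox Q" and R: "R \<in> set Qs" "B' = qbox R" using B by blast
    obtain p q where pq: "p \<in> S" "col p = Red" "in_quad p Q" "q \<in> S" "col q = Blue" "in_quad q R"
      using h unfolding Q R cov by blast
    have "Q \<noteq> R"
    proof
      assume "Q = R"
      then have "col p = col q" using assms(2)[OF Q(1)] pq unfolding monochromatic_def by metis
      then show False using pq by simp
    qed
    then have "apart Q R" using ap Q R by simp
    then show "B \<inter> interior B' = {}" using apart_qbox[of Q R] assms(2)[OF R(1)] by (simp only: Q R)
  qed (use assms is_box_qbox cov in auto)
qed

lemma pieces_apart: "fits Q W \<Longrightarrow> sorted_wrt apart (pieces w Q W)"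
  by (cases Q; cases W) (auto simp: pieces_def)

lemma apart_kid: "fits Q W \<Longrightarrow> K \<in> set (pieces w Q W) \<Longrightarrow> apart R Q \<Longrightarrow> apart R K"
  by (cases Q; cases W; cases R) (auto simp: pieces_def split: if_splits)

text \<open>The walls are grid lines, so a point off the grid lies on none of them and falls into
  the interior of a piece.\<close>

lemma pin_kid:
  assumes "fits Q W" "in_quad p Q" "W \<in> GX \<times> GX \<times> GY \<times> GY" "fst p \<notin> GX" "snd p \<notin> GY"
  shows "\<exists>K\<in>set (pieces w Q W). in_quad p K"
proof -
  obtain x0 x1 y0 y1 where q: "Q = (x0, x1, y0, y1)" by (cases Q)
  obtain u1 u2 v1 v2 where w: "W = (u1, u2, v1, v2)" by (cases W)
  have "fst p \<noteq> u1" "fst p \<noteq> u2" "snd p \<noteq> v1" "snd p \<noteq> v2" using assms(3-5) by (auto simp: w)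
  then have "fst p < u1 \<or> u1 < fst p" "fst p < u2 \<or> u2 < fst p" "snd p < v1 \<or> v1 < snd p" "snd p < v2 \<or> v2 < snd p"
    by auto
  then show ?thesis using assms(1,2) by (cases w) (auto simp: pieces_def q w)
qed

subsection \<open>Running times\<close>

(* Valid if no loop is iterated more than N times. *)
fun time_bound :: "nat \<Rightarrow> com \<Rightarrow> nat" where
  "time_bound N Skip = 0"
| "time_bound N (IAssign a i e) = 1"
| "time_bound N (RAssign a i e) = 1"
| "time_bound N (Seq c d) = time_bound N c + time_bound N d"
| "time_bound N (If b c d) = 1 + time_bound N c + time_bound N d"
| "time_bound N (While b c) = 1 + N * (1 + time_bound N c)"

fun time_poly :: "com \<Rightarrow> nat poly" where
  "time_poly Skip = 0"
| "time_poly (IAssign a i e) = 1"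
| "time_poly (RAssign a i e) = 1"
| "time_poly (Seq c d) = time_poly c + time_poly d"
| "time_poly (If b c d) = 1 + time_poly c + time_poly d"
| "time_poly (While b c) = 1 + [:0, 1:] * (1 + time_poly c)"

lemma poly_tbp: "poly (time_poly c) N = time_bound N c"
  by (induction c) (auto simp: algebra_simps)

text \<open>Termination, running time and postcondition in one predicate. The time is a function of
  the program text and \<open>N\<close>, so the rules need not mention it.\<close>

definition runs :: "nat \<Rightarrow> com \<Rightarrow> state \<Rightarrow> (state \<Rightarrow> bool) \<Rightarrow> bool" where
  "runs N c s Q \<longleftrightarrow> (\<exists>t s'. exec c s t s' \<and> t \<le> time_bound N c \<and> Q s')"

lemma runs_Skip: "Q s \<Longrightarrow> runs N Skip s Q"
  unfolding runs_def by (auto intro: exec.Skip)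

lemma runs_IAssign: "Q (iupdate a (ival i s) (ival e s) s) \<Longrightarrow> runs N (IAssign a i e) s Q"
  unfolding runs_def by (intro exI conjI, rule exec.IAssign) auto

lemma runs_RAssign: "Q (rupdate a (ival i s) (rval e s) s) \<Longrightarrow> runs N (RAssign a i e) s Q"
  unfolding runs_def by (intro exI conjI, rule exec.RAssign) auto

lemma runs_Seq: "runs N c s (\<lambda>s'. runs N d s' Q) \<Longrightarrow> runs N (Seq c d) s Q"
  unfolding runs_def by simp (meson exec.Seq add_mono)

lemma runs_If: "(bval b s \<Longrightarrow> runs N c s Q) \<Longrightarrow> (\<not> bval b s \<Longrightarrow> runs N d s Q) \<Longrightarrow> runs N (If b c d) s Q"
proof (cases "bval b s")
  case True
  assume "bval b s \<Longrightarrow> runs N c s Q"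
  then obtain t s' where "exec c s t s'" "t \<le> time_bound N c" "Q s'" using True by (auto simp: runs_def)
  then show ?thesis unfolding runs_def
    by (intro exI[of _ "Suc t"] exI[of _ s']) (auto intro: exec.IfTrue[OF True])
next
  case False
  assume "\<not> bval b s \<Longrightarrow> runs N d s Q"
  then obtain t s' where "exec d s t s'" "t \<le> time_bound N d" "Q s'" using False by (auto simp: runs_def)
  then show ?thesis unfolding runs_def
    by (intro exI[of _ "Suc t"] exI[of _ s']) (auto intro: exec.IfFalse[OF False])
qed

lemma runs_conseq: "runs N c s P \<Longrightarrow> (\<And>s'. P s' \<Longrightarrow> Q s') \<Longrightarrow> runs N c s Q"
  unfolding runs_def by blast

lemma runs_While_aux:
  assumes "\<And>s. J s \<Longrightarrow> bval b s \<Longrightarrow> runs N c s (\<lambda>s'. J s' \<and> \<mu> s' < \<mu> s)" "J s"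
  shows "\<exists>t s'. exec (While b c) s t s' \<and> t \<le> 1 + \<mu> s * (1 + time_bound N c) \<and> J s' \<and> \<not> bval b s'"
  using assms(2)
proof (induction "\<mu> s" arbitrary: s rule: less_induct)
  case less
  show ?case
  proof (cases "bval b s")
    case False
    show ?thesis using exec.WhileFalse[of b s c, OF False] less.prems False by (intro exI[of _ 1] exI[of _ s]) simp
  next
    case True
    obtain t s' where s': "exec c s t s'" "t \<le> time_bound N c" "J s'" "\<mu> s' < \<mu> s"
      using assms(1)[OF less.prems True] by (auto simp: runs_def)
    obtain u s'' where s'': "exec (While b c) s' u s''" "u \<le> 1 + \<mu> s' * (1 + time_bound N c)" "J s''" "\<not> bval b s''"
      using less.hyps[OF s'(4,3)] by blast
    have "Suc (\<mu> s') * (1 + time_bound N c) \<le> \<mu> s * (1 + time_bound N c)"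
      using s'(4) by (intro mult_le_mono1) simp
    then have "Suc (t + u) \<le> 1 + \<mu> s * (1 + time_bound N c)" using s'(2) s''(2) by simp
    then show ?thesis using exec.WhileTrue[OF True s'(1) s''(1)] s'' by blast
  qed
qed

text \<open>The variant serves twice: it yields termination, and as it starts at or below
  \<open>N\<close> it limits the iterations.\<close>

lemma runs_While:
  assumes "J s" "\<mu> s \<le> N" "\<And>s. J s \<Longrightarrow> bval b s \<Longrightarrow> runs N c s (\<lambda>s'. J s' \<and> \<mu> s' < \<mu> s)"
    "\<And>s'. J s' \<Longrightarrow> \<not> bval b s' \<Longrightarrow> Q s'"
  shows "runs N (While b c) s Q"
proof -
  obtain t s' where *: "exec (While b c) s t s'" "t \<le> 1 + \<mu> s * (1 + time_bound N c)" "J s'" "\<not> bval b s'"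
    using runs_While_aux[of J b N c \<mu> s] assms by blast
  have "\<mu> s * (1 + time_bound N c) \<le> N * (1 + time_bound N c)" using assms(2) by (rule mult_le_mono1)
  then show ?thesis using * assms(4) unfolding runs_def by (intro exI[of _ t] exI[of _ s']) auto
qed

section \<open>Counting loops, nested loops and frames\<close>

abbreviation V :: "vname \<Rightarrow> iexp" where
  "V a \<equiv> ICell a (INum 0)"

definition For :: "vname \<Rightarrow> iexp \<Rightarrow> com \<Rightarrow> com" where
  "For v e c = Seq (IAssign v (INum 0) (INum 0))
     (While (ILess (V v) e) (Seq c (IAssign v (INum 0) (IAdd (V v) (INum 1)))))"

fun nest :: "vname list \<Rightarrow> iexp \<Rightarrow> com \<Rightarrow> com" where
  "nest [] e c = c"
| "nest (v # vs) e c = For v e (nest vs e c)"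

lemma imem_iupdate [simp]: "imem (iupdate a i k s) b = (if b = a then (imem s a)(i := k) else imem s b)"
  by (simp add: iupdate_def)

lemma imem_rupdate [simp]: "imem (rupdate a i k s) = imem s"
  by (simp add: rupdate_def)

lemma rmem_rupdate [simp]: "rmem (rupdate a i k s) b = (if b = a then (rmem s a)(i := k) else rmem s b)"
  by (simp add: rupdate_def)

lemma rmem_iupdate [simp]: "rmem (iupdate a i k s) = rmem s"
  by (simp add: iupdate_def)

lemma runs_For:
  assumes "J 0 (iupdate v 0 0 s)" "m \<le> N"
    and step: "\<And>k s. k < m \<Longrightarrow> J k s \<Longrightarrow> imem s v 0 = k \<Longrightarrow>
      runs N c s (\<lambda>s'. imem s' v 0 = k \<and> J (Suc k) (iupdate v 0 (Suc k) s'))"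
    and bound: "\<And>k s. J k s \<Longrightarrow> imem s v 0 = k \<Longrightarrow> ival e s = m"
    and fin: "\<And>s. J m s \<Longrightarrow> Q s"
  shows "runs N (For v e c) s Q"
  unfolding For_def
proof (intro runs_Seq runs_IAssign, simp only: ival.simps)
  define K where "K s \<longleftrightarrow> J (imem s v 0) s \<and> imem s v 0 \<le> m" for s
  show "runs N (While (ILess (V v) e) (Seq c (IAssign v (INum 0) (IAdd (V v) (INum 1))))) (iupdate v 0 0 s) Q"
  proof (rule runs_While[where J = K and \<mu> = "\<lambda>s. m - imem s v 0"])
    show "K (iupdate v 0 0 s)" using assms(1) by (simp add: K_def)
    show "m - imem (iupdate v 0 0 s) v 0 \<le> N" using assms(2) by simp
    fix s assume s: "K s" "bval (ILess (V v) e) s"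
    then have lt: "imem s v 0 < m" using bound[of "imem s v 0" s] by (simp add: K_def)
    show "runs N (Seq c (IAssign v (INum 0) (IAdd (V v) (INum 1)))) s (\<lambda>s'. K s' \<and> m - imem s' v 0 < m - imem s v 0)"
    proof (rule runs_Seq, rule runs_conseq[OF step[OF lt]])
      show "J (imem s v 0) s" using s by (simp add: K_def)
      fix s' assume "imem s' v 0 = imem s v 0 \<and> J (Suc (imem s v 0)) (iupdate v 0 (Suc (imem s v 0)) s')"
      then show "runs N (IAssign v (INum 0) (IAdd (V v) (INum 1))) s' (\<lambda>s'. K s' \<and> m - imem s' v 0 < m - imem s v 0)"
        using lt by (intro runs_IAssign) (simp add: K_def)
    qed simp
  next
    fix s assume s: "K s" "\<not> bval (ILess (V v) e) s"
    then have "imem s v 0 = m" using bound[of "imem s v 0" s] by (simp add: K_def)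
    then show "Q s" using s fin[of s] by (simp add: K_def)
  qed
qed

text \<open>\<open>Post xs\<close> is what the iteration with counters \<open>xs\<close> achieves,
  and \<open>le\<close> is how the state may develop afterwards; since \<open>Post\<close> is
  preserved along \<open>le\<close>, every achievement survives to the end. In the induction the
  outermost counter becomes part of the invariant.\<close>

lemma runs_nest:
  assumes vs: "distinct vs" and M: "M \<le> N"
    and bound: "\<And>s. Inv s \<Longrightarrow> ival e s = M"
    and stable: "\<And>s v k. v \<in> set vs \<Longrightarrow> Inv s \<Longrightarrow> Inv (iupdate v 0 k s)"
    and le: "\<And>s s' s''. le s s' \<Longrightarrow> le s' s'' \<Longrightarrow> le s s''" "\<And>s v k. v \<in> set vs \<Longrightarrow> le s (iupdate v 0 k s)"
    and Post: "\<And>s s' xs. le s s' \<Longrightarrow> Post xs s \<Longrightarrow> Post xs s'"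
    and body: "\<And>s xs. Inv s \<Longrightarrow> length xs = length vs \<Longrightarrow> set xs \<subseteq> {..<M} \<Longrightarrow> map (\<lambda>v. imem s v 0) vs = xs \<Longrightarrow>
      runs N c s (\<lambda>s'. Inv s' \<and> le s s' \<and> Post xs s' \<and> (\<forall>v\<in>set vs. imem s' v 0 = imem s v 0))"
    and s: "Inv s"
    and fin: "\<And>s'. Inv s' \<Longrightarrow> le s s' \<Longrightarrow> (\<And>xs. length xs = length vs \<Longrightarrow> set xs \<subseteq> {..<M} \<Longrightarrow> Post xs s') \<Longrightarrow> Q s'"
  shows "runs N (nest vs e c) s Q"
  using assms(1,3-)
proof (induction vs arbitrary: Inv Post s Q)
  case Nil
  show ?case by simp (rule runs_conseq[OF Nil(7)[OF Nil(8)]], auto intro!: Nil(9))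
next
  case (Cons v vs)
  note stable = Cons.prems(3) and le = Cons.prems(4,5) and Post = Cons.prems(6) and body = Cons.prems(7) and fin = Cons.prems(9)
  define J where "J k s' \<longleftrightarrow> Inv s' \<and> le s s' \<and> (\<forall>xs. length xs = Suc (length vs) \<and> set xs \<subseteq> {..<M} \<and> hd xs < k \<longrightarrow> Post xs s')" for k s'
  show ?case unfolding nest.simps
  proof (rule runs_For[where J = J and m = M])
    show "J 0 (iupdate v 0 0 s)" using Cons.prems by (auto simp: J_def)
    show "M \<le> N" by (rule M)
    show "ival e s = M" if "J k s" for k s using that Cons.prems(2) by (simp add: J_def)
    show "Q s'" if J: "J M s'" for s'
    proof (rule fin)
      fix xs :: "nat list" assume "length xs = length (v # vs)" "set xs \<subseteq> {..<M}"
      then show "Post xs s'" using J by (cases xs) (auto simp: J_def)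
    qed (use J in \<open>simp_all add: J_def\<close>)
    fix k s' assume k: "k < M" and J: "J k s'" and v: "imem s' v 0 = k"
    show "runs N (nest vs e c) s' (\<lambda>s'. imem s' v 0 = k \<and> J (Suc k) (iupdate v 0 (Suc k) s'))"
    proof (rule Cons.IH[where Inv = "\<lambda>s. Inv s \<and> imem s v 0 = k" and Post = "\<lambda>xs. Post (k # xs)"])
      show "distinct vs" using Cons.prems(1) by simp
      show "ival e s = M" if "Inv s \<and> imem s v 0 = k" for s using that Cons.prems(2) by simp
      show "Inv (iupdate u 0 l s) \<and> imem (iupdate u 0 l s) v 0 = k" if "u \<in> set vs" "Inv s \<and> imem s v 0 = k" for s u l
        using that stable Cons.prems(1) by auto
      show "le s (iupdate u 0 l s)" if "u \<in> set vs" for s u l using that le by simp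
      show "Inv s' \<and> imem s' v 0 = k" using J v by (simp add: J_def)
      show "runs N c s (\<lambda>s'. (Inv s' \<and> imem s' v 0 = k) \<and> le s s' \<and> Post (k # xs) s' \<and> (\<forall>v\<in>set vs. imem s' v 0 = imem s v 0))"
        if "Inv s \<and> imem s v 0 = k" "length xs = length vs" "set xs \<subseteq> {..<M}" "map (\<lambda>v. imem s v 0) vs = xs" for s xs
        by (rule runs_conseq[OF body[of s "k # xs"]]) (use that k in auto)
      fix s'' assume s'': "Inv s'' \<and> imem s'' v 0 = k" "le s' s''"
        "\<And>xs. length xs = length vs \<Longrightarrow> set xs \<subseteq> {..<M} \<Longrightarrow> Post (k # xs) s''"
      let ?s = "iupdate v 0 (Suc k) s''"
      have le': "le s'' ?s" using le by simp
      have "Post xs ?s" if xs: "length xs = Suc (length vs)" "set xs \<subseteq> {..<M}" "hd xs < Suc k" for xs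
      proof (rule Post[OF le'], cases "hd xs < k")
        case True
        then show "Post xs s''" using J xs s''(2) Post by (auto simp: J_def)
      next
        case False
        then obtain ys where "xs = k # ys" using xs by (cases xs) auto
        then show "Post xs s''" using s''(3) xs by auto
      qed
      moreover have "Inv ?s" using s'' stable by simp
      moreover have "le s ?s" using J s''(2) le' le(1) unfolding J_def by blast
      ultimately show "imem s'' v 0 = k \<and> J (Suc k) ?s" using s'' by (simp add: J_def)
    qed (fact le(1) Post)+
  qed
qed

definition frame :: "vname set \<Rightarrow> vname set \<Rightarrow> state \<Rightarrow> state \<Rightarrow> bool" where
  "frame A B s s' \<longleftrightarrow> (\<forall>a. a \<notin> A \<longrightarrow> imem s' a = imem s a) \<and> (\<forall>a. a \<notin> B \<longrightarrow> rmem s' a = rmem s a)"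

lemma frame_refl [simp]: "frame A B s s"
  by (simp add: frame_def)

lemma frame_iupdate [simp]: "frame A B s s' \<Longrightarrow> a \<in> A \<Longrightarrow> frame A B s (iupdate a i v s')"
  by (auto simp: frame_def)

lemma frame_rupdate [simp]: "frame A B s s' \<Longrightarrow> a \<in> B \<Longrightarrow> frame A B s (rupdate a i v s')"
  by (auto simp: frame_def)

lemma frame_imem: "frame A B s s' \<Longrightarrow> a \<notin> A \<Longrightarrow> imem s' a = imem s a"
  by (simp add: frame_def)

lemma frame_rmem: "frame A B s s' \<Longrightarrow> a \<notin> B \<Longrightarrow> rmem s' a = rmem s a"
  by (simp add: frame_def)

lemma frame_trans: "frame A B s s' \<Longrightarrow> frame A' B' s' s'' \<Longrightarrow> A \<subseteq> C \<Longrightarrow> A' \<subseteq> C \<Longrightarrow> B \<subseteq> D \<Longrightarrow> B' \<subseteq> D \<Longrightarrow> frame C D s s''"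
  unfolding frame_def by (intro conjI allI impI) (metis subsetD)+

section \<open>Computing the lines\<close>

primrec low_line :: "(nat \<Rightarrow> real) \<Rightarrow> nat \<Rightarrow> real" where
  "low_line x 0 = x 0 - 1"
| "low_line x (Suc k) = (if x k - 1 < low_line x k then x k - 1 else low_line x k)"

(* The value depends only on the coordinate a, so equal coordinates yield the same line and every gap
   contains exactly one line. *)
primrec next_line :: "(nat \<Rightarrow> real) \<Rightarrow> real \<Rightarrow> nat \<Rightarrow> real" where
  "next_line x a 0 = a + 1"
| "next_line x a (Suc k) = (if a < x k \<and> 1/2 * (a + x k) < next_line x a k then 1/2 * (a + x k) else next_line x a k)"

lemma low_line_less: "i < k \<Longrightarrow> low_line x k < x i"
  by (induction k) (auto simp: less_Suc_eq)

lemma next_line_gt: "a < next_line x a k"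
  by (induction k) auto

lemma next_line_lt: "i < k \<Longrightarrow> a < x i \<Longrightarrow> next_line x a k < x i"
  by (induction k) (auto simp: less_Suc_eq)

text \<open>Index \<open>n\<close> holds the line below all points. There are thus
  \<open>n + 1\<close> indices, one of them even without points, and the order of the indices says
  nothing about the order of the lines.\<close>

definition line :: "(nat \<Rightarrow> real) \<Rightarrow> nat \<Rightarrow> nat \<Rightarrow> real" where
  "line x n i = (if i < n then next_line x (x i) n else low_line x n)"

lemma lines_line: "lines (x ` {..<n}) (line x n ` {..<Suc n})"
proof -
  have top: "line x n i < x j" if "i < n" "j < n" "x i < x j" for i j
    using that by (simp add: line_def next_line_lt)
  have up: "x i < line x n i" if "i < n" for i
    using that by (simp add: line_def next_line_gt)
  have low: "line x n n < x j" if "j < n" for j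
    using that by (simp add: line_def low_line_less)
  have ne: "line x n i \<noteq> x j" if "i < Suc n" "j < n" for i j
    using that top[of i j] up[of i] low[of j] by (cases "i = n"; cases "x i < x j") auto
  have bet: "\<exists>k<n. line x n i < x k \<and> x k < line x n j"
    if ij: "i < Suc n" "j < Suc n" "line x n i < line x n j" for i j
  proof (cases "i = n")
    case True
    then have "j < n" using ij by (cases "j = n") auto
    then show ?thesis using low up True by blast
  next
    case False
    then have i: "i < n" using ij by simp
    have j: "j < n"
      using ij low[OF i] up[OF i] by (cases "j = n") auto
    have "x i \<noteq> x j" using ij i j by (auto simp: line_def)
    moreover have "\<not> x j < x i" using top[OF j i] up[OF i] ij by auto
    ultimately have "x i < x j" by simp
    then show ?thesis using top[OF i j] up[OF j] j by blast
  qed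
  have disj: "line x n ` {..<Suc n} \<inter> x ` {..<n} = {}"
    by (auto dest: ne)
  have betw: "\<forall>g\<in>line x n ` {..<Suc n}. \<forall>g'\<in>line x n ` {..<Suc n}. g < g' \<longrightarrow> (\<exists>z\<in>x ` {..<n}. g < z \<and> z < g')"
  proof (intro ballI impI)
    fix g g' assume "g \<in> line x n ` {..<Suc n}" "g' \<in> line x n ` {..<Suc n}" "g < g'"
    then obtain i j where ij: "i < Suc n" "j < Suc n" "g = line x n i" "g' = line x n j" "line x n i < line x n j" by auto
    obtain k where "k < n" "line x n i < x k" "x k < line x n j" using bet[OF ij(1,2,5)] by blast
    then show "\<exists>z\<in>x ` {..<n}. g < z \<and> z < g'" using ij by (intro bexI[of _ "x k"]) auto
  qed
  have "\<exists>g\<in>line x n ` {..<Suc n}. \<forall>z\<in>x ` {..<n}. g < z"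
    by (rule bexI[of _ "line x n n"]) (use low in auto)
  moreover have "\<exists>g\<in>line x n ` {..<Suc n}. z < g \<and> (\<forall>z'\<in>x ` {..<n}. z < z' \<longrightarrow> g < z')" if z: "z \<in> x ` {..<n}" for z
  proof -
    obtain i where "i < n" "z = x i" using z by auto
    then have "x i < line x n i \<and> (\<forall>j<n. x i < x j \<longrightarrow> line x n i < x j)" using top up by blast
    then show ?thesis using \<open>i < n\<close> \<open>z = x i\<close> by (intro bexI[of _ "line x n i"]) auto
  qed
  ultimately show ?thesis unfolding lines_def using disj betw by simp
qed

definition low_loop :: "vname \<Rightarrow> vname \<Rightarrow> com" where
  "low_loop x g = For ''i'' (V ''n'') (If (RLess (RSub (RCell x (V ''i'')) (RNum 1)) (RCell g (V ''n'')))
     (RAssign g (V ''n'') (RSub (RCell x (V ''i'')) (RNum 1))) Skip)"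

definition halve_gap :: "vname \<Rightarrow> vname \<Rightarrow> com" where
  "halve_gap x g = If (BAnd (RLess (RCell x (V ''i'')) (RCell x (V ''j'')))
       (RLess (RScale (1/2) (RAdd (RCell x (V ''i'')) (RCell x (V ''j'')))) (RCell g (V ''i''))))
     (RAssign g (V ''i'') (RScale (1/2) (RAdd (RCell x (V ''i'')) (RCell x (V ''j''))))) Skip"

definition next_loop :: "vname \<Rightarrow> vname \<Rightarrow> com" where
  "next_loop x g = For ''i'' (V ''n'') (Seq (RAssign g (V ''i'') (RAdd (RCell x (V ''i'')) (RNum 1))) (For ''j'' (V ''n'') (halve_gap x g)))"

definition max_loop :: "vname \<Rightarrow> vname \<Rightarrow> com" where
  "max_loop g u = For ''i'' (V ''M'')
     (If (RLess (RCell g (V u)) (RCell g (V ''i''))) (IAssign u (INum 0) (V ''i'')) Skip)"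

definition make_lines :: "vname \<Rightarrow> vname \<Rightarrow> com" where
  "make_lines x g = Seq (RAssign g (V ''n'') (RSub (RCell x (INum 0)) (RNum 1)))
    (Seq (low_loop x g) (next_loop x g))"

lemma runs_low_loop:
  assumes n: "imem s ''n'' 0 = n" "n \<le> N" and g: "x \<noteq> g" "rmem s g n = rmem s x 0 - 1"
    and fin: "\<And>s'. frame {''i''} {g} s s' \<Longrightarrow> rmem s' g n = low_line (rmem s x) n \<Longrightarrow> Q s'"
  shows "runs N (low_loop x g) s Q"
  unfolding low_loop_def
proof (rule runs_For[where J = "\<lambda>k s'. frame {''i''} {g} s s' \<and> rmem s' g n = low_line (rmem s x) k" and m = n])
  fix k s' assume J: "frame {''i''} {g} s s' \<and> rmem s' g n = low_line (rmem s x) k"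
  have n': "imem s' ''n'' 0 = n" "rmem s' x = rmem s x"
    using frame_imem[of "{''i''}" "{g}" s s' "''n''"] frame_rmem[of "{''i''}" "{g}" s s' x] J n g by simp_all
  show "ival (V ''n'') s' = n" using n' by simp
  assume i: "imem s' ''i'' 0 = k"
  show "runs N (If (RLess (RSub (RCell x (V ''i'')) (RNum 1)) (RCell g (V ''n'')))
      (RAssign g (V ''n'') (RSub (RCell x (V ''i'')) (RNum 1))) Skip) s'
     (\<lambda>s'. imem s' ''i'' 0 = k \<and> frame {''i''} {g} s (iupdate ''i'' 0 (Suc k) s') \<and>
       rmem (iupdate ''i'' 0 (Suc k) s') g n = low_line (rmem s x) (Suc k))"
    by (intro runs_If runs_RAssign runs_Skip) (use J i n' g in simp_all)
qed (use n g fin in simp_all)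

lemma runs_next_loop:
  assumes n: "imem s ''n'' 0 = n" "n \<le> N" and g: "x \<noteq> g"
    and fin: "\<And>s'. frame {''i'', ''j''} {g} s s' \<Longrightarrow> rmem s' g n = rmem s g n \<Longrightarrow>
      (\<And>i. i < n \<Longrightarrow> rmem s' g i = next_line (rmem s x) (rmem s x i) n) \<Longrightarrow> Q s'"
  shows "runs N (next_loop x g) s Q"
  unfolding next_loop_def
proof -
  let ?F = "frame {''i'', ''j''} {g} s"
  let ?J = "\<lambda>k s'. ?F s' \<and> rmem s' g n = rmem s g n \<and> (\<forall>i<k. rmem s' g i = next_line (rmem s x) (rmem s x i) n)"
  have F: "imem s' ''n'' 0 = n" "rmem s' x = rmem s x" if "?F s'" for s'
    using frame_imem[OF that, of "''n''"] frame_rmem[OF that, of x] n g by simp_all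
  have half: "(of_rat (1/2) :: real) = 1/2" by (simp only: of_rat_divide of_rat_1 of_rat_numeral_eq)
  show "runs N (For ''i'' (V ''n'') (Seq (RAssign g (V ''i'') (RAdd (RCell x (V ''i'')) (RNum 1))) (For ''j'' (V ''n'') (halve_gap x g)))) s Q"
  proof (rule runs_For[where J = ?J and m = n])
    show "ival (V ''n'') s' = n" if "?J k s'" for k s' using F(1)[of s'] that by simp
    fix k s' assume k: "k < n" and J: "?J k s'" and i: "imem s' ''i'' 0 = k"
    have "?F s'" using J by simp
    note n' = F[OF this]
    let ?K = "\<lambda>j s'. ?J k s' \<and> imem s' ''i'' 0 = k \<and> rmem s' g k = next_line (rmem s x) (rmem s x k) j"
    show "runs N (Seq (RAssign g (V ''i'') (RAdd (RCell x (V ''i'')) (RNum 1))) (For ''j'' (V ''n'') (halve_gap x g))) s'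
       (\<lambda>s'. imem s' ''i'' 0 = k \<and> ?J (Suc k) (iupdate ''i'' 0 (Suc k) s'))"
    proof (intro runs_Seq runs_RAssign, rule runs_For[where J = ?K and m = n])
      show "?K 0 (iupdate ''j'' 0 0 (rupdate g (ival (V ''i'') s') (rval (RAdd (RCell x (V ''i'')) (RNum 1)) s') s'))"
        using J i n' g k by simp
      show "n \<le> N" by (rule n)
      show "ival (V ''n'') s' = n" if "?K j s'" for j s' using F(1)[of s'] that by simp
      show "imem s' ''i'' 0 = k \<and> ?J (Suc k) (iupdate ''i'' 0 (Suc k) s')" if "?K n s'" for s'
        using that by (simp add: less_Suc_eq all_conj_distrib)
      fix j s' assume j: "j < n" and K: "?K j s'" and ij: "imem s' ''j'' 0 = j"
      have "?F s'" using K by simp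
      note n' = F[OF this]
      show "runs N (halve_gap x g) s'
         (\<lambda>s'. imem s' ''j'' 0 = j \<and> ?K (Suc j) (iupdate ''j'' 0 (Suc j) s'))"
        unfolding halve_gap_def
        by (intro runs_If runs_RAssign runs_Skip) (use K ij n' g k half in simp_all)
    qed
  qed (use n fin in simp_all)
qed

lemma runs_max_loop:
  assumes n: "imem s ''M'' 0 = M" "M \<le> N" "0 < M" and u: "u \<notin> {''i'', ''M''}" "imem s u 0 = 0"
    and fin: "\<And>s'. frame {''i'', u} {} s s' \<Longrightarrow> imem s' u 0 < M \<Longrightarrow>
      (\<And>i. i < M \<Longrightarrow> rmem s g i \<le> rmem s g (imem s' u 0)) \<Longrightarrow> Q s'"
  shows "runs N (max_loop g u) s Q"
  unfolding max_loop_def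
proof (rule runs_For[where J = "\<lambda>k s'. frame {''i'', u} {} s s' \<and> imem s' u 0 < M \<and>
    (\<forall>i<k. rmem s g i \<le> rmem s g (imem s' u 0))" and m = M])
  fix k s' assume J: "frame {''i'', u} {} s s' \<and> imem s' u 0 < M \<and>
    (\<forall>i<k. rmem s g i \<le> rmem s g (imem s' u 0))"
  have n': "imem s' ''M'' 0 = M" "rmem s' g = rmem s g"
    using frame_imem[of "{''i'', u}" "{}" s s' "''M''"] frame_rmem[of "{''i'', u}" "{}" s s' g] J n u by auto
  show "ival (V ''M'') s' = M" using n' by simp
  assume k: "k < M" and i: "imem s' ''i'' 0 = k"
  have "rmem s g j \<le> rmem s g k" if "j < k" "rmem s g (imem s' u 0) < rmem s g k" for j
    using J that by (meson less_imp_le order_trans)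
  then show "runs N (If (RLess (RCell g (V u)) (RCell g (V ''i''))) (IAssign u (INum 0) (V ''i'')) Skip) s'
     (\<lambda>s'. imem s' ''i'' 0 = k \<and> frame {''i'', u} {} s (iupdate ''i'' 0 (Suc k) s') \<and>
       imem (iupdate ''i'' 0 (Suc k) s') u 0 < M \<and>
       (\<forall>i<Suc k. rmem s g i \<le> rmem s g (imem (iupdate ''i'' 0 (Suc k) s') u 0)))"
    by (intro runs_If runs_IAssign runs_Skip) (use J k i n' u in \<open>auto simp: less_Suc_eq\<close>)
qed (use n u fin in auto)

lemma runs_make_lines:
  assumes n: "imem s ''n'' 0 = n" "n \<le> N" and g: "x \<noteq> g"
    and fin: "\<And>s'. frame {''i'', ''j''} {g} s s' \<Longrightarrow> (\<And>i. i < Suc n \<Longrightarrow> rmem s' g i = line (rmem s x) n i) \<Longrightarrow> Q s'"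
  shows "runs N (make_lines x g) s Q"
  unfolding make_lines_def
proof (rule runs_Seq, rule runs_RAssign, rule runs_Seq)
  let ?s = "rupdate g (ival (V ''n'') s) (rval (RSub (RCell x (INum 0)) (RNum 1)) s) s"
  show "runs N (low_loop x g) ?s (\<lambda>s'. runs N (next_loop x g) s' Q)"
  proof (rule runs_low_loop[where n = n])
    fix s1 assume 1: "frame {''i''} {g} ?s s1" "rmem s1 g n = low_line (rmem ?s x) n"
    have n1: "imem s1 ''n'' 0 = n" "rmem s1 x = rmem s x"
      using 1 n g by (simp_all add: frame_def)
    show "runs N (next_loop x g) s1 Q"
    proof (rule runs_next_loop[OF n1(1) n(2) g])
      fix s2 assume 2: "frame {''i'', ''j''} {g} s1 s2" "rmem s2 g n = rmem s1 g n"
        "\<And>i. i < n \<Longrightarrow> rmem s2 g i = next_line (rmem s1 x) (rmem s1 x i) n"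
      have l: "rmem s2 g i = line (rmem s x) n i" if "i < Suc n" for i
        using that 1(2) 2(2,3) n1 g by (auto simp: line_def less_Suc_eq)
      have "frame {''i'', ''j''} {g} s s1"
        by (rule frame_trans[of "{}" "{g}" s ?s _ _ s1, OF _ 1(1)]) (simp_all add: frame_def)
      then have "frame {''i'', ''j''} {g} s s2"
        by (rule frame_trans[OF _ 2(1)]) auto
      then show "Q s2" by (rule fin) (use l in simp)
    qed
  qed (use n g in simp_all)
qed

definition multiples :: "vname \<Rightarrow> iexp \<Rightarrow> com" where
  "multiples P e = Seq (IAssign P (INum 0) (INum 0))
     (For ''i'' (V ''M'') (IAssign P (IAdd (V ''i'') (INum 1)) (IAdd (ICell P (V ''i'')) e)))"

lemma runs_multiples:
  assumes "imem s ''M'' 0 = M" "M \<le> N" "P \<notin> {''i'', ''M''}"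
    and e: "\<And>s'. frame {''i'', P} {} s s' \<Longrightarrow> ival e s' = v"
    and fin: "\<And>s'. frame {''i'', P} {} s s' \<Longrightarrow> (\<forall>i\<le>M. imem s' P i = i * v) \<Longrightarrow> Q s'"
  shows "runs N (multiples P e) s Q"
  unfolding multiples_def
proof (intro runs_Seq runs_IAssign,
    rule runs_For[where J = "\<lambda>k s'. frame {''i'', P} {} s s' \<and> (\<forall>i\<le>k. imem s' P i = i * v)" and m = M])
  show "frame {''i'', P} {} s (iupdate ''i'' 0 0 (iupdate P (ival (INum 0) s) (ival (INum 0) s) s)) \<and>
    (\<forall>i\<le>0. imem (iupdate ''i'' 0 0 (iupdate P (ival (INum 0) s) (ival (INum 0) s) s)) P i = i * v)"
    using assms(3) by simp
  show "ival (V ''M'') s' = M" if "frame {''i'', P} {} s s' \<and> (\<forall>i\<le>k. imem s' P i = i * v)" for k s'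
    using that frame_imem[of "{''i'', P}" "{}" s s' "''M''"] assms(1,3) by auto
  show "runs N (IAssign P (IAdd (V ''i'') (INum 1)) (IAdd (ICell P (V ''i'')) e)) s'
     (\<lambda>s'. imem s' ''i'' 0 = k \<and> frame {''i'', P} {} s (iupdate ''i'' 0 (Suc k) s') \<and>
       (\<forall>i\<le>Suc k. imem (iupdate ''i'' 0 (Suc k) s') P i = i * v))"
    if "k < M" "frame {''i'', P} {} s s' \<and> (\<forall>i\<le>k. imem s' P i = i * v)" "imem s' ''i'' 0 = k" for k s'
    using that assms(3) e[of s'] by (intro runs_IAssign) (auto simp: le_Suc_eq)
qed (use assms in auto)

subsection \<open>Dynamic programming\<close>

fun qmap :: "('a \<Rightarrow> 'b) \<Rightarrow> ('a \<Rightarrow> 'b) \<Rightarrow> 'a quad \<Rightarrow> 'b quad" where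
  "qmap f g (a, b, c, d) = (f a, f b, g c, g d)"

fun qset :: "'a quad \<Rightarrow> 'a set" where
  "qset (a, b, c, d) = {a, b, c, d}"

lemma pieces_qmap: "pieces w (qmap f g Q) (qmap f g W) = map (qmap f g) (pieces w Q W)"
  by (cases Q; cases W) (auto simp: pieces_def)

lemma pieces_qset: "K \<in> set (pieces w Q W) \<Longrightarrow> qset K \<subseteq> qset Q \<union> qset W"
  by (cases Q; cases W) (auto simp: pieces_def split: if_splits)

lemma tiling_pos: "tiling pr GX GY Q n \<Longrightarrow> 1 \<le> n"
  by (erule tiling.cases) auto

definition imul :: "nat \<Rightarrow> iexp \<Rightarrow> iexp" where
  "imul k e = (IAdd e ^^ k) (INum 0)"

lemma ival_imul: "ival (imul k e) s = k * ival e s"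
  by (induction k) (auto simp: imul_def)

section \<open>The fragments of the program\<close>

definition quad_of :: "state \<Rightarrow> vname quad \<Rightarrow> nat quad" where
  "quad_of s = qmap (\<lambda>v. imem s v 0) (\<lambda>v. imem s v 0)"

abbreviation vq :: "vname quad" where
  "vq \<equiv> (''a'', ''b'', ''c'', ''d'')"

abbreviation vw :: "vname quad" where
  "vw \<equiv> (''e'', ''f'', ''g'', ''h'')"

text \<open>Four digits in base M, the products being read from the tables of multiples.\<close>

fun index_exp :: "vname quad \<Rightarrow> iexp" where
  "index_exp (a, b, c, d) = IAdd (IAdd (ICell ''P3'' (V a)) (ICell ''P2'' (V b))) (IAdd (ICell ''P1'' (V c)) (V d))"

definition table_exp :: "vname quad \<Rightarrow> iexp" where
  "table_exp q = ICell ''T'' (index_exp q)"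

fun cost_exp :: "vname quad list \<Rightarrow> iexp" where
  "cost_exp [] = INum 1"
| "cost_exp (q # qs) = IAdd (table_exp q) (cost_exp qs)"

definition rle :: "rexp \<Rightarrow> rexp \<Rightarrow> bexp" where
  "rle e f = BNot (RLess f e)"

abbreviation gx :: "vname \<Rightarrow> rexp" where
  "gx v \<equiv> RCell ''gx'' (V v)"

abbreviation gy :: "vname \<Rightarrow> rexp" where
  "gy v \<equiv> RCell ''gy'' (V v)"

fun fits_exp :: "vname quad \<Rightarrow> vname quad \<Rightarrow> bexp" where
  "fits_exp (a, b, c, d) (e, f, g, h) =
     BAnd (BAnd (rle (gx a) (gx e)) (BAnd (rle (gx e) (gx f)) (rle (gx f) (gx b))))
       (BAnd (rle (gy c) (gy g)) (BAnd (rle (gy g) (gy h)) (rle (gy h) (gy d))))"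

fun inside_exp :: "vname \<Rightarrow> vname quad \<Rightarrow> bexp" where
  "inside_exp i (a, b, c, d) = BAnd (BAnd (RLess (gx a) (RCell ''x'' (V i))) (RLess (RCell ''x'' (V i)) (gx b)))
     (BAnd (RLess (gy c) (RCell ''y'' (V i))) (RLess (RCell ''y'' (V i)) (gy d)))"

fun proper_exp :: "vname quad \<Rightarrow> bexp" where
  "proper_exp (a, b, c, d) = BAnd (RLess (gx a) (gx b)) (RLess (gy c) (gy d))"

declare index_exp.simps [simp del] fits_exp.simps [simp del] inside_exp.simps [simp del] proper_exp.simps [simp del]

text \<open>Red is stored as 0 and blue as 1, so the comparison selects pairs of a red and a blue
  point.\<close>

definition mixed_exp :: bexp where
  "mixed_exp = BAnd (ILess (ICell ''color'' (V ''i'')) (ICell ''color'' (V ''j''))) (BAnd (inside_exp ''i'' vq) (inside_exp ''j'' vq))"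

definition mark_mixed :: com where
  "mark_mixed = If mixed_exp (IAssign ''T'' (index_exp vq) (IAdd (V ''lim'') (INum 1))) Skip"

(* The value lim + 1 stands for infinity. *)
definition init_body :: com where
  "init_body = Seq (IAssign ''T'' (index_exp vq) (INum 1))
     (nest [''i'', ''j''] (V ''n'') mark_mixed)"

definition init :: com where
  "init = nest [''a'', ''b'', ''c'', ''d''] (V ''M'') init_body"

text \<open>Relaxation as in the Bellman-Ford method. A piece may coincide with the whole rectangle,
  so the computation does not proceed by size but by cost, one unit per round.\<close>

definition relax :: "bool \<Rightarrow> com" where
  "relax w = If (BAnd (fits_exp vq vw) (ILess (cost_exp (pieces w vq vw)) (table_exp vq)))
     (IAssign ''T'' (index_exp vq) (cost_exp (pieces w vq vw))) Skip"

definition relax_all :: com where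
  "relax_all = nest [''a'', ''b'', ''c'', ''d'', ''e'', ''f'', ''g'', ''h''] (V ''M'') (Seq (relax True) (relax False))"

definition rounds :: com where
  "rounds = For ''k'' (V ''lim'') relax_all"

fun push :: "vname quad \<Rightarrow> com" where
  "push (a, b, c, d) = Seq (IAssign ''sa'' (V ''sp'') (V a)) (Seq (IAssign ''sb'' (V ''sp'') (V b))
     (Seq (IAssign ''sc'' (V ''sp'') (V c)) (Seq (IAssign ''sd'' (V ''sp'') (V d))
       (IAssign ''sp'' (INum 0) (IAdd (V ''sp'') (INum 1))))))"

fun pushes :: "vname quad list \<Rightarrow> com" where
  "pushes [] = Skip"
| "pushes (q # qs) = Seq (push q) (pushes qs)"

text \<open>The flag \<open>''found''\<close> makes later attempts idle, so the pieces of a single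
  split are pushed.\<close>

definition attempt :: "bool \<Rightarrow> com" where
  "attempt w = If (BAnd (ILess (V ''found'') (INum 1)) (BAnd (fits_exp vq vw) (BNot (ILess (table_exp vq) (cost_exp (pieces w vq vw))))))
     (Seq (IAssign ''found'' (INum 0) (INum 1)) (pushes (pieces w vq vw))) Skip"

definition emit :: com where
  "emit = If (proper_exp vq) (Seq (RAssign ''x1'' (V ''m'') (gx ''a'')) (Seq (RAssign ''x2'' (V ''m'') (gx ''b''))
     (Seq (RAssign ''y1'' (V ''m'') (gy ''c'')) (Seq (RAssign ''y2'' (V ''m'') (gy ''d''))
       (IAssign ''m'' (INum 0) (IAdd (V ''m'') (INum 1))))))) Skip"

definition pop :: com where
  "pop = Seq (IAssign ''sp'' (INum 0) (ISub (V ''sp'') (INum 1))) (Seq (IAssign ''a'' (INum 0) (ICell ''sa'' (V ''sp'')))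
     (Seq (IAssign ''b'' (INum 0) (ICell ''sb'' (V ''sp''))) (Seq (IAssign ''c'' (INum 0) (ICell ''sc'' (V ''sp'')))
       (IAssign ''d'' (INum 0) (ICell ''sd'' (V ''sp''))))))"

definition search :: com where
  "search = nest [''e'', ''f'', ''g'', ''h''] (V ''M'') (Seq (attempt True) (attempt False))"

text \<open>An entry below 2 marks a leaf, because a split costs at least 1 + 5.\<close>

definition emit_or_split :: com where
  "emit_or_split = If (ILess (table_exp vq) (INum 2)) emit (Seq (IAssign ''found'' (INum 0) (INum 0)) search)"

definition harvest :: com where
  "harvest = While (ILess (INum 0) (V ''sp'')) (Seq pop emit_or_split)"

lemma digits:
  fixes a b u v M :: nat
  assumes "a * M + u = b * M + v" "u < M" "v < M"
  shows "a = b \<and> u = v"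
proof -
  have "(a * M + u) div M = a" "(a * M + u) mod M = u" "(b * M + v) div M = b" "(b * M + v) mod M = v"
    using assms(2,3) by auto
  then show ?thesis using assms(1) by metis
qed

section \<open>The table and its invariants\<close>

locale table =
  fixes n M lim N :: nat and x y lx ly :: "nat \<Rightarrow> real" and cl :: "nat \<Rightarrow> nat"
  assumes bounds: "n \<le> N" "M \<le> N" "lim \<le> N"
begin

definition env :: "state \<Rightarrow> bool" where
  "env s \<longleftrightarrow> imem s ''n'' 0 = n \<and> imem s ''M'' 0 = M \<and> imem s ''lim'' 0 = lim \<and>
     (\<forall>i\<le>M. imem s ''P1'' i = i * M \<and> imem s ''P2'' i = i * (M * M) \<and> imem s ''P3'' i = i * (M * (M * M))) \<and>
     (\<forall>i<n. imem s ''color'' i = cl i \<and> rmem s ''x'' i = x i \<and> rmem s ''y'' i = y i) \<and>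
     (\<forall>i<M. rmem s ''gx'' i = lx i \<and> rmem s ''gy'' i = ly i)"

lemma env_iupdate [simp]:
  assumes "a \<notin> {''n'', ''M'', ''lim'', ''P1'', ''P2'', ''P3'', ''color''}"
  shows "env (iupdate a i v s) = env s"
proof -
  have "imem (iupdate a i v s) b = imem s b" if "b \<in> {''n'', ''M'', ''lim'', ''P1'', ''P2'', ''P3'', ''color''}" for b
    using assms that by auto
  then show ?thesis unfolding env_def rmem_iupdate by (simp only: insert_iff simp_thms)
qed

lemma env_rupdate [simp]:
  assumes "a \<notin> {''x'', ''y'', ''gx'', ''gy''}"
  shows "env (rupdate a i v s) = env s"
proof -
  have "rmem (rupdate a i v s) b = rmem s b" if "b \<in> {''x'', ''y'', ''gx'', ''gy''}" for b
    using assms that by auto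
  then show ?thesis unfolding env_def imem_rupdate by (simp only: insert_iff simp_thms)
qed

definition R :: "nat quad set" where
  "R = {..<M} \<times> {..<M} \<times> {..<M} \<times> {..<M}"

fun index :: "nat quad \<Rightarrow> nat" where
  "index (a, b, c, d) = a * (M * (M * M)) + b * (M * M) + (c * M + d)"

definition val :: "nat quad \<Rightarrow> real quad" where
  "val = qmap lx ly"

text \<open>Quadruples outside \<open>R\<close> may share a cell with one inside. Their fixed value
  0 makes a write at an index from \<open>R\<close> an exact function update.\<close>

definition tab :: "state \<Rightarrow> nat quad \<Rightarrow> nat" where
  "tab s q = (if q \<in> R then imem s ''T'' (index q) else 0)"

lemma ix_inj: "q \<in> R \<Longrightarrow> q' \<in> R \<Longrightarrow> index q = index q' \<Longrightarrow> q = q'"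
proof -
  assume q: "q \<in> R" "q' \<in> R" "index q = index q'"
  obtain a b c d a' b' c' d' where Q: "q = (a, b, c, d)" "q' = (a', b', c', d')" by (cases q; cases q')
  have lt: "d < M" "d' < M" "c < M" "c' < M" "b < M" "b' < M" using q by (auto simp: Q R_def)
  have "((a * M + b) * M + c) * M + d = ((a' * M + b') * M + c') * M + d'"
    using q(3) by (simp add: Q algebra_simps)
  from digits[OF this lt(1,2)] have 1: "(a * M + b) * M + c = (a' * M + b') * M + c'" "d = d'" by auto
  from digits[OF 1(1) lt(3,4)] have 2: "a * M + b = a' * M + b'" "c = c'" by auto
  from digits[OF 2(1) lt(5,6)] show ?thesis using 1 2 Q by simp
qed

lemma tab_update: "q \<in> R \<Longrightarrow> tab (iupdate ''T'' (index q) v s) = (tab s)(q := v)"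
  using ix_inj by (auto simp: tab_def fun_eq_iff)

lemma tab_iupdate [simp]: "a \<noteq> ''T'' \<Longrightarrow> tab (iupdate a i v s) = tab s"
  by (auto simp: tab_def fun_eq_iff)

lemma tab_rupdate [simp]: "tab (rupdate a i v s) = tab s"
  by (auto simp: tab_def fun_eq_iff)

lemma quad_of_simps: "quad_of s (a, b, c, d) = (imem s a 0, imem s b 0, imem s c 0, imem s d 0)"
  by (simp add: quad_of_def)

lemma quad_of_iupdate [simp]: "a \<notin> qset Q \<Longrightarrow> quad_of (iupdate a i v s) Q = quad_of s Q"
  by (cases Q) (auto simp: quad_of_simps)

lemma quad_of_rupdate [simp]: "quad_of (rupdate a i v s) Q = quad_of s Q"
  by (cases Q) (auto simp: quad_of_simps)

lemma pieces_qn: "map (quad_of s) (pieces w Q W) = pieces w (quad_of s Q) (quad_of s W)"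
  by (simp add: quad_of_def pieces_qmap)

lemma pieces_val: "map val (pieces w Q W) = pieces w (val Q) (val W)"
  by (simp add: val_def pieces_qmap)

lemma pieces_R: "Q \<in> R \<Longrightarrow> W \<in> R \<Longrightarrow> K \<in> set (pieces w Q W) \<Longrightarrow> K \<in> R"
  using pieces_qset[of K w Q W] by (cases Q; cases W; cases K) (auto simp: R_def)

lemma ival_ixe: "env s \<Longrightarrow> quad_of s q \<in> R \<Longrightarrow> ival (index_exp q) s = index (quad_of s q)"
  by (cases q) (auto simp: index_exp.simps env_def quad_of_simps R_def)

lemma ival_Te: "env s \<Longrightarrow> quad_of s q \<in> R \<Longrightarrow> ival (table_exp q) s = tab s (quad_of s q)"
  by (simp add: table_exp_def ival_ixe tab_def)

lemma ival_sume_list: "env s \<Longrightarrow> (\<And>q. q \<in> set qs \<Longrightarrow> quad_of s q \<in> R) \<Longrightarrow>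
    ival (cost_exp qs) s = 1 + sum_list (map (tab s) (map (quad_of s) qs))"
  by (induction qs) (auto simp: ival_Te)

lemma ival_sume: "env s \<Longrightarrow> quad_of s Q \<in> R \<Longrightarrow> quad_of s W \<in> R \<Longrightarrow>
    ival (cost_exp (pieces w Q W)) s = 1 + sum_list (map (tab s) (pieces w (quad_of s Q) (quad_of s W)))"
proof (subst ival_sume_list)
  assume e: "env s" "quad_of s Q \<in> R" "quad_of s W \<in> R"
  show "quad_of s q \<in> R" if "q \<in> set (pieces w Q W)" for q
  proof (rule pieces_R[OF e(2,3)])
    show "quad_of s q \<in> set (pieces w (quad_of s Q) (quad_of s W))" using that by (simp add: pieces_qn[symmetric])
  qed
qed (simp_all add: pieces_qn)

lemma bval_fitse: "env s \<Longrightarrow> quad_of s Q \<in> R \<Longrightarrow> quad_of s W \<in> R \<Longrightarrow> bval (fits_exp Q W) s \<longleftrightarrow> fits (val (quad_of s Q)) (val (quad_of s W))"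
  by (cases Q; cases W) (auto simp: env_def quad_of_simps R_def val_def rle_def not_less fits_exp.simps)

definition point_inside :: "nat \<Rightarrow> nat quad \<Rightarrow> bool" where
  "point_inside i q \<longleftrightarrow> in_quad (x i, y i) (val q)"

definition leaf_ok :: "nat quad \<Rightarrow> bool" where
  "leaf_ok q \<longleftrightarrow> \<not> (\<exists>i<n. \<exists>j<n. cl i < cl j \<and> point_inside i q \<and> point_inside j q)"

lemma bval_pine: "env s \<Longrightarrow> quad_of s Q \<in> R \<Longrightarrow> imem s i 0 < n \<Longrightarrow> bval (inside_exp i Q) s \<longleftrightarrow> point_inside (imem s i 0) (quad_of s Q)"
  by (cases Q) (auto simp: env_def quad_of_simps R_def val_def point_inside_def inside_exp.simps)

lemma bval_propere: "env s \<Longrightarrow> quad_of s Q \<in> R \<Longrightarrow> bval (proper_exp Q) s \<longleftrightarrow> proper (val (quad_of s Q))"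
  by (cases Q) (auto simp: env_def quad_of_simps R_def val_def proper_exp.simps)

lemma runs_init_body:
  assumes s: "env s" "quad_of s vq = q" "q \<in> R"
    and fin: "\<And>s'. env s' \<Longrightarrow> quad_of s' vq = q \<Longrightarrow> tab s' = (tab s)(q := if leaf_ok q then 1 else lim + 1) \<Longrightarrow> Q s'"
  shows "runs N init_body s Q"
  unfolding init_body_def
proof (rule runs_Seq, rule runs_IAssign)
  let ?s = "iupdate ''T'' (ival (index_exp vq) s) (ival (INum 1) s) s"
  have T1: "tab ?s = (tab s)(q := 1)" using s by (simp add: ival_ixe tab_update)
  let ?Inv = "\<lambda>s'. env s' \<and> quad_of s' vq = q \<and> (tab s' = (tab s)(q := 1) \<or> tab s' = (tab s)(q := lim + 1) \<and> \<not> leaf_ok q)"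
  let ?le = "\<lambda>s s'. tab s q = lim + 1 \<longrightarrow> tab s' q = lim + 1"
  let ?Post = "\<lambda>xs s. cl (xs ! 0) < cl (xs ! 1) \<and> point_inside (xs ! 0) q \<and> point_inside (xs ! 1) q \<longrightarrow> tab s q = lim + 1"
  show "runs N (nest [''i'', ''j''] (V ''n'') mark_mixed) ?s Q"
  proof (rule runs_nest[where Inv = ?Inv and le = ?le and Post = ?Post and M = n])
    show "?Inv ?s" using s T1 by (simp add: quad_of_simps)
    show "ival (V ''n'') s' = n" if "?Inv s'" for s' using that by (simp add: env_def)
    show "?Inv (iupdate v 0 k s')" if "v \<in> set [''i'', ''j'']" "?Inv s'" for s' v k
      using that by (auto simp: quad_of_simps)
    show "?le s' (iupdate v 0 k s')" if "v \<in> set [''i'', ''j'']" for s' v k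
      using that by auto
    show "runs N mark_mixed s'
       (\<lambda>s''. ?Inv s'' \<and> ?le s' s'' \<and> ?Post xs s'' \<and> (\<forall>v\<in>set [''i'', ''j'']. imem s'' v 0 = imem s' v 0))"
      if I: "?Inv s'" and xs: "length xs = length [''i'', ''j'']" "set xs \<subseteq> {..<n}" "map (\<lambda>v. imem s' v 0) [''i'', ''j''] = xs" for s' xs
    proof -
      have ij: "xs ! 0 = imem s' ''i'' 0" "xs ! 1 = imem s' ''j'' 0" "imem s' ''i'' 0 < n" "imem s' ''j'' 0 < n"
        using xs by auto
      have e: "env s'" "quad_of s' vq = q" using I by auto
      have b: "bval mixed_exp s'
        \<longleftrightarrow> cl (xs ! 0) < cl (xs ! 1) \<and> point_inside (xs ! 0) q \<and> point_inside (xs ! 1) q"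
        using bval_pine[of s' vq] e s(3) ij by (simp add: env_def mixed_exp_def)
      have lim: "ival (IAdd (V ''lim'') (INum 1)) s' = lim + 1" using e by (simp add: env_def)
      have ixq: "ival (index_exp vq) s' = index q" using e s(3) by (simp add: ival_ixe)
      show ?thesis unfolding mark_mixed_def
      proof (rule runs_If)
        assume "bval mixed_exp s'"
        then have nl: "\<not> leaf_ok q" using b ij unfolding leaf_ok_def by metis
        show "runs N (IAssign ''T'' (index_exp vq) (IAdd (V ''lim'') (INum 1))) s'
          (\<lambda>s''. ?Inv s'' \<and> ?le s' s'' \<and> ?Post xs s'' \<and> (\<forall>v\<in>set [''i'', ''j'']. imem s'' v 0 = imem s' v 0))"
        proof (rule runs_IAssign, unfold ixq lim)
          let ?t = "iupdate ''T'' (index q) (lim + 1) s'"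
          have "tab ?t = (tab s')(q := lim + 1)" by (rule tab_update[OF s(3)])
          also have "\<dots> = (tab s)(q := lim + 1)" using I by auto
          finally have "tab ?t = (tab s)(q := lim + 1)" .
          moreover have "env ?t" "quad_of ?t vq = q" using e by simp_all
          ultimately show "?Inv ?t \<and> ?le s' ?t \<and> ?Post xs ?t \<and> (\<forall>v\<in>set [''i'', ''j'']. imem ?t v 0 = imem s' v 0)"
            using nl by simp
        qed
      qed (use b I in \<open>auto intro!: runs_Skip\<close>)
    qed
    fix s' assume I: "?Inv s'" and P: "\<And>xs. length xs = length [''i'', ''j''] \<Longrightarrow> set xs \<subseteq> {..<n} \<Longrightarrow> ?Post xs s'"
    show "Q s'"
    proof (rule fin)
      have "tab s' q = lim + 1" if nl: "\<not> leaf_ok q"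
      proof -
        obtain i j where "i < n" "j < n" "cl i < cl j" "point_inside i q" "point_inside j q" using nl unfolding leaf_ok_def by blast
        then show ?thesis using P[of "[i, j]"] by simp
      qed
      then show "tab s' = (tab s)(q := if leaf_ok q then 1 else lim + 1)" using I by auto
    qed (use I in auto)
  qed (use bounds in auto)
qed

lemma runs_init:
  assumes s: "env s" and fin: "\<And>s'. env s' \<Longrightarrow> (\<And>q. q \<in> R \<Longrightarrow> tab s' q = (if leaf_ok q then 1 else lim + 1)) \<Longrightarrow> Q s'"
  shows "runs N init s Q"
  unfolding init_def
proof (rule runs_nest[where Inv = env and M = M and
    le = "\<lambda>s s'. \<forall>q\<in>R. tab s q = (if leaf_ok q then 1 else lim + 1) \<longrightarrow> tab s' q = (if leaf_ok q then 1 else lim + 1)" and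
    Post = "\<lambda>xs s. \<forall>a b c d. xs = [a, b, c, d] \<longrightarrow> tab s (a, b, c, d) = (if leaf_ok (a, b, c, d) then 1 else lim + 1) \<or> (a, b, c, d) \<notin> R"])
  show "env (iupdate v 0 k s)" if "v \<in> set [''a'', ''b'', ''c'', ''d'']" "env s" for s v k
    using that by auto
  show "\<forall>q\<in>R. tab s q = (if leaf_ok q then 1 else lim + 1) \<longrightarrow> tab (iupdate v 0 k s) q = (if leaf_ok q then 1 else lim + 1)"
    if "v \<in> set [''a'', ''b'', ''c'', ''d'']" for s v k
    using that by auto
  fix s and xs :: "nat list" assume e: "env s" and xs: "length xs = length [''a'', ''b'', ''c'', ''d'']" "set xs \<subseteq> {..<M}"
    "map (\<lambda>v. imem s v 0) [''a'', ''b'', ''c'', ''d''] = xs"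
  let ?q = "quad_of s vq"
  have xq: "xs = [a, b, c, d] \<Longrightarrow> (a, b, c, d) = ?q" for a b c d using xs by (auto simp: quad_of_simps)
  have q: "?q \<in> R" using xs by (auto simp: quad_of_simps R_def)
  show "runs N init_body s (\<lambda>s'. env s' \<and>
      (\<forall>q\<in>R. tab s q = (if leaf_ok q then 1 else lim + 1) \<longrightarrow> tab s' q = (if leaf_ok q then 1 else lim + 1)) \<and>
      (\<forall>a b c d. xs = [a, b, c, d] \<longrightarrow> tab s' (a, b, c, d) = (if leaf_ok (a, b, c, d) then 1 else lim + 1) \<or> (a, b, c, d) \<notin> R) \<and>
      (\<forall>v\<in>set [''a'', ''b'', ''c'', ''d'']. imem s' v 0 = imem s v 0))"
    by (rule runs_init_body[OF e refl q]) (use xq in \<open>auto simp: quad_of_simps\<close>)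
next
  fix s' assume "env s'" and P: "\<And>xs. length xs = length [''a'', ''b'', ''c'', ''d''] \<Longrightarrow> set xs \<subseteq> {..<M} \<Longrightarrow>
    \<forall>a b c d. xs = [a, b, c, d] \<longrightarrow> tab s' (a, b, c, d) = (if leaf_ok (a, b, c, d) then 1 else lim + 1) \<or> (a, b, c, d) \<notin> R"
  show "Q s'"
  proof (rule fin)
    fix q assume q: "q \<in> R"
    obtain a b c d where "q = (a, b, c, d)" by (cases q)
    then show "tab s' q = (if leaf_ok q then 1 else lim + 1)" using P[of "[a, b, c, d]"] q by (auto simp: R_def)
  qed fact
qed (use s bounds in \<open>auto simp: env_def\<close>)

text \<open>Each entry up to \<open>lim\<close> carries a certificate in the current table, a leaf
  or a split that accounts for it. Certificates use an inequality, so they stay valid when entries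
  decrease; the extraction of the boxes follows them.\<close>

definition sound :: "(nat quad \<Rightarrow> nat) \<Rightarrow> bool" where
  "sound T \<longleftrightarrow> (\<forall>q\<in>R. 1 \<le> T q \<and> T q \<le> lim + 1 \<and>
     (T q \<le> lim \<longrightarrow> leaf_ok q \<and> T q = 1 \<or>
       (\<exists>w. \<exists>W\<in>R. fits (val q) (val W) \<and> 1 + sum_list (map T (pieces w q W)) \<le> T q)))"

text \<open>Equal coordinates repeat lines, so several quadruples of indices may describe one
  rectangle; the leaf predicate on rectangles therefore quantifies over all of them.\<close>

definition complete :: "nat \<Rightarrow> (nat quad \<Rightarrow> nat) \<Rightarrow> bool" where
  "complete k T \<longleftrightarrow> (\<forall>q\<in>R. (leaf_ok q \<longrightarrow> T q \<le> 1) \<and>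
     (\<forall>c\<le>k. tiling (\<lambda>Q. \<forall>q\<in>R. val q = Q \<longrightarrow> leaf_ok q) (lx ` {..<M}) (ly ` {..<M}) (val q) c \<longrightarrow> T q \<le> c))"

lemma sum_list_le: "(\<And>K. K \<in> set Ks \<Longrightarrow> f K \<le> (g K :: nat)) \<Longrightarrow> sum_list (map f Ks) \<le> sum_list (map g Ks)"
  by (rule sum_list_mono)

lemma sound_relax:
  assumes T: "sound T" and q: "q \<in> R" "W \<in> R" "fits (val q) (val W)" "1 + sum_list (map T (pieces w q W)) < T q"
  shows "sound (T(q := 1 + sum_list (map T (pieces w q W))))"
proof -
  let ?T = "T(q := 1 + sum_list (map T (pieces w q W)))"
  have le: "?T p \<le> T p" for p using q(4) by simp
  have sl: "sum_list (map ?T Ks) \<le> sum_list (map T Ks)" for Ks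
    by (rule sum_list_le) (rule le)
  show ?thesis unfolding sound_def
  proof
    fix p assume p: "p \<in> R"
    have Tp: "1 \<le> T p" "T p \<le> lim + 1" "T p \<le> lim \<Longrightarrow> leaf_ok p \<and> T p = 1 \<or>
       (\<exists>w. \<exists>W\<in>R. fits (val p) (val W) \<and> 1 + sum_list (map T (pieces w p W)) \<le> T p)"
      using T p unfolding sound_def by blast+
    show "1 \<le> ?T p \<and> ?T p \<le> lim + 1 \<and> (?T p \<le> lim \<longrightarrow> leaf_ok p \<and> ?T p = 1 \<or>
       (\<exists>w. \<exists>W\<in>R. fits (val p) (val W) \<and> 1 + sum_list (map ?T (pieces w p W)) \<le> ?T p))"
    proof (cases "p = q")
      case True
      have "1 + sum_list (map ?T (pieces w q W)) \<le> ?T q" using sl[of "pieces w q W"] by simp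
      moreover have "?T q \<le> lim + 1" using le[of q] Tp(2) True by simp
      ultimately show ?thesis using q True by auto
    next
      case False
      then have eq: "?T p = T p" by simp
      have "1 + sum_list (map ?T (pieces w p W)) \<le> T p" if "1 + sum_list (map T (pieces w p W)) \<le> T p" for w W
        using sl[of "pieces w p W"] that by simp
      then have "T p \<le> lim \<longrightarrow> leaf_ok p \<and> T p = 1 \<or>
          (\<exists>w. \<exists>W\<in>R. fits (val p) (val W) \<and> 1 + sum_list (map ?T (pieces w p W)) \<le> T p)"
        using Tp(3) by blast
      then show ?thesis unfolding eq using Tp(1,2) by blast
    qed
  qed
qed

lemma runs_relax:
  assumes s: "env s" "sound (tab s)" and q: "quad_of s vq = q" "q \<in> R" "quad_of s vw = W" "W \<in> R"
    and fin: "\<And>s'. env s' \<Longrightarrow> sound (tab s') \<Longrightarrow> (\<And>q. tab s' q \<le> tab s q) \<Longrightarrow>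
      (fits (val q) (val W) \<Longrightarrow> tab s' q \<le> 1 + sum_list (map (tab s) (pieces w q W))) \<Longrightarrow>
      frame {''T''} {} s s' \<Longrightarrow> Q s'"
  shows "runs N (relax w) s Q"
  unfolding relax_def
proof (rule runs_If)
  have Rs: "quad_of s vq \<in> R" "quad_of s vw \<in> R" using q by auto
  note cost_exp = ival_sume[OF s(1) Rs, of w, unfolded q(1,3)] and table_exp = ival_Te[OF s(1) Rs(1), unfolded q(1)]
    and index_exp = ival_ixe[OF s(1) Rs(1), unfolded q(1)] and fits = bval_fitse[OF s(1) Rs, unfolded q(1,3)]
  {
    assume b: "bval (BAnd (fits_exp vq vw) (ILess (cost_exp (pieces w vq vw)) (table_exp vq))) s"
    then have b': "fits (val q) (val W)" "1 + sum_list (map (tab s) (pieces w q W)) < tab s q"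
      by (simp_all only: bval.simps cost_exp table_exp fits)
    let ?s = "iupdate ''T'' (index q) (1 + sum_list (map (tab s) (pieces w q W))) s"
    have T: "tab ?s = (tab s)(q := 1 + sum_list (map (tab s) (pieces w q W)))" using q by (simp only: tab_update)
    show "runs N (IAssign ''T'' (index_exp vq) (cost_exp (pieces w vq vw))) s Q"
    proof (rule runs_IAssign, unfold cost_exp index_exp, rule fin)
      show "sound (tab ?s)" unfolding T by (rule sound_relax[OF s(2) q(2,4) b'])
      show "tab ?s p \<le> tab s p" for p unfolding T using b' by simp
      show "tab ?s q \<le> 1 + sum_list (map (tab s) (pieces w q W))" unfolding T by simp
    qed (use s in simp_all)
  }
  assume b: "\<not> bval (BAnd (fits_exp vq vw) (ILess (cost_exp (pieces w vq vw)) (table_exp vq))) s"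
  show "runs N Skip s Q"
  proof (rule runs_Skip, rule fin)
    show "tab s q \<le> 1 + sum_list (map (tab s) (pieces w q W))" if "fits (val q) (val W)"
      using that b by (simp only: bval.simps cost_exp table_exp fits) simp
  qed (use s in simp_all)
qed

text \<open>In a tiling of cost \<open>Suc k\<close> that is a split, every piece costs at most
  \<open>k\<close>, and there the old table is already low enough.\<close>

lemma complete_step:
  assumes T0: "complete k T0" and le: "\<And>q. T q \<le> T0 q"
    and T: "\<And>q W w. q \<in> R \<Longrightarrow> W \<in> R \<Longrightarrow> fits (val q) (val W) \<Longrightarrow> T q \<le> 1 + sum_list (map T0 (pieces w q W))"
  shows "complete (Suc k) T"
  unfolding complete_def
proof (intro ballI conjI allI impI)
  fix q assume q: "q \<in> R"
  have lfq: "leaf_ok q \<Longrightarrow> T q \<le> 1" using T0 q le[of q] unfolding complete_def by fastforce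
  then show "leaf_ok q \<Longrightarrow> T q \<le> 1" .
  let ?ok = "\<lambda>Q. \<forall>q\<in>R. val q = Q \<longrightarrow> leaf_ok q" and ?GX = "lx ` {..<M}" and ?GY = "ly ` {..<M}"
  fix c assume c: "c \<le> Suc k" and p: "tiling ?ok ?GX ?GY (val q) c"
  from p show "T q \<le> c"
  proof (cases rule: tiling.cases)
    case leaf
    then have "leaf_ok q" using q by blast
    then show ?thesis using lfq leaf by simp
  next
    case (split W w f)
    have "W \<in> val ` R"
      using split(2) by (cases W) (force simp: R_def val_def image_iff)
    then obtain W' where W': "W' \<in> R" "W = val W'" by blast
    have pieces: "pieces w (val q) W = map val (pieces w q W')" by (simp add: W' pieces_val)
    have "T0 K \<le> f (val K)" if K: "K \<in> set (pieces w q W')" for K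
    proof -
      have vK: "val K \<in> set (pieces w (val q) W)" using K by (simp add: pieces)
      have "f (val K) \<le> sum_list (map f (pieces w (val q) W))"
        using vK by (simp add: member_le_sum_list)
      then have "f (val K) \<le> k" using split(4) c by simp
      then show ?thesis using T0 pieces_R[OF q W'(1) K] split(3) vK unfolding complete_def by blast
    qed
    then have "sum_list (map T0 (pieces w q W')) \<le> sum_list (map (f \<circ> val) (pieces w q W'))"
      by (intro sum_list_le) simp
    also have "\<dots> = sum_list (map f (pieces w (val q) W))" by (simp add: pieces)
    finally have "1 + sum_list (map T0 (pieces w q W')) \<le> c" using split(4) by simp
    then show ?thesis using T[OF q W'(1), of w] split(1) W'(2) by simp
  qed
qed

text \<open>The sums refer to the table at the start of the round. Entries lowered during the round
  only make the new sums smaller.\<close>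

lemma runs_round:
  assumes s: "env s" "sound (tab s)" "k \<notin> {''n'', ''M'', ''lim'', ''P1'', ''P2'', ''P3'', ''color'', ''T''}"
      "k \<notin> {''a'', ''b'', ''c'', ''d'', ''e'', ''f'', ''g'', ''h''}" "imem s k 0 = m"
    and fin: "\<And>s'. env s' \<Longrightarrow> sound (tab s') \<Longrightarrow> imem s' k 0 = m \<Longrightarrow> (\<And>q. tab s' q \<le> tab s q) \<Longrightarrow>
      (\<And>q W w. q \<in> R \<Longrightarrow> W \<in> R \<Longrightarrow> fits (val q) (val W) \<Longrightarrow> tab s' q \<le> 1 + sum_list (map (tab s) (pieces w q W))) \<Longrightarrow> Q s'"
  shows "runs N relax_all s Q"
proof -
  let ?vs = "[''a'', ''b'', ''c'', ''d'', ''e'', ''f'', ''g'', ''h'']"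
  let ?T0 = "tab s"
  let ?Inv = "\<lambda>s'. env s' \<and> sound (tab s') \<and> imem s' k 0 = m \<and> (\<forall>q. tab s' q \<le> ?T0 q)"
  let ?le = "\<lambda>s s'. \<forall>q. tab s' q \<le> tab s q"
  let ?good = "\<lambda>q W s'. fits (val q) (val W) \<longrightarrow> (\<forall>w. tab s' q \<le> 1 + sum_list (map ?T0 (pieces w q W)))"
  let ?Post = "\<lambda>xs s'. \<forall>a b c d e f g h. xs = [a, b, c, d, e, f, g, h] \<longrightarrow> ?good (a, b, c, d) (e, f, g, h) s'"
  show ?thesis unfolding relax_all_def
  proof (rule runs_nest[where Inv = ?Inv and le = ?le and Post = ?Post and M = M])
    show "ival (V ''M'') s' = M" if "?Inv s'" for s' using that by (simp add: env_def)
    show "?Inv (iupdate v 0 l s')" if "v \<in> set ?vs" "?Inv s'" for s' v l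
    proof -
      have "v \<notin> {''n'', ''M'', ''lim'', ''P1'', ''P2'', ''P3'', ''color''}" "v \<noteq> ''T''" "k \<noteq> v"
        using that(1) s(4) by auto
      then show ?thesis using that(2) by simp
    qed
    show "?le s' (iupdate v 0 l s')" if "v \<in> set ?vs" for s' v l
    proof -
      have "v \<noteq> ''T''" using that by auto
      then show ?thesis by simp
    qed
    show "?le s1 s3" if "?le s1 s2" "?le s2 s3" for s1 s2 s3 using that order_trans by blast
    show "?Post xs s2" if "?le s1 s2" "?Post xs s1" for s1 s2 xs using that order_trans by blast
    fix s1 and xs :: "nat list"
    assume I: "?Inv s1" and xs: "length xs = length ?vs" "set xs \<subseteq> {..<M}" "map (\<lambda>v. imem s1 v 0) ?vs = xs"
    let ?q = "quad_of s1 vq" and ?W = "quad_of s1 vw"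
    have q: "?q \<in> R" "?W \<in> R" using xs(2,3) by (auto simp: quad_of_simps R_def)
    have T0: "sum_list (map (tab s') Ks) \<le> sum_list (map ?T0 Ks)" if "\<And>q. tab s' q \<le> ?T0 q" for s' Ks
      using that by (intro sum_list_le)
    show "runs N (Seq (relax True) (relax False)) s1
      (\<lambda>s'. ?Inv s' \<and> ?le s1 s' \<and> ?Post xs s' \<and> (\<forall>v\<in>set ?vs. imem s' v 0 = imem s1 v 0))"
    proof (rule runs_Seq, rule runs_relax[OF _ _ refl q(1) refl q(2)])
      show "env s1" "sound (tab s1)" using I by blast+
      fix s2 assume 2: "env s2" "sound (tab s2)" "\<And>q. tab s2 q \<le> tab s1 q"
        "fits (val ?q) (val ?W) \<Longrightarrow> tab s2 ?q \<le> 1 + sum_list (map (tab s1) (pieces True ?q ?W))" "frame {''T''} {} s1 s2"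
      have im2: "imem s2 v = imem s1 v" if "v \<noteq> ''T''" for v using frame_imem[OF 2(5)] that by simp
      have q2: "quad_of s2 vq = ?q" "quad_of s2 vw = ?W" by (simp_all add: quad_of_simps im2)
      show "runs N (relax False) s2
        (\<lambda>s'. ?Inv s' \<and> ?le s1 s' \<and> ?Post xs s' \<and> (\<forall>v\<in>set ?vs. imem s' v 0 = imem s1 v 0))"
      proof (rule runs_relax[OF 2(1,2) q2(1) q(1) q2(2) q(2)])
        fix s3 assume 3: "env s3" "sound (tab s3)" "\<And>q. tab s3 q \<le> tab s2 q"
          "fits (val ?q) (val ?W) \<Longrightarrow> tab s3 ?q \<le> 1 + sum_list (map (tab s2) (pieces False ?q ?W))" "frame {''T''} {} s2 s3"
        have im3: "imem s3 v = imem s1 v" if "v \<noteq> ''T''" for v using frame_imem[OF 3(5)] im2 that by simp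
        have le: "\<And>q. tab s3 q \<le> tab s1 q" "\<And>q. tab s3 q \<le> ?T0 q" "\<And>q. tab s2 q \<le> ?T0 q" "\<And>q. tab s1 q \<le> ?T0 q"
        proof -
          show le1: "tab s1 q \<le> ?T0 q" for q using I by blast
          show le2: "tab s2 q \<le> ?T0 q" for q using 2(3)[of q] le1[of q] by simp
          show "tab s3 q \<le> tab s1 q" for q using 3(3)[of q] 2(3)[of q] by simp
          show "tab s3 q \<le> ?T0 q" for q using 3(3)[of q] le2[of q] by simp
        qed
        have g: "?good ?q ?W s3"
        proof (intro impI allI)
          fix w assume f: "fits (val ?q) (val ?W)"
          show "tab s3 ?q \<le> 1 + sum_list (map ?T0 (pieces w ?q ?W))"
          proof (cases w)
            case True
            then show ?thesis
              using 3(3)[of ?q] 2(4)[OF f] T0[OF le(4), of "pieces True ?q ?W"] by simp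
          next
            case False
            then show ?thesis
              using 3(4)[OF f] T0[OF le(3), of "pieces False ?q ?W"] by simp
          qed
        qed
        have "?Post xs s3"
        proof (intro allI impI)
          fix a b c d e f g h assume "xs = [a, b, c, d, e, f, g, h]"
            and f: "fits (val (a, b, c, d)) (val (e, f, g, h))" 
          then have eq: "?q = (a, b, c, d)" "?W = (e, f, g, h)" using xs(3) by (simp_all add: quad_of_simps)
          show "tab s3 (a, b, c, d) \<le> 1 + sum_list (map ?T0 (pieces w (a, b, c, d) (e, f, g, h)))" for w
            using g f unfolding eq by blast
        qed
        moreover have "imem s3 k = imem s1 k" using im3[of k] s(3) by simp
        moreover have "\<forall>v\<in>set ?vs. imem s3 v 0 = imem s1 v 0" by (simp add: im3)
        ultimately show "?Inv s3 \<and> ?le s1 s3 \<and> ?Post xs s3 \<and> (\<forall>v\<in>set ?vs. imem s3 v 0 = imem s1 v 0)"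
          using 3(1,2) le I by simp
      qed
    qed
  next
    fix s' assume I: "?Inv s'" and P: "\<And>xs. length xs = length ?vs \<Longrightarrow> set xs \<subseteq> {..<M} \<Longrightarrow> ?Post xs s'"
    show "Q s'"
    proof (rule fin)
      fix q W w assume q: "q \<in> R" "W \<in> R" "fits (val q) (val W)"
      obtain a b c d e f g h where eq: "q = (a, b, c, d)" "W = (e, f, g, h)" by (cases q; cases W)
      have "?Post [a, b, c, d, e, f, g, h] s'" by (rule P) (use q in \<open>auto simp: eq R_def\<close>)
      then show "tab s' q \<le> 1 + sum_list (map ?T0 (pieces w q W))" using q(3) by (simp add: eq)
    qed (use I in auto)
  qed (use s bounds in auto)
qed

lemma runs_rounds:
  assumes s: "env s" "\<And>q. q \<in> R \<Longrightarrow> tab s q = (if leaf_ok q then 1 else lim + 1)"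
    and fin: "\<And>s'. env s' \<Longrightarrow> sound (tab s') \<Longrightarrow> complete lim (tab s') \<Longrightarrow> Q s'"
  shows "runs N rounds s Q"
  unfolding rounds_def
proof (rule runs_For[where J = "\<lambda>k s. env s \<and> sound (tab s) \<and> complete k (tab s)" and m = lim])
  have "sound (tab s)" unfolding sound_def by (simp add: s(2))
  moreover have "complete 0 (tab s)"
    unfolding complete_def by (auto simp: s(2) dest: tiling_pos)
  ultimately show "env (iupdate ''k'' 0 0 s) \<and> sound (tab (iupdate ''k'' 0 0 s)) \<and> complete 0 (tab (iupdate ''k'' 0 0 s))"
    using s(1) by simp
  show "ival (V ''lim'') s = lim" if "env s \<and> sound (tab s) \<and> complete k (tab s)" for k s
    using that by (simp add: env_def)
  fix k s assume J: "env s \<and> sound (tab s) \<and> complete k (tab s)" and k: "imem s ''k'' 0 = k"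
  show "runs N relax_all s
     (\<lambda>s'. imem s' ''k'' 0 = k \<and> env (iupdate ''k'' 0 (Suc k) s') \<and> sound (tab (iupdate ''k'' 0 (Suc k) s')) \<and>
       complete (Suc k) (tab (iupdate ''k'' 0 (Suc k) s')))"
  proof (rule runs_round[where k = "''k''" and m = k])
    fix s' assume 1: "env s'" "sound (tab s')" "imem s' ''k'' 0 = k" "\<And>q. tab s' q \<le> tab s q"
      "\<And>q W w. q \<in> R \<Longrightarrow> W \<in> R \<Longrightarrow> fits (val q) (val W) \<Longrightarrow> tab s' q \<le> 1 + sum_list (map (tab s) (pieces w q W))"
    have "complete (Suc k) (tab s')" using J by (intro complete_step[OF _ 1(4,5)]) auto
    then show "imem s' ''k'' 0 = k \<and> env (iupdate ''k'' 0 (Suc k) s') \<and> sound (tab (iupdate ''k'' 0 (Suc k) s')) \<and>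
       complete (Suc k) (tab (iupdate ''k'' 0 (Suc k) s'))" using 1 by simp
  qed (use J k in auto)
qed (use bounds fin in auto)

end

subsection \<open>Reading off the boxes\<close>

definition stack :: "state \<Rightarrow> nat quad list" where
  "stack s = map (\<lambda>k. (imem s ''sa'' k, imem s ''sb'' k, imem s ''sc'' k, imem s ''sd'' k)) [0..<imem s ''sp'' 0]"

definition boxes :: "state \<Rightarrow> real quad list" where
  "boxes s = map (\<lambda>k. (rmem s ''x1'' k, rmem s ''x2'' k, rmem s ''y1'' k, rmem s ''y2'' k)) [0..<imem s ''m'' 0]"

abbreviation stack_names :: "vname set" where
  "stack_names \<equiv> {''sa'', ''sb'', ''sc'', ''sd'', ''sp''}"

lemma quad_of_Fr: "frame A B s s' \<Longrightarrow> qset Q \<inter> A = {} \<Longrightarrow> quad_of s' Q = quad_of s Q"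
  by (cases Q) (auto simp: frame_def quad_of_def)

lemma runs_push:
  assumes "qset q \<inter> stack_names = {}"
    and fin: "\<And>s'. stack s' = stack s @ [quad_of s q] \<Longrightarrow> frame stack_names {} s s' \<Longrightarrow> Q s'"
  shows "runs N (push q) s Q"
proof (cases q)
  case q: (fields a b c d)
  have "{a, b, c, d} \<inter> stack_names = {}" using assms(1) by (simp only: q qset.simps)
  then have ne: "a \<notin> stack_names" "b \<notin> stack_names" "c \<notin> stack_names" "d \<notin> stack_names" by blast+
  show ?thesis unfolding q push.simps
  proof (intro runs_Seq runs_IAssign, rule fin)
    let ?s1 = "iupdate ''sa'' (ival (V ''sp'') s) (ival (V a) s) s"
    let ?s2 = "iupdate ''sb'' (ival (V ''sp'') ?s1) (ival (V b) ?s1) ?s1"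
    let ?s3 = "iupdate ''sc'' (ival (V ''sp'') ?s2) (ival (V c) ?s2) ?s2"
    let ?s4 = "iupdate ''sd'' (ival (V ''sp'') ?s3) (ival (V d) ?s3) ?s3"
    let ?s5 = "iupdate ''sp'' (ival (INum 0) ?s4) (ival (IAdd (V ''sp'') (INum 1)) ?s4) ?s4"
    show "stack ?s5 = stack s @ [quad_of s q]" using ne by (simp add: stack_def q quad_of_def)
    show "frame stack_names {} s ?s5" by simp
  qed
qed

lemma runs_pushes:
  assumes "\<And>q. q \<in> set qs \<Longrightarrow> qset q \<inter> stack_names = {}"
    and fin: "\<And>s'. stack s' = stack s @ map (quad_of s) qs \<Longrightarrow> frame stack_names {} s s' \<Longrightarrow> Q s'"
  shows "runs N (pushes qs) s Q"
  using assms
proof (induction qs arbitrary: s)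
  case Nil
  show ?case by simp (rule runs_Skip, rule Nil, simp_all)
next
  case (Cons q qs)
  show ?case unfolding pushes.simps
  proof (rule runs_Seq, rule runs_push)
    show "qset q \<inter> stack_names = {}" using Cons.prems(1) by simp
    fix s1 assume 1: "stack s1 = stack s @ [quad_of s q]" "frame stack_names {} s s1"
    show "runs N (pushes qs) s1 Q"
    proof (rule Cons.IH)
      show "qset q \<inter> stack_names = {}" if "q \<in> set qs" for q using Cons.prems(1) that by simp
      fix s2 assume 2: "stack s2 = stack s1 @ map (quad_of s1) qs" "frame stack_names {} s1 s2"
      have "map (quad_of s1) qs = map (quad_of s) qs"
      proof (rule map_cong[OF refl])
        show "quad_of s1 q = quad_of s q" if "q \<in> set qs" for q
          using Cons.prems(1)[of q] that by (intro quad_of_Fr[OF 1(2)]) simp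
      qed
      then show "Q s2" using 1 2 by (intro Cons.prems(2)) (auto intro: frame_trans)
    qed
  qed
qed

context table
begin

lemma env_Fr:
  assumes "frame A {} s s'" "A \<inter> {''n'', ''M'', ''lim'', ''P1'', ''P2'', ''P3'', ''color''} = {}"
  shows "env s' = env s"
proof -
  have "imem s' b = imem s b" if "b \<in> {''n'', ''M'', ''lim'', ''P1'', ''P2'', ''P3'', ''color''}" for b
  proof (rule frame_imem[OF assms(1)], rule notI)
    assume "b \<in> A"
    then have "b \<in> A \<inter> {''n'', ''M'', ''lim'', ''P1'', ''P2'', ''P3'', ''color''}" using that by (rule IntI)
    then show False unfolding assms(2) by simp
  qed
  moreover have "rmem s' = rmem s" using frame_rmem[OF assms(1)] by auto
  ultimately show ?thesis unfolding env_def by (simp only: insert_iff simp_thms)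
qed

lemma tab_Fr: "frame A B s s' \<Longrightarrow> ''T'' \<notin> A \<Longrightarrow> tab s' = tab s"
  using frame_imem[of A B s s' "''T''"] by (simp add: tab_def fun_eq_iff)

lemma boxes_Fr: "frame A {} s s' \<Longrightarrow> ''m'' \<notin> A \<Longrightarrow> boxes s' = boxes s"
  using frame_imem[of A "{}" s s' "''m''"] frame_rmem[of A "{}" s s'] by (simp add: boxes_def)

lemma stack_iupdate [simp]:
  assumes "a \<notin> stack_names"
  shows "stack (iupdate a i v s) = stack s"
proof -
  have "imem (iupdate a i v s) b = imem s b" if "b \<in> stack_names" for b
    using assms that by auto
  then show ?thesis unfolding stack_def by (simp only: insert_iff simp_thms)
qed

lemma stack_rupdate [simp]: "stack (rupdate a i v s) = stack s"
  by (simp add: stack_def)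

lemma boxes_iupdate [simp]: "a \<noteq> ''m'' \<Longrightarrow> boxes (iupdate a i v s) = boxes s"
  by (simp add: boxes_def)

lemma runs_attempt:
  assumes s: "env s" and q: "quad_of s vq = q" "q \<in> R" "quad_of s vw = W" "W \<in> R"
    and yes: "\<And>s'. imem s ''found'' 0 = 0 \<Longrightarrow> fits (val q) (val W) \<Longrightarrow>
        1 + sum_list (map (tab s) (pieces w q W)) \<le> tab s q \<Longrightarrow>
        frame (insert ''found'' stack_names) {} s s' \<Longrightarrow> imem s' ''found'' 0 = 1 \<Longrightarrow> stack s' = stack s @ pieces w q W \<Longrightarrow> Q s'"
    and no: "imem s ''found'' 0 = 0 \<Longrightarrow> \<not> (fits (val q) (val W) \<and> 1 + sum_list (map (tab s) (pieces w q W)) \<le> tab s q) \<Longrightarrow> Q s"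
    and found: "imem s ''found'' 0 > 0 \<Longrightarrow> Q s"
  shows "runs N (attempt w) s Q"
  unfolding attempt_def
proof (rule runs_If)
  have Rs: "quad_of s vq \<in> R" "quad_of s vw \<in> R" using q by auto
  note cost_exp = ival_sume[OF s(1) Rs, of w, unfolded q(1,3)] and table_exp = ival_Te[OF s(1) Rs(1), unfolded q(1)]
    and fits = bval_fitse[OF s(1) Rs, unfolded q(1,3)]
  let ?b = "BAnd (ILess (V ''found'') (INum 1)) (BAnd (fits_exp vq vw) (BNot (ILess (table_exp vq) (cost_exp (pieces w vq vw)))))"
  have b: "bval ?b s \<longleftrightarrow> imem s ''found'' 0 = 0 \<and> fits (val q) (val W) \<and> 1 + sum_list (map (tab s) (pieces w q W)) \<le> tab s q"
    by (simp only: bval.simps cost_exp table_exp fits not_less ival.simps) auto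
  {
    assume "bval ?b s"
    with b have b': "imem s ''found'' 0 = 0" "fits (val q) (val W)" "1 + sum_list (map (tab s) (pieces w q W)) \<le> tab s q"
      by blast+
    let ?s = "iupdate ''found'' (ival (INum 0) s) (ival (INum 1) s) s"
    show "runs N (Seq (IAssign ''found'' (INum 0) (INum 1)) (pushes (pieces w vq vw))) s Q"
    proof (rule runs_Seq, rule runs_IAssign, rule runs_pushes)
      show "qset p \<inter> stack_names = {}" if "p \<in> set (pieces w vq vw)" for p
        using pieces_qset[OF that] by auto
      fix s' assume 1: "stack s' = stack ?s @ map (quad_of ?s) (pieces w vq vw)" "frame stack_names {} ?s s'"
      have "frame (insert ''found'' stack_names) {} s ?s" by simp
      then have F: "frame (insert ''found'' stack_names) {} s s'" by (rule frame_trans[OF _ 1(2)]) auto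
      have "imem s' ''found'' = imem ?s ''found''" by (rule frame_imem[OF 1(2)]) simp
      moreover have "stack s' = stack s @ pieces w q W" unfolding 1(1) by (simp add: pieces_qn q)
      ultimately show "Q s'" using b' F by (intro yes) simp_all
    qed
  }
  assume "\<not> bval ?b s"
  then show "runs N Skip s Q"
    using no found b by (intro runs_Skip) blast
qed

text \<open>The scan meets the split provided by \<open>ex\<close> unless an earlier one has set the
  flag, so it ends with the pieces of exactly one split on the stack.\<close>

lemma runs_search:
  assumes s: "env s" and q: "quad_of s vq = q" "q \<in> R" and f: "imem s ''found'' 0 = 0"
    and ex: "\<exists>w. \<exists>W\<in>R. fits (val q) (val W) \<and> 1 + sum_list (map (tab s) (pieces w q W)) \<le> tab s q"
    and fin: "\<And>s' w W. env s' \<Longrightarrow> tab s' = tab s \<Longrightarrow> boxes s' = boxes s \<Longrightarrow> W \<in> R \<Longrightarrow> fits (val q) (val W) \<Longrightarrow>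
      1 + sum_list (map (tab s) (pieces w q W)) \<le> tab s q \<Longrightarrow> stack s' = stack s @ pieces w q W \<Longrightarrow> Q s'"
  shows "runs N search s Q"
proof -
  let ?vs = "[''e'', ''f'', ''g'', ''h'']"
  let ?A = "{''e'', ''f'', ''g'', ''h'', ''found''} \<union> stack_names"
  define P where "P w W \<longleftrightarrow> W \<in> R \<and> fits (val q) (val W) \<and> 1 + sum_list (map (tab s) (pieces w q W)) \<le> tab s q" for w W
  let ?done = "\<lambda>s'. imem s' ''found'' 0 = 1 \<and> (\<exists>w W. P w W \<and> stack s' = stack s @ pieces w q W)"
  let ?Inv = "\<lambda>s'. frame ?A {} s s' \<and> (imem s' ''found'' 0 = 0 \<and> stack s' = stack s \<or> ?done s')"
  let ?le = "\<lambda>s s'. imem s ''found'' 0 = 1 \<longrightarrow> imem s' ''found'' 0 = 1"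
  let ?Post = "\<lambda>xs s'. \<forall>a b c d w. xs = [a, b, c, d] \<longrightarrow> P w (a, b, c, d) \<longrightarrow> imem s' ''found'' 0 = 1"
  have FrD: "env s'" "tab s' = tab s" "boxes s' = boxes s" "quad_of s' vq = q" if "frame ?A {} s s'" for s'
    using env_Fr[OF that] tab_Fr[OF that] boxes_Fr[OF that] quad_of_Fr[OF that, of vq] s q by auto
  show ?thesis unfolding search_def
  proof (rule runs_nest[where Inv = ?Inv and le = ?le and Post = ?Post and M = M])
    show "ival (V ''M'') s' = M" if "?Inv s'" for s' using FrD(1)[of s'] that by (simp add: env_def)
    show "?Inv (iupdate v 0 k s')" if v: "v \<in> set ?vs" and I: "?Inv s'" for s' v k
    proof -
      have "v \<in> ?A" "v \<noteq> ''found''" "v \<notin> stack_names" using v by auto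
      then show ?thesis using I by (simp del: insert_iff Un_iff)
    qed
    show "?le s' (iupdate v 0 k s')" if "v \<in> set ?vs" for s' v k using that by auto
    show "?Inv s" using f by simp
    fix s1 and xs :: "nat list"
    assume I: "?Inv s1" and xs: "length xs = length ?vs" "set xs \<subseteq> {..<M}" "map (\<lambda>v. imem s1 v 0) ?vs = xs"
    let ?W = "quad_of s1 vw"
    have W: "?W \<in> R" using xs(2,3) by (auto simp: quad_of_simps R_def)
    have xW: "xs = [a, b, c, d] \<Longrightarrow> (a, b, c, d) = ?W" for a b c d using xs(3) by (simp add: quad_of_simps)
    let ?G = "\<lambda>s'. ?Inv s' \<and> ?le s1 s' \<and> ?Post xs s' \<and> (\<forall>v\<in>set ?vs. imem s' v 0 = imem s1 v 0)"
    let ?H = "\<lambda>s'. ?Inv s' \<and> ?le s1 s' \<and> (P True ?W \<longrightarrow> imem s' ''found'' 0 = 1) \<and> (\<forall>v\<in>set ?vs. imem s' v 0 = imem s1 v 0)"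
    have att: "runs N (attempt w) s2 (\<lambda>s'. ?Inv s' \<and> ?le s2 s' \<and> (P w ?W \<longrightarrow> imem s' ''found'' 0 = 1) \<and> (\<forall>v\<in>set ?vs. imem s' v 0 = imem s1 v 0))"
      if I2: "?Inv s2" and v2: "\<forall>v\<in>set ?vs. imem s2 v 0 = imem s1 v 0" for s2 w
    proof (rule runs_attempt[where q = q and W = ?W])
      have F2: "frame ?A {} s s2" using I2 by blast
      show "env s2" "quad_of s2 vq = q" using FrD[OF F2] by blast+
      have T2: "tab s2 = tab s" by (rule FrD(2)[OF F2])
      show "quad_of s2 vw = ?W" using v2 by (simp add: quad_of_simps)
      {
        fix s' assume a: "imem s2 ''found'' 0 = 0" "fits (val q) (val ?W)"
          "1 + sum_list (map (tab s2) (pieces w q ?W)) \<le> tab s2 q"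
          "frame (insert ''found'' stack_names) {} s2 s'" "imem s' ''found'' 0 = 1" "stack s' = stack s2 @ pieces w q ?W"
        have "frame ?A {} s s'" by (rule frame_trans[OF F2 a(4)]) auto
        moreover have "P w ?W" using a(2,3) W unfolding P_def T2 by blast
        moreover have "stack s2 = stack s" using I2 a(1) by auto
        ultimately have d: "frame ?A {} s s'" "?done s'" using a(5,6) by (blast, metis)
        have "imem s' v 0 = imem s2 v 0" if "v \<in> set ?vs" for v
        proof -
          have "imem s' v = imem s2 v" by (rule frame_imem[OF a(4)]) (use that in auto)
          then show ?thesis by simp
        qed
        then have "\<forall>v\<in>set ?vs. imem s' v 0 = imem s1 v 0" using v2 by simp
        then show "?Inv s' \<and> ?le s2 s' \<and> (P w ?W \<longrightarrow> imem s' ''found'' 0 = 1) \<and> (\<forall>v\<in>set ?vs. imem s' v 0 = imem s1 v 0)"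
          using a(5) d by blast
      }
      {
        assume "\<not> (fits (val q) (val ?W) \<and> 1 + sum_list (map (tab s2) (pieces w q ?W)) \<le> tab s2 q)"
        then have "\<not> P w ?W" unfolding P_def T2 by blast
        then show "?Inv s2 \<and> ?le s2 s2 \<and> (P w ?W \<longrightarrow> imem s2 ''found'' 0 = 1) \<and> (\<forall>v\<in>set ?vs. imem s2 v 0 = imem s1 v 0)"
          using I2 v2 by blast
      }
      assume "imem s2 ''found'' 0 > 0"
      then have "imem s2 ''found'' 0 = 1" using I2 by auto
      then show "?Inv s2 \<and> ?le s2 s2 \<and> (P w ?W \<longrightarrow> imem s2 ''found'' 0 = 1) \<and> (\<forall>v\<in>set ?vs. imem s2 v 0 = imem s1 v 0)"
        using I2 v2 by blast
    qed (use q W in auto)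
    show "runs N (Seq (attempt True) (attempt False)) s1 ?G"
    proof (rule runs_Seq, rule runs_conseq[OF att[OF I]])
      show "\<forall>v\<in>set ?vs. imem s1 v 0 = imem s1 v 0" by simp
      fix s2 assume 2: "?Inv s2 \<and> ?le s1 s2 \<and> (P True ?W \<longrightarrow> imem s2 ''found'' 0 = 1) \<and> (\<forall>v\<in>set ?vs. imem s2 v 0 = imem s1 v 0)"
      show "runs N (attempt False) s2 ?G"
      proof (rule runs_conseq[OF att])
        show "?Inv s2" "\<forall>v\<in>set ?vs. imem s2 v 0 = imem s1 v 0" using 2 by blast+
        fix s3 assume 3: "?Inv s3 \<and> ?le s2 s3 \<and> (P False ?W \<longrightarrow> imem s3 ''found'' 0 = 1) \<and> (\<forall>v\<in>set ?vs. imem s3 v 0 = imem s1 v 0)"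
        have f: "P True ?W \<Longrightarrow> imem s2 ''found'' 0 = 1" "imem s2 ''found'' 0 = 1 \<Longrightarrow> imem s3 ''found'' 0 = 1"
          "P False ?W \<Longrightarrow> imem s3 ''found'' 0 = 1" using 2 3 by blast+
        have "imem s3 ''found'' 0 = 1" if "P w ?W" for w
          using f that by (cases w) auto
        then have "?Post xs s3" using xW by metis
        then show "?G s3" using 2 3 by blast
      qed
    qed
  next
    fix s' assume I: "?Inv s'" and post: "\<And>xs. length xs = length ?vs \<Longrightarrow> set xs \<subseteq> {..<M} \<Longrightarrow> ?Post xs s'"
    obtain w W where W: "P w W" using ex unfolding P_def by blast
    obtain a b c d where w: "W = (a, b, c, d)" by (cases W)
    have "?Post [a, b, c, d] s'" by (rule post) (use W in \<open>auto simp: P_def R_def w\<close>)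
    then have "imem s' ''found'' 0 = 1" using W by (auto simp: w)
    then obtain w' W' where "P w' W'" "stack s' = stack s @ pieces w' q W'" using I by auto
    moreover have F: "frame ?A {} s s'" using I by blast
    ultimately show "Q s'" using FrD[OF F] unfolding P_def by (intro fin) blast+
  qed (use bounds in auto)
qed

lemma runs_pop:
  assumes "stack s \<noteq> []"
    and fin: "\<And>s'. frame {''sp'', ''a'', ''b'', ''c'', ''d''} {} s s' \<Longrightarrow> stack s' = butlast (stack s) \<Longrightarrow> quad_of s' vq = last (stack s) \<Longrightarrow> Q s'"
  shows "runs N pop s Q"
  unfolding pop_def
proof (intro runs_Seq runs_IAssign, rule fin)
  have "imem s ''sp'' 0 > 0" using assms(1) by (auto simp: stack_def)
  then obtain k where k: "imem s ''sp'' 0 = Suc k" by (cases "imem s ''sp'' 0") auto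
  let ?s1 = "iupdate ''sp'' (ival (INum 0) s) (ival (ISub (V ''sp'') (INum 1)) s) s"
  let ?s2 = "iupdate ''a'' (ival (INum 0) ?s1) (ival (ICell ''sa'' (V ''sp'')) ?s1) ?s1"
  let ?s3 = "iupdate ''b'' (ival (INum 0) ?s2) (ival (ICell ''sb'' (V ''sp'')) ?s2) ?s2"
  let ?s4 = "iupdate ''c'' (ival (INum 0) ?s3) (ival (ICell ''sc'' (V ''sp'')) ?s3) ?s3"
  let ?s5 = "iupdate ''d'' (ival (INum 0) ?s4) (ival (ICell ''sd'' (V ''sp'')) ?s4) ?s4"
  show "frame {''sp'', ''a'', ''b'', ''c'', ''d''} {} s ?s5" by simp
  show "stack ?s5 = butlast (stack s)" by (simp add: stack_def k)
  show "quad_of ?s5 vq = last (stack s)" by (simp add: stack_def k quad_of_simps)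
qed

lemma runs_emit:
  assumes s: "env s" "quad_of s vq = q" "q \<in> R"
    and fin: "\<And>s'. env s' \<Longrightarrow> tab s' = tab s \<Longrightarrow> stack s' = stack s \<Longrightarrow>
      boxes s' = boxes s @ (if proper (val q) then [val q] else []) \<Longrightarrow> Q s'"
  shows "runs N emit s Q"
  unfolding emit_def
proof (rule runs_If)
  have p: "bval (proper_exp vq) s = proper (val q)" using bval_propere[OF s(1), of vq] s by simp
  have g: "val q = (rmem s ''gx'' (imem s ''a'' 0), rmem s ''gx'' (imem s ''b'' 0),
      rmem s ''gy'' (imem s ''c'' 0), rmem s ''gy'' (imem s ''d'' 0))"
    using s by (auto simp: env_def R_def val_def quad_of_simps)
  {
    assume b: "bval (proper_exp vq) s"
    show "runs N (Seq (RAssign ''x1'' (V ''m'') (gx ''a'')) (Seq (RAssign ''x2'' (V ''m'') (gx ''b''))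
     (Seq (RAssign ''y1'' (V ''m'') (gy ''c'')) (Seq (RAssign ''y2'' (V ''m'') (gy ''d''))
       (IAssign ''m'' (INum 0) (IAdd (V ''m'') (INum 1))))))) s Q"
      by (intro runs_Seq runs_RAssign runs_IAssign, rule fin) (use s p b in \<open>simp_all add: boxes_def g\<close>)
  }
  assume "\<not> bval (proper_exp vq) s"
  then show "runs N Skip s Q" using s p by (intro runs_Skip fin) simp_all
qed

text \<open>The sum of the entries on the stack is a potential: a split lowers it by at least 1
  because its own unit is spent, and so does the removal of a leaf. It bounds the number of
  iterations and, together with the boxes already emitted, the size of the output.\<close>

lemma runs_harvest:
  assumes s: "env s" and T: "sound (tab s)" and st: "stack s = [q0]" "boxes s = []"
    and q0: "q0 \<in> R" "tab s q0 \<le> lim"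
    and avoid: "\<And>p. p \<in> P \<Longrightarrow> in_quad p (val q0) \<and> fst p \<notin> lx ` {..<M} \<and> snd p \<notin> ly ` {..<M}"
    and fin: "\<And>s'. length (boxes s') \<le> tab s q0 \<Longrightarrow> sorted_wrt apart (boxes s') \<Longrightarrow>
      (\<And>Q. Q \<in> set (boxes s') \<Longrightarrow> proper Q \<and> (\<exists>q\<in>R. leaf_ok q \<and> Q = val q)) \<Longrightarrow>
      (\<And>p. p \<in> P \<Longrightarrow> \<exists>Q\<in>set (boxes s'). in_quad p Q) \<Longrightarrow> Q s'"
  shows "runs N harvest s Q"
  unfolding harvest_def
proof -
  define T0 where "T0 = tab s"
  note T = T[folded T0_def] and q0 = q0[folded T0_def]
  have T1: "1 \<le> T0 q" if "q \<in> R" for q using T that unfolding sound_def by blast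
  define J where "J s' \<longleftrightarrow> env s' \<and> tab s' = T0 \<and> (\<forall>q\<in>set (stack s'). q \<in> R \<and> T0 q \<le> lim) \<and>
    length (boxes s') + sum_list (map T0 (stack s')) \<le> T0 q0 \<and>
    sorted_wrt apart (map val (stack s') @ boxes s') \<and>
    (\<forall>Q\<in>set (boxes s'). proper Q \<and> (\<exists>q\<in>R. leaf_ok q \<and> Q = val q)) \<and>
    (\<forall>p\<in>P. \<exists>Q\<in>set (map val (stack s') @ boxes s'). in_quad p Q)" for s'
  show "runs N (While (ILess (INum 0) (V ''sp'')) (Seq pop emit_or_split)) s Q"
  proof (rule runs_While[where J = J and \<mu> = "\<lambda>s'. sum_list (map T0 (stack s'))"])
    show "J s" using s st q0 avoid by (simp add: J_def T0_def)
    show "sum_list (map T0 (stack s)) \<le> N" using st q0 bounds by simp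
    show "Q s'" if J: "J s'" and b: "\<not> bval (ILess (INum 0) (V ''sp'')) s'" for s'
    proof -
      have "stack s' = []" using b by (simp add: stack_def)
      then show ?thesis using J by (intro fin) (auto simp: J_def T0_def)
    qed
    fix s1 assume J: "J s1" and b: "bval (ILess (INum 0) (V ''sp'')) s1"
    then have ne: "stack s1 \<noteq> []" by (simp add: stack_def)
    define rest q where "rest = butlast (stack s1)" and "q = last (stack s1)"
    have stk1: "stack s1 = rest @ [q]" using ne by (simp add: rest_def q_def)
    have q: "q \<in> R" "T0 q \<le> lim" using J by (auto simp: J_def stk1)
    let ?G = "\<lambda>s'. J s' \<and> sum_list (map T0 (stack s')) < sum_list (map T0 (stack s1))"
    show "runs N (Seq pop emit_or_split) s1 ?G"
    proof (rule runs_Seq, rule runs_pop[OF ne])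
      fix s2 assume 2: "frame {''sp'', ''a'', ''b'', ''c'', ''d''} {} s1 s2" "stack s2 = butlast (stack s1)" "quad_of s2 vq = last (stack s1)"
      have e2: "env s2" "tab s2 = T0" "boxes s2 = boxes s1" "stack s2 = rest" "quad_of s2 vq = q"
        using env_Fr[OF 2(1)] tab_Fr[OF 2(1)] boxes_Fr[OF 2(1)] 2(2,3) J by (simp_all add: J_def rest_def q_def)
      have table_exp: "ival (table_exp vq) s2 = T0 q" using ival_Te[OF e2(1), of vq] e2 q by simp
      have ap: "sorted_wrt apart (map val rest)" "sorted_wrt apart (boxes s1)"
        "\<And>r Q. r \<in> set rest \<Longrightarrow> Q \<in> set (boxes s1) \<Longrightarrow> apart (val r) Q"
        "\<And>r. r \<in> set rest \<Longrightarrow> apart (val r) (val q)" "\<And>Q. Q \<in> set (boxes s1) \<Longrightarrow> apart (val q) Q"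
        using J by (auto simp: J_def stk1 sorted_wrt_append)
      show "runs N emit_or_split s2 ?G" unfolding emit_or_split_def
      proof (rule runs_If)
        assume "bval (ILess (table_exp vq) (INum 2)) s2"
        then have lt: "T0 q < 2" using table_exp by simp
        \<comment> \<open>A split would leave nothing for its pieces, whose entries are at least 1;
          only the leaf case of \<open>sound\<close> remains.\<close>
        have lfq: "leaf_ok q"
        proof (rule ccontr)
          assume "\<not> leaf_ok q"
          then obtain w W where W: "W \<in> R" "1 + sum_list (map T0 (pieces w q W)) \<le> T0 q"
            using T q unfolding sound_def by blast
          then have "sum_list (map T0 (pieces w q W)) = 0" using lt by linarith
          then have z: "\<forall>K\<in>set (pieces w q W). T0 K = 0" by simp
          obtain K where K: "K \<in> set (pieces w q W)"
            by (cases w; cases q; cases W) (auto simp: pieces_def)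
          then show False using z T1[OF pieces_R[OF q(1) W(1) K]] by auto
        qed
        show "runs N emit s2 ?G"
        proof (rule runs_emit[OF e2(1,5) q(1)])
          fix s3 assume 3: "env s3" "tab s3 = tab s2" "stack s3 = stack s2"
            "boxes s3 = boxes s2 @ (if proper (val q) then [val q] else [])"
          have "J s3" unfolding J_def
          proof (intro conjI)
            show "env s3" "tab s3 = T0" using 3 e2 by simp_all
            show "\<forall>q\<in>set (stack s3). q \<in> R \<and> T0 q \<le> lim" using J by (simp add: J_def 3 e2 stk1)
            show "length (boxes s3) + sum_list (map T0 (stack s3)) \<le> T0 q0"
              using J T1[OF q(1)] by (simp add: J_def 3 e2 stk1)
            show "sorted_wrt apart (map val (stack s3) @ boxes s3)"
              using ap by (auto simp: 3 e2 sorted_wrt_append intro: apart_sym)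
            show "\<forall>Q\<in>set (boxes s3). proper Q \<and> (\<exists>q\<in>R. leaf_ok q \<and> Q = val q)"
              using J q lfq by (auto simp: J_def 3 e2)
            show "\<forall>p\<in>P. \<exists>Q\<in>set (map val (stack s3) @ boxes s3). in_quad p Q"
            proof
              fix p assume "p \<in> P"
              then obtain Q where Q: "Q \<in> set (map val (stack s1) @ boxes s1)" "in_quad p Q" using J unfolding J_def by blast
              \<comment> \<open>Only degenerate rectangles are suppressed, and these contain no
                point in their interior.\<close>
              have "proper (val q)" if "in_quad p (val q)" using that by (cases "val q") auto
              then show "\<exists>Q\<in>set (map val (stack s3) @ boxes s3). in_quad p Q"
                using Q by (auto simp: 3 e2 stk1)
            qed
          qed
          moreover have "sum_list (map T0 (stack s3)) < sum_list (map T0 (stack s1))"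
            using T1[OF q(1)] by (simp add: 3 e2 stk1)
          ultimately show "?G s3" by blast
        qed
      next
        assume "\<not> bval (ILess (table_exp vq) (INum 2)) s2"
        then have ge: "2 \<le> T0 q" using table_exp by simp
        then have ex: "\<exists>w. \<exists>W\<in>R. fits (val q) (val W) \<and> 1 + sum_list (map T0 (pieces w q W)) \<le> T0 q"
          using T q unfolding sound_def by fastforce
        let ?s = "iupdate ''found'' (ival (INum 0) s2) (ival (INum 0) s2) s2"
        have e: "env ?s" "tab ?s = T0" "boxes ?s = boxes s1" "stack ?s = rest" "quad_of ?s vq = q" "imem ?s ''found'' 0 = 0"
          using e2 by simp_all
        show "runs N (Seq (IAssign ''found'' (INum 0) (INum 0))
          search) s2 ?G"
        proof (rule runs_Seq, rule runs_IAssign, rule runs_search[OF e(1,5) q(1) e(6)])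
          show "\<exists>w. \<exists>W\<in>R. fits (val q) (val W) \<and> 1 + sum_list (map (tab ?s) (pieces w q W)) \<le> tab ?s q"
            unfolding e(2) by (rule ex)
          fix s3 w W assume 3: "env s3" "tab s3 = tab ?s" "boxes s3 = boxes ?s" and W: "W \<in> R" "fits (val q) (val W)"
            and le: "1 + sum_list (map (tab ?s) (pieces w q W)) \<le> tab ?s q" and stk3: "stack s3 = stack ?s @ pieces w q W"
          note le = le[unfolded e(2)] and stk3 = stk3[unfolded e(4)] and 3 = 3[unfolded e]
          have vk: "map val (pieces w q W) = pieces w (val q) (val W)" by (rule pieces_val)
          have vK: "val K \<in> set (pieces w (val q) (val W))" if "K \<in> set (pieces w q W)" for K
            using that unfolding vk[symmetric] by simp
          have apk: "apart Q (val K)" if "apart Q (val q)" "K \<in> set (pieces w q W)" for Q K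
            by (rule apart_kid[OF W(2) vK[OF that(2)] that(1)])
          have "J s3" unfolding J_def
          proof (intro conjI)
            show "env s3" "tab s3 = T0" using 3 by simp_all
            show "\<forall>q\<in>set (stack s3). q \<in> R \<and> T0 q \<le> lim"
            proof
              fix K assume K: "K \<in> set (stack s3)"
              show "K \<in> R \<and> T0 K \<le> lim"
              proof (cases "K \<in> set rest")
                case True
                then show ?thesis using J by (simp add: J_def stk1)
              next
                case False
                then have K': "K \<in> set (pieces w q W)" using K by (simp add: stk3)
                then have "T0 K \<le> sum_list (map T0 (pieces w q W))" by (simp add: member_le_sum_list)
                then show ?thesis using pieces_R[OF q(1) W(1) K'] le q(2) by simp
              qed
            qed
            show "length (boxes s3) + sum_list (map T0 (stack s3)) \<le> T0 q0"
              using J le by (simp add: J_def 3 stk1 stk3)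
            have srt: "sorted_wrt apart (map val (pieces w q W))" unfolding vk by (rule pieces_apart[OF W(2)])
            show "sorted_wrt apart (map val (stack s3) @ boxes s3)"
            proof -
              have "apart (val r) (val K)" if "r \<in> set rest" "K \<in> set (pieces w q W)" for r K
                using apk[OF ap(4)[OF that(1)] that(2)] .
              moreover have "apart (val K) Q" if "Q \<in> set (boxes s1)" "K \<in> set (pieces w q W)" for Q K
                using apart_sym[OF apk[OF apart_sym[OF ap(5)[OF that(1)]] that(2)]] .
              ultimately show ?thesis
                using ap srt by (simp add: 3 stk3 sorted_wrt_append ball_Un del: split_paired_All split_paired_Ball_Sigma apart.simps) 
            qed
            show "\<forall>Q\<in>set (boxes s3). proper Q \<and> (\<exists>q\<in>R. leaf_ok q \<and> Q = val q)"
              using J by (simp add: J_def 3)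
            show "\<forall>p\<in>P. \<exists>Q\<in>set (map val (stack s3) @ boxes s3). in_quad p Q"
            proof
              fix p assume p: "p \<in> P"
              then obtain Q where Q: "Q \<in> set (map val (stack s1) @ boxes s1)" "in_quad p Q" using J unfolding J_def by blast
              show "\<exists>Q\<in>set (map val (stack s3) @ boxes s3). in_quad p Q"
              proof (cases "Q = val q")
                case True
                have "val W \<in> lx ` {..<M} \<times> lx ` {..<M} \<times> ly ` {..<M} \<times> ly ` {..<M}"
                  using W(1) by (cases W) (auto simp: R_def val_def)
                then have "\<exists>K\<in>set (pieces w (val q) (val W)). in_quad p K"
                  using Q(2) True avoid[OF p] by (intro pin_kid[OF W(2)]) auto
                then show ?thesis unfolding vk[symmetric] by (auto simp: stk3)
              next
                case False
                then show ?thesis using Q by (auto simp: stk1 stk3 3)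
              qed
            qed
          qed
          moreover have "sum_list (map T0 (stack s3)) < sum_list (map T0 (stack s1))"
            using le by (simp add: stk1 stk3)
          ultimately show "?G s3" by blast
        qed
      qed
    qed
  qed
qed

end

section \<open>The complete program and its correctness\<close>

definition make_multiples :: com where
  "make_multiples = Seq (multiples ''P1'' (V ''M''))
     (Seq (multiples ''P2'' (ICell ''P1'' (V ''M''))) (multiples ''P3'' (ICell ''P2'' (V ''M''))))"

text \<open>The limit 1196 (n + 1) exceeds 6 + 1190 n, the cost guaranteed by
  \<open>tiling_points\<close>. It is also at least \<open>n + 1\<close>, so it can serve as the
  common bound for all loops.\<close>

definition setup_table :: com where
  "setup_table = Seq (IAssign ''M'' (INum 0) (IAdd (V ''n'') (INum 1))) (Seq (IAssign ''lim'' (INum 0) (imul 1196 (V ''M'')))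
     (Seq (make_lines ''x'' ''gx'') (Seq (make_lines ''y'' ''gy'') make_multiples)))"

text \<open>The root must contain all points. Its lower lines have the index n in both directions,
  while the upper ones have to be searched because the lines are not sorted.\<close>

definition push_root :: com where
  "push_root = Seq (IAssign ''b'' (INum 0) (INum 0)) (Seq (max_loop ''gx'' ''b'')
     (Seq (IAssign ''d'' (INum 0) (INum 0)) (Seq (max_loop ''gy'' ''d'')
     (Seq (IAssign ''a'' (INum 0) (V ''n'')) (Seq (IAssign ''c'' (INum 0) (V ''n''))
     (Seq (IAssign ''sp'' (INum 0) (INum 0)) (Seq (IAssign ''m'' (INum 0) (INum 0)) (push vq))))))))"

definition sbcc_prog :: com where
  "sbcc_prog = Seq setup_table (Seq init (Seq rounds (Seq push_root harvest)))"

lemma runs_setup_table: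
  assumes nN: "imem s ''n'' 0 = n" "Suc n \<le> N"
    and x: "rmem s ''x'' = x" "rmem s ''y'' = y" "imem s ''color'' = cl"
    and fin: "\<And>s'. table.env n (Suc n) (1196 * Suc n) x y (line x n) (line y n) cl s' \<Longrightarrow> Q s'"
  shows "runs N setup_table s Q"
  unfolding setup_table_def
proof (rule runs_Seq, rule runs_IAssign, rule runs_Seq, rule runs_IAssign, rule runs_Seq)
  let ?s0 = "iupdate ''M'' (ival (INum 0) s) (ival (IAdd (V ''n'') (INum 1)) s) s"
  let ?s = "iupdate ''lim'' (ival (INum 0) ?s0) (ival (imul 1196 (V ''M'')) ?s0) ?s0"
  have s0: "imem ?s ''n'' 0 = n" "imem ?s ''M'' 0 = Suc n" "imem ?s ''lim'' 0 = 1196 * Suc n"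
    "rmem ?s ''x'' = x" "rmem ?s ''y'' = y" "imem ?s ''color'' = cl"
    using nN x by (simp_all add: ival_imul del: mult_Suc_right)
  show "runs N (make_lines ''x'' ''gx'') ?s (\<lambda>s'. runs N (Seq (make_lines ''y'' ''gy'') make_multiples) s' Q)"
  proof (rule runs_make_lines[OF s0(1)])
    fix s1 assume 1: "frame {''i'', ''j''} {''gx''} ?s s1" "\<And>i. i < Suc n \<Longrightarrow> rmem s1 ''gx'' i = line (rmem ?s ''x'') n i"
    have s1: "imem s1 ''n'' 0 = n" "imem s1 ''M'' 0 = Suc n" "imem s1 ''lim'' 0 = 1196 * Suc n"
      "rmem s1 ''x'' = x" "rmem s1 ''y'' = y" "imem s1 ''color'' = cl"
      using frame_imem[OF 1(1)] frame_rmem[OF 1(1)] s0 by (simp_all only: insert_iff empty_iff) simp_all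
    show "runs N (Seq (make_lines ''y'' ''gy'') make_multiples) s1 Q"
    proof (rule runs_Seq, rule runs_make_lines[OF s1(1)])
      fix s2 assume 2: "frame {''i'', ''j''} {''gy''} s1 s2" "\<And>i. i < Suc n \<Longrightarrow> rmem s2 ''gy'' i = line (rmem s1 ''y'') n i"
      have s2: "imem s2 ''n'' 0 = n" "imem s2 ''M'' 0 = Suc n" "imem s2 ''lim'' 0 = 1196 * Suc n"
        "rmem s2 ''x'' = x" "rmem s2 ''y'' = y" "imem s2 ''color'' = cl" "rmem s2 ''gx'' = rmem s1 ''gx''"
        using frame_imem[OF 2(1)] frame_rmem[OF 2(1)] s1 by (simp_all only: insert_iff empty_iff) simp_all
      have g2: "rmem s1 ''gx'' i = line x n i" "rmem s2 ''gy'' i = line y n i" if "i < Suc n" for i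
        using 1(2)[OF that] 2(2)[OF that] s0(4) s1(5) by simp_all
      show "runs N make_multiples s2 Q"
        unfolding make_multiples_def
      proof (rule runs_Seq, rule runs_multiples[OF s2(2) nN(2), where v = "Suc n"])
        show "ival (V ''M'') s' = Suc n" if "frame {''i'', ''P1''} {} s2 s'" for s'
          using frame_imem[OF that, of "''M''"] s2 by simp
        fix s3 assume 3: "frame {''i'', ''P1''} {} s2 s3" "\<forall>i\<le>Suc n. imem s3 ''P1'' i = i * Suc n"
        have M3: "imem s3 ''M'' 0 = Suc n" using frame_imem[OF 3(1), of "''M''"] s2 by simp
        show "runs N (Seq (multiples ''P2'' (ICell ''P1'' (V ''M''))) (multiples ''P3'' (ICell ''P2'' (V ''M'')))) s3 Q"
        proof (rule runs_Seq, rule runs_multiples[OF M3 nN(2), where v = "Suc n * Suc n"])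
          show "ival (ICell ''P1'' (V ''M'')) s' = Suc n * Suc n" if "frame {''i'', ''P2''} {} s3 s'" for s'
            using frame_imem[OF that, of "''M''"] frame_imem[OF that, of "''P1''"] M3 3(2) by simp
          fix s4 assume 4: "frame {''i'', ''P2''} {} s3 s4" "\<forall>i\<le>Suc n. imem s4 ''P2'' i = i * (Suc n * Suc n)"
          have M4: "imem s4 ''M'' 0 = Suc n" using frame_imem[OF 4(1), of "''M''"] M3 by simp
          show "runs N (multiples ''P3'' (ICell ''P2'' (V ''M''))) s4 Q"
          proof (rule runs_multiples[OF M4 nN(2), where v = "Suc n * (Suc n * Suc n)"])
            show "ival (ICell ''P2'' (V ''M'')) s' = Suc n * (Suc n * Suc n)" if "frame {''i'', ''P3''} {} s4 s'" for s'
              using frame_imem[OF that, of "''M''"] frame_imem[OF that, of "''P2''"] M4 4(2) by simp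
            fix s5 assume 5: "frame {''i'', ''P3''} {} s4 s5" "\<forall>i\<le>Suc n. imem s5 ''P3'' i = i * (Suc n * (Suc n * Suc n))"
            have i5: "imem s5 v = imem s2 v" if "v \<noteq> ''i''" "v \<noteq> ''P1''" "v \<noteq> ''P2''" "v \<noteq> ''P3''" for v
              using frame_imem[OF 3(1), of v] frame_imem[OF 4(1), of v] frame_imem[OF 5(1), of v] that by simp
            have P5: "imem s5 ''P1'' = imem s3 ''P1''" "imem s5 ''P2'' = imem s4 ''P2''"
              using frame_imem[OF 4(1), of "''P1''"] frame_imem[OF 5(1), of "''P1''"] frame_imem[OF 5(1), of "''P2''"] by simp_all
            have r5: "rmem s5 v = rmem s2 v" for v
              using frame_rmem[OF 3(1), of v] frame_rmem[OF 4(1), of v] frame_rmem[OF 5(1), of v] by simp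
            interpret table n "Suc n" "1196 * Suc n" "1196 * Suc n" x y "line x n" "line y n" cl
              by unfold_locales simp_all
            show "Q s5"
              by (rule fin) (unfold env_def, intro conjI allI impI,
                simp_all only: i5 P5 r5 s2 g2 3(2) 4(2) 5(2), simp_all add: i5 s2 del: mult_Suc mult_Suc_right)
          qed simp
        qed simp
      qed simp
    qed (use nN in simp_all)
  qed (use nN in simp_all)
qed

context table
begin

lemma runs_push_root:
  assumes s: "env s" and M: "M = Suc n"
    and fin: "\<And>s' u v. env s' \<Longrightarrow> tab s' = tab s \<Longrightarrow> stack s' = [(n, u, n, v)] \<Longrightarrow> boxes s' = [] \<Longrightarrow> u < M \<Longrightarrow> v < M \<Longrightarrow>
      (\<And>i. i < M \<Longrightarrow> lx i \<le> lx u) \<Longrightarrow> (\<And>i. i < M \<Longrightarrow> ly i \<le> ly v) \<Longrightarrow> Q s'"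
  shows "runs N push_root s Q"
  unfolding push_root_def
proof (rule runs_Seq, rule runs_IAssign, rule runs_Seq)
  let ?s0 = "iupdate ''b'' (ival (INum 0) s) (ival (INum 0) s) s"
  let ?rest = "Seq (IAssign ''a'' (INum 0) (V ''n'')) (Seq (IAssign ''c'' (INum 0) (V ''n''))
     (Seq (IAssign ''sp'' (INum 0) (INum 0)) (Seq (IAssign ''m'' (INum 0) (INum 0)) (push vq))))"
  have e0: "env ?s0" "tab ?s0 = tab s" using s by simp_all
  show "runs N (max_loop ''gx'' ''b'') ?s0 (\<lambda>s'. runs N (Seq (IAssign ''d'' (INum 0) (INum 0)) (Seq (max_loop ''gy'' ''d'') ?rest)) s' Q)"
  proof (rule runs_max_loop[where M = M])
    show "imem ?s0 ''M'' 0 = M" using e0(1) by (simp add: env_def)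
    fix s1 assume 1: "frame {''i'', ''b''} {} ?s0 s1" "imem s1 ''b'' 0 < M"
      "\<And>i. i < M \<Longrightarrow> rmem ?s0 ''gx'' i \<le> rmem ?s0 ''gx'' (imem s1 ''b'' 0)"
    have e1: "env s1" "tab s1 = tab s" using env_Fr[OF 1(1)] tab_Fr[OF 1(1)] e0 by simp_all
    have u: "lx i \<le> lx (imem s1 ''b'' 0)" if "i < M" for i
      using 1(2) 1(3)[OF that] s that by (simp add: env_def)
    let ?s2 = "iupdate ''d'' (ival (INum 0) s1) (ival (INum 0) s1) s1"
    have e2: "env ?s2" "tab ?s2 = tab s" using e1 by simp_all
    show "runs N (Seq (IAssign ''d'' (INum 0) (INum 0)) (Seq (max_loop ''gy'' ''d'') ?rest)) s1 Q"
    proof (rule runs_Seq, rule runs_IAssign, rule runs_Seq, rule runs_max_loop[where M = M])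
      show "imem ?s2 ''M'' 0 = M" using e2(1) by (simp add: env_def)
      fix s3 assume 3: "frame {''i'', ''d''} {} ?s2 s3" "imem s3 ''d'' 0 < M"
        "\<And>i. i < M \<Longrightarrow> rmem ?s2 ''gy'' i \<le> rmem ?s2 ''gy'' (imem s3 ''d'' 0)"
      have e3: "env s3" "tab s3 = tab s" using env_Fr[OF 3(1)] tab_Fr[OF 3(1)] e2 by simp_all
      have b3: "imem s3 ''b'' 0 = imem s1 ''b'' 0" using frame_imem[OF 3(1), of "''b''"] by simp
      have v: "ly i \<le> ly (imem s3 ''d'' 0)" if "i < M" for i
        using 3(2) 3(3)[OF that] e1(1) that by (simp add: env_def)
      let ?s4 = "iupdate ''a'' (ival (INum 0) s3) (ival (V ''n'') s3) s3"
      let ?s5 = "iupdate ''c'' (ival (INum 0) ?s4) (ival (V ''n'') ?s4) ?s4"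
      let ?s6 = "iupdate ''sp'' (ival (INum 0) ?s5) (ival (INum 0) ?s5) ?s5"
      let ?s7 = "iupdate ''m'' (ival (INum 0) ?s6) (ival (INum 0) ?s6) ?s6"
      have n3: "imem s3 ''n'' 0 = n" using e3(1) by (simp add: env_def)
      have e7: "env ?s7" "tab ?s7 = tab s" "stack ?s7 = []" "boxes ?s7 = []"
        using e3 by (simp_all add: stack_def boxes_def)
      have q7: "quad_of ?s7 vq = (n, imem s1 ''b'' 0, n, imem s3 ''d'' 0)"
        by (simp add: quad_of_simps n3 b3)
      show "runs N ?rest s3 Q"
      proof (rule runs_Seq, rule runs_IAssign, rule runs_Seq, rule runs_IAssign, rule runs_Seq, rule runs_IAssign,
          rule runs_Seq, rule runs_IAssign, rule runs_push)
        fix s' assume p: "stack s' = stack ?s7 @ [quad_of ?s7 vq]" "frame stack_names {} ?s7 s'"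
        show "Q s'"
          by (rule fin[of s' "imem s1 ''b'' 0" "imem s3 ''d'' 0"])
            (use env_Fr[OF p(2)] tab_Fr[OF p(2)] boxes_Fr[OF p(2)] p(1) e7 q7 1(2) 3(2) u v in simp_all)
      qed simp
    qed (use bounds M in simp_all)
  qed (use bounds M in simp_all)
qed

end

lemma lines_avoid: "lines X G \<Longrightarrow> x \<in> X \<Longrightarrow> x \<notin> G"
  unfolding lines_def by (elim conjE) (rule notI, drule (1) IntI[rotated], simp)

lemma tiling_weaken:
  assumes "tiling ok GX GY Q n" "\<And>Q. ok Q \<Longrightarrow> ok' Q"
  shows "tiling ok' GX GY Q n"
  using assms(1)
proof induction
  case (leaf Q n)
  then show ?case using assms(2) by (blast intro: tiling.leaf)
next
  case (split Q W w f n)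
  then show ?case by (intro tiling.split[where W = W and w = w and f = f]) auto
qed

lemma sbcc_prog_correct:
  assumes S: "finite S" "set ps = S" and n: "n = length ps"
  shows "runs (1196 * Suc n) sbcc_prog (input_state ps col) (\<lambda>s. is_sbcc S col (output_boxes s) \<and>
    real (card (output_boxes s)) \<le> 1196 * real (min_sbcc_size S col))"
proof -
  let ?s = "input_state ps col"
  define x y cl where "x = rmem ?s ''x''" and "y = rmem ?s ''y''" and "cl = imem ?s ''color''"
  have xy: "x i = fst (ps ! i)" "y i = snd (ps ! i)" "cl i = (case col (ps ! i) of Red \<Rightarrow> 0 | Blue \<Rightarrow> 1)" if "i < n" for i
    using that by (simp_all add: x_def y_def cl_def input_state_def n)
  have S_nth: "S = (!) ps ` {..<n}" unfolding S(2)[symmetric] n by (auto simp: set_conv_nth)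
  have imgs: "x ` {..<n} = fst ` S" "y ` {..<n} = snd ` S"
    unfolding S_nth image_image using xy(1,2) by (auto intro!: image_cong)
  interpret table n "Suc n" "1196 * Suc n" "1196 * Suc n" x y "line x n" "line y n" cl
    by unfold_locales simp_all
  let ?GX = "line x n ` {..<Suc n}" and ?GY = "line y n ` {..<Suc n}"
  have lines: "lines (fst ` S) ?GX" "lines (snd ` S) ?GY"
    using lines_line[of x n] lines_line[of y n] imgs by simp_all
  have cl: "cl i < cl j \<longleftrightarrow> col (ps ! i) = Red \<and> col (ps ! j) = Blue" if "i < n" "j < n" for i j
    using xy(3)[OF that(1)] xy(3)[OF that(2)] by (auto split: color.splits)
  have point_inside: "point_inside i q \<longleftrightarrow> in_quad (ps ! i) (val q)" if "i < n" for i q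
    using xy(1,2)[OF that] by (simp add: point_inside_def)
  have leaf_ok: "leaf_ok q \<longleftrightarrow> monochromatic S col (val q)" for q
  proof
    assume l: "leaf_ok q"
    show "monochromatic S col (val q)"
      unfolding monochromatic_def
    proof (intro ballI impI)
      fix p p' assume p: "p \<in> S" "p' \<in> S" "in_quad p (val q) \<and> in_quad p' (val q)"
      obtain i j where ij: "i < n" "j < n" "p = ps ! i" "p' = ps ! j"
        using p unfolding S_nth by blast
      have "\<not> cl i < cl j" "\<not> cl j < cl i" using l p(3) ij point_inside unfolding leaf_ok_def by blast+
      then show "col p = col p'" using cl ij by (cases "col p"; cases "col p'") auto
    qed
  next
    assume "monochromatic S col (val q)"
    then have *: "col (ps ! i) = col (ps ! j)" if "i < n" "j < n" "point_inside i q" "point_inside j q" for i j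
      using that point_inside unfolding monochromatic_def S_nth by blast
    show "leaf_ok q" unfolding leaf_ok_def
    proof (intro notI, elim exE conjE)
      fix i j assume "i < n" "j < n" "cl i < cl j" "point_inside i q" "point_inside j q"
      then show False using *[of i j] cl[of i j] by auto
    qed
  qed
  show ?thesis unfolding sbcc_prog_def
  proof (rule runs_Seq, rule runs_setup_table)
    show "imem ?s ''n'' 0 = n" by (simp add: input_state_def n)
    show "rmem ?s ''x'' = x" "rmem ?s ''y'' = y" "imem ?s ''color'' = cl" by (simp_all add: x_def y_def cl_def)
    fix s1 assume e1: "env s1"
    let ?P = "\<lambda>s. is_sbcc S col (output_boxes s) \<and> real (card (output_boxes s)) \<le> 1196 * real (min_sbcc_size S col)"
    show "runs (1196 * Suc n) (Seq init (Seq rounds (Seq push_root harvest))) s1 ?P"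
    proof (rule runs_Seq, rule runs_init[OF e1])
      fix s2 assume 2: "env s2" "\<And>q. q \<in> R \<Longrightarrow> tab s2 q = (if leaf_ok q then 1 else 1196 * Suc n + 1)"
      show "runs (1196 * Suc n) (Seq rounds (Seq push_root harvest)) s2 ?P"
      proof (rule runs_Seq, rule runs_rounds[OF 2])
        fix s3 assume 3: "env s3" "sound (tab s3)" "complete (1196 * Suc n) (tab s3)"
        show "runs (1196 * Suc n) (Seq push_root harvest) s3 ?P"
        proof (rule runs_Seq, rule runs_push_root[OF 3(1) refl])
          fix s4 u v assume 4: "env s4" "tab s4 = tab s3" "stack s4 = [(n, u, n, v)]" "boxes s4 = []" "u < Suc n" "v < Suc n"
            "\<And>i. i < Suc n \<Longrightarrow> line x n i \<le> line x n u" "\<And>i. i < Suc n \<Longrightarrow> line y n i \<le> line y n v"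
          let ?q = "(n, u, n, v)"
          have q: "?q \<in> R" using 4 by (simp add: R_def)
          have Q: "val ?q \<in> ?GX \<times> ?GX \<times> ?GY \<times> ?GY" using q by (auto simp: R_def val_def)
          have root: "tab s4 ?q \<le> c" if "c \<le> 1196 * Suc n" "tiling (monochromatic S col) ?GX ?GY (val ?q) c" for c
          proof -
            have "tiling (\<lambda>Q. \<forall>q\<in>R. val q = Q \<longrightarrow> leaf_ok q) ?GX ?GY (val ?q) c"
              by (rule tiling_weaken[OF that(2)]) (simp add: leaf_ok)
            then show ?thesis using 3(3) q that(1) unfolding complete_def 4(2) by blast
          qed
          have cS: "card S \<le> n" using S n card_length by metis
          have r0: "tab s4 ?q \<le> 6 + 1190 * card S"
            using tiling_points[OF S(1) lines Q] cS by (intro root) auto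
          \<comment> \<open>Completeness of the table ends at the limit, so a cover with more than
            \<open>n\<close> boxes is not treated by its own tiling; the bound from the points is
            then already the better one.\<close>
          have rB: "tab s4 ?q \<le> 6 + 1190 * card B" if "is_sbcc S col B" for B
          proof (cases "card B \<le> n")
            case True
            then show ?thesis using tiling_sbcc[OF S(1) lines Q that] by (intro root) auto
          next
            case False
            then show ?thesis using r0 cS by linarith
          qed
          show "runs (1196 * Suc n) harvest s4 ?P"
          proof (rule runs_harvest[OF 4(1) _ 4(3,4) q, where P = S])
            show "sound (tab s4)" using 3(2) 4(2) by simp
            have "6 + 1190 * card S \<le> 1196 * Suc n" using cS by simp
            with r0 show "tab s4 ?q \<le> 1196 * Suc n" by (rule order_trans)
            show "in_quad p (val ?q) \<and> fst p \<notin> ?GX \<and> snd p \<notin> ?GY" if p: "p \<in> S" for p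
            proof (intro conjI)
              show "fst p \<notin> ?GX" by (rule lines_avoid[OF lines(1) imageI[OF p]])
              show "snd p \<notin> ?GY" by (rule lines_avoid[OF lines(2) imageI[OF p]])
              obtain i where i: "i < n" "p = ps ! i" using p unfolding S_nth by blast
              have "line x n n < x i" "line y n n < y i" using low_line_less i(1) by (simp_all add: line_def)
              moreover have "x i < line x n i" "y i < line y n i" using next_line_gt i(1) by (simp_all add: line_def)
              moreover have "line x n i \<le> line x n u" "line y n i \<le> line y n v" using 4(7,8) i(1) by simp_all
              ultimately show "in_quad p (val ?q)" using xy[OF i(1)] i(2) by (simp add: val_def)
            qed
            fix s5 assume 5: "length (boxes s5) \<le> tab s4 ?q" "sorted_wrt apart (boxes s5)"
              "\<And>Q. Q \<in> set (boxes s5) \<Longrightarrow> proper Q \<and> (\<exists>q\<in>R. leaf_ok q \<and> Q = val q)"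
              "\<And>p. p \<in> S \<Longrightarrow> \<exists>Q\<in>set (boxes s5). in_quad p Q"
            have out: "output_boxes s5 = qbox ` set (boxes s5)"
              by (simp add: output_boxes_def boxes_def image_image lessThan_atLeast0)
            have sb: "is_sbcc S col (output_boxes s5)"
              unfolding out by (rule sbcc_of_quads[OF 5(2) _ 5(4)]) (use 5(3) leaf_ok in blast)+
            \<comment> \<open>The output itself shows that an SBCC exists, so the minimum is
              attained by some \<open>B\<close>.\<close>
            then have "\<exists>k B. is_sbcc S col B \<and> card B = k" by blast
            then have "\<exists>B. is_sbcc S col B \<and> card B = min_sbcc_size S col"
              unfolding min_sbcc_size_def by (rule LeastI_ex)
            then obtain B where B: "is_sbcc S col B" "card B = min_sbcc_size S col" by blast
            have "card (output_boxes s5) \<le> length (boxes s5)"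
              unfolding out by (metis card_image_le card_length finite_set le_trans)
            also have "\<dots> \<le> 6 + 1190 * card B" using 5(1) rB[OF B(1)] by simp
            finally have le: "card (output_boxes s5) \<le> 6 + 1190 * card B" .
            \<comment> \<open>One box of \<open>B\<close> absorbs the additive 6. Without points
              \<open>B\<close> may be empty, but then there is one line per direction, every
              rectangle is degenerate and nothing is output.\<close>
            have "card (output_boxes s5) \<le> 1196 * card B"
            proof (cases "S = {}")
              case True
              then have n0: "n = 0" using S n by simp
              have "boxes s5 = []"
              proof (rule ccontr)
                assume "boxes s5 \<noteq> []"
                then obtain Q where "Q \<in> set (boxes s5)" using hd_in_set by blast
                then obtain q where "proper (val q)" "q \<in> R" using 5(3) by blast
                then show False using n0 unfolding R_def val_def by (cases q) auto
              qed
              then show ?thesis by (simp add: out)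
            next
              case False
              have "B \<noteq> {}" using B(1) False unfolding is_sbcc_def by blast
              moreover have "finite B" using B(1) by (simp add: is_sbcc_def)
              ultimately have "card B \<noteq> 0" by simp
              then show ?thesis using le by linarith
            qed
            then have "real (card (output_boxes s5)) \<le> 1196 * real (card B)" by linarith
            then show "?P s5" using sb B(2) by simp
          qed
        qed
      qed
    qed
  qed simp
qed

theorem theorem22:
  "\<exists>(C::real) (prog::com) (p::nat poly). C \<ge> 1 \<and>
     (\<forall>(S::point set) (col::point \<Rightarrow> color) (ps::point list).
        finite S \<and> set ps = S \<and> distinct ps \<longrightarrow>
        (\<exists>t s. exec prog (input_state ps col) t s \<and>
               t \<le> poly p (card S) \<and>
               is_sbcc S col (output_boxes s) \<and>
               real (card (output_boxes s)) \<le> C * real (min_sbcc_size S col)))"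
proof (rule exI[of _ 1196], rule exI[of _ sbcc_prog], rule exI[of _ "pcompose (time_poly sbcc_prog) [:1196, 1196:]"],
    intro conjI allI impI)
  show "(1196 :: real) \<ge> 1" by simp
  fix S :: "point set" and col :: "point \<Rightarrow> color" and ps :: "point list"
  assume S: "finite S \<and> set ps = S \<and> distinct ps"
  then have n: "card S = length ps" using distinct_card by blast
  obtain t s where ts: "exec sbcc_prog (input_state ps col) t s" "t \<le> time_bound (1196 * Suc (length ps)) sbcc_prog"
    "is_sbcc S col (output_boxes s)" "real (card (output_boxes s)) \<le> 1196 * real (min_sbcc_size S col)"
    using sbcc_prog_correct[of S ps "length ps" col] S unfolding runs_def by blast
  \<comment> \<open>The inner polynomial \<open>[:1196, 1196:]\<close> is 1196 (n + 1), the common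
    bound on the iterations of the loops.\<close>
  have "time_bound (1196 * Suc (length ps)) sbcc_prog = poly (pcompose (time_poly sbcc_prog) [:1196, 1196:]) (card S)"
    by (simp add: poly_pcompose poly_tbp n algebra_simps)
  then show "\<exists>t s. exec sbcc_prog (input_state ps col) t s \<and> t \<le> poly (pcompose (time_poly sbcc_prog) [:1196, 1196:]) (card S) \<and>
    is_sbcc S col (output_boxes s) \<and> real (card (output_boxes s)) \<le> 1196 * real (min_sbcc_size S col)"
    using ts by metis
qed

end
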